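(* Let $K$ be a number field and let $\mathscr{D}G_K:=\varprojlim_{L/K}D_{L/K}$, the inverse limit over finite Galois extensions $L/K$ (inside a fixed algebraic closure $\bar K$) of the finite monoids $D_{L/K}$. Then the unit group of $\mathscr{D}G_K$ is isomorphic to the absolute Galois group $G_K$.
   Context: $P_K$ is the set of non-zero maximal ideals of $O_K$, $I_K$ the monoid of non-zero integral ideals of $K$; $\mathbb{N}$ contains $0$. For a finite Galois extension $L/K$ define $\mathfrak{f}=\mathfrak{f}_{L/K}\in I_K$ by $v_{\mathfrak p}(\mathfrak f):=\min\{e\in\mathbb{N}\mid \mathrm{Gal}^e(L_{\mathfrak P}/K_{\mathfrak p})=1\}$ for each $\mathfrak p\in P_K$, where $\mathfrak P$ is any prime of $L$ over $\mathfrak p$ and $\mathrm{Gal}^e$ denotes the ramification subgroup in the upper numbering. For $\mathfrak d\mid\mathfrak f$ let $L^{(\mathfrak f/\mathfrak d)}$ be the subfield of $L$ fixed by the subgroup of $\mathrm{Gal}(L/K)$ generated by the ramification subgroups $\mathrm{Gal}^{v_{\mathfrak p}(\mathfrak f/\mathfrak d)}(L_{\mathfrak P}/K_{\mathfrak p})$ for all $\mathfrak p\in P_K$ and all $\mathfrak P\mid\mathfrak p$; it is Galois over $K$. $D_{L/K}:=\coprod_{\mathfrak d\mid\mathfrak f}\{\mathfrak d\}\times \mathrm{Gal}(L^{(\mathfrak f/\mathfrak d)}/K)$ is a finite monoid under $(\mathfrak d,\sigma)\cdot(\mathfrak d',\sigma'):=(\mathfrak d'',\sigma\sigma')$, where $\mathfrak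 d''=\gcd(\mathfrak f,\mathfrak d\mathfrak d')$ and the product $\sigma\sigma'$ is taken in $\mathrm{Gal}(L^{(\mathfrak f/\mathfrak d'')}/K)$ after restricting both factors. For $L'\supseteq L\supseteq K$ the transition map $D_{L'/K}\to D_{L/K}$ is $(\mathfrak d',\sigma')\mapsto(\gcd(\mathfrak d',\mathfrak f_{L/K}),\sigma'|)$, with $\sigma'|$ the restriction of $\sigma'$ to $L^{(\mathfrak f_{L/K}/\gcd(\mathfrak d',\mathfrak f_{L/K}))}$. *)

theory Defs
  imports
    "HOL-Analysis.Henstock_Kurzweil_Integration"
    "HOL-Algebra.Bij"
    "HOL-Algebra.Product_Groups"
    "HOL-Algebra.Divisibility"
    "HOL-Algebra.Ideal_Product"
    "HOL-Algebra.Algebraic_Closure_Type"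
begin

text \<open>
  The ambient algebraic closure of the number field \<open>K\<close> is a type \<open>'a\<close>; \<open>K\<close> and its finite
  extensions are subsets of it. The type \<open>'a\<close> is viewed as an HOL-Algebra ring through
  \<^const>\<open>ring_of_type_algebra\<close>.
\<close>

section \<open>Number fields and Galois groups\<close>

definition set_ring :: "'a::field set \<Rightarrow> 'a ring"
  where "set_ring A = ring_of_type_algebra\<lparr>carrier := A\<rparr>"

definition number_field :: "'a::field_char_0 set \<Rightarrow> bool"
  where "number_field K \<longleftrightarrow>
    subfield K ring_of_type_algebra \<and> ring.finite_dimension ring_of_type_algebra \<rat> K"

definition algebraic_over :: "'a::field set \<Rightarrow> 'a \<Rightarrow> bool"
  where "algebraic_over K x \<longleftrightarrow>
    (\<exists>p :: 'a poly. p \<noteq> 0 \<and> (\<forall>i. Polynomial.coeff p i \<in> K) \<and> poly p x = 0)"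

definition aut_fixing :: "('b, 'c) ring_scheme \<Rightarrow> 'b set \<Rightarrow> ('b \<Rightarrow> 'b) monoid"
  where "aut_fixing R S = BijGroup (carrier R)
    \<lparr>carrier := {\<sigma> \<in> Bij (carrier R). \<sigma> \<in> ring_hom R R \<and> (\<forall>x\<in>S. \<sigma> x = x)}\<rparr>"

definition galois_group :: "'a::field set \<Rightarrow> 'a set \<Rightarrow> ('a \<Rightarrow> 'a) monoid"
  where "galois_group K L = aut_fixing (set_ring L) K"

definition fixed_field :: "'a set \<Rightarrow> ('a \<Rightarrow> 'a) set \<Rightarrow> 'a set"
  where "fixed_field L H = {x \<in> L. \<forall>\<sigma>\<in>H. \<sigma> x = x}"

definition finite_galois :: "'a::field set \<Rightarrow> 'a set \<Rightarrow> bool"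
  where "finite_galois K L \<longleftrightarrow>
    subfield L ring_of_type_algebra \<and> K \<subseteq> L \<and>
    ring.finite_dimension ring_of_type_algebra K L \<and>
    fixed_field L (carrier (galois_group K L)) = K"

definition absolute_galois_group :: "'a::field set \<Rightarrow> ('a \<Rightarrow> 'a) monoid"
  where "absolute_galois_group K = galois_group K UNIV"

section \<open>Integral ideals\<close>

definition ring_of_integers :: "'a::field_char_0 set \<Rightarrow> 'a ring"
  where "ring_of_integers K = set_ring {x \<in> K. algebraic_int x}"

definition ideal_monoid :: "'a::field_char_0 set \<Rightarrow> 'a set ring"
  where "ideal_monoid K = ideals_set (ring_of_integers K)
    \<lparr>carrier := {I. ideal I (ring_of_integers K) \<and> I \<noteq> {0}}\<rparr>"

definition primes_of :: "'a::field_char_0 set \<Rightarrow> 'a set set"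
  where "primes_of K = {p. maximalideal p (ring_of_integers K) \<and> p \<noteq> {0}}"

definition primes_over :: "'a::field_char_0 set \<Rightarrow> 'a set \<Rightarrow> 'a set \<Rightarrow> 'a set set"
  where "primes_over K L p = {P \<in> primes_of L. P \<inter> K = p}"

definition ideal_val :: "'a::field_char_0 set \<Rightarrow> 'a set \<Rightarrow> 'a set \<Rightarrow> nat"
  where "ideal_val K p I =
    (GREATEST n. p [^]\<^bsub>ideal_monoid K\<^esub> n divides\<^bsub>ideal_monoid K\<^esub> I)"

definition ideal_gcd :: "'a::field_char_0 set \<Rightarrow> 'a set \<Rightarrow> 'a set \<Rightarrow> 'a set"
  where "ideal_gcd K I J = I <+>\<^bsub>ring_of_integers K\<^esub> J"

definition ideal_quot :: "'a::field_char_0 set \<Rightarrow> 'a set \<Rightarrow> 'a set \<Rightarrow> 'a set"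
  where "ideal_quot K I J =
    (THE C. C \<in> carrier (ideal_monoid K) \<and> J \<otimes>\<^bsub>ideal_monoid K\<^esub> C = I)"

section \<open>Completions\<close>

text \<open>
  For a prime \<open>P\<close> of \<open>L\<close>, \<open>local_power L P k\<close> is the \<open>k\<close>-th power of the maximal ideal of the
  local ring of \<open>P\<close>, that is, the set of \<open>x\<close> in \<open>L\<close> of \<open>P\<close>-adic valuation at least \<open>k\<close>. These
  sets are the basic neighbourhoods of 0 in the \<open>P\<close>-adic topology, and the completion of \<open>L\<close> at
  \<open>P\<close> is the ring of Cauchy sequences modulo null sequences.
\<close>

definition local_power :: "'a::field_char_0 set \<Rightarrow> 'a set \<Rightarrow> nat \<Rightarrow> 'a set"
  where "local_power L P k =
    {a / b | a b. a \<in> P [^]\<^bsub>ideal_monoid L\<^esub> k \<and> b \<in> carrier (ring_of_integers L) - P}"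

definition cauchy_ring :: "'a::field_char_0 set \<Rightarrow> 'a set \<Rightarrow> (nat \<Rightarrow> 'a) ring"
  where "cauchy_ring L P =
    \<lparr>carrier = {s. range s \<subseteq> L \<and> (\<forall>k. \<exists>N. \<forall>m\<ge>N. \<forall>n\<ge>N. s m - s n \<in> local_power L P k)},
     monoid.mult = (\<lambda>s t n. s n * t n), one = (\<lambda>n. 1),
     ring.zero = (\<lambda>n. 0), add = (\<lambda>s t n. s n + t n)\<rparr>"

definition null_ideal :: "'a::field_char_0 set \<Rightarrow> 'a set \<Rightarrow> (nat \<Rightarrow> 'a) set"
  where "null_ideal L P =
    {s \<in> carrier (cauchy_ring L P). \<forall>k. \<exists>N. \<forall>n\<ge>N. s n \<in> local_power L P k}"

definition completion :: "'a::field_char_0 set \<Rightarrow> 'a set \<Rightarrow> (nat \<Rightarrow> 'a) set ring"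
  where "completion L P = cauchy_ring L P Quot null_ideal L P"

definition completion_emb :: "'a::field_char_0 set \<Rightarrow> 'a set \<Rightarrow> 'a \<Rightarrow> (nat \<Rightarrow> 'a) set"
  where "completion_emb L P x = null_ideal L P +>\<^bsub>cauchy_ring L P\<^esub> (\<lambda>n. x)"

text \<open>
  The closure in the completion of a subset \<open>S\<close> of \<open>L\<close>. For \<open>P\<close> over \<open>p\<close>, the closure of \<open>K\<close> is
  the completion of \<open>K\<close> at \<open>p\<close>, and the closure of \<open>local_power L P k\<close> is the \<open>k\<close>-th power of the
  maximal ideal of the complete valuation ring (the valuation ring itself for \<open>k = 0\<close>).
\<close>

definition completion_closure ::
    "'a::field_char_0 set \<Rightarrow> 'a set \<Rightarrow> 'a set \<Rightarrow> (nat \<Rightarrow> 'a) set set"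
  where "completion_closure L P S =
    {A \<in> carrier (completion L P). \<exists>s\<in>A. range s \<subseteq> S}"

definition local_galois_group ::
    "'a::field_char_0 set \<Rightarrow> 'a set \<Rightarrow> 'a set \<Rightarrow> ((nat \<Rightarrow> 'a) set \<Rightarrow> (nat \<Rightarrow> 'a) set) monoid"
  where "local_galois_group K L P = aut_fixing (completion L P) (completion_closure L P K)"

section \<open>Ramification groups\<close>

definition local_ram_lower ::
    "'a::field_char_0 set \<Rightarrow> 'a set \<Rightarrow> 'a set \<Rightarrow> nat \<Rightarrow> ((nat \<Rightarrow> 'a) set \<Rightarrow> (nat \<Rightarrow> 'a) set) set"
  where "local_ram_lower K L P i =
    {\<sigma> \<in> carrier (local_galois_group K L P).
      \<forall>A \<in> completion_closure L P (local_power L P 0).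
        \<sigma> A \<ominus>\<^bsub>completion L P\<^esub> A \<in> completion_closure L P (local_power L P (i + 1))}"

text \<open>
  The local Galois group embeds into the Galois group of \<open>L\<close> over \<open>K\<close> by restriction to \<open>L\<close>.
  From here on its subgroups are identified with their images, in particular in the indices that
  define the Herbrand function.
\<close>

definition ram_lower ::
    "'a::field_char_0 set \<Rightarrow> 'a set \<Rightarrow> 'a set \<Rightarrow> nat \<Rightarrow> ('a \<Rightarrow> 'a) set"
  where "ram_lower K L P i =
    {\<tau> \<in> carrier (galois_group K L). \<exists>\<sigma> \<in> local_ram_lower K L P i.
      \<forall>x\<in>L. \<sigma> (completion_emb L P x) = completion_emb L P (\<tau> x)}"

text \<open>
  The Herbrand function \<open>\<phi>(u)\<close> for \<open>u \<ge> 0\<close>, the integral over \<open>[0, u]\<close> of \<open>1 / [G\<^sub>0 : G\<^sub>t]\<close>, where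
  \<open>G\<^sub>t\<close> means \<open>G\<^sub>i\<close> for the least integer \<open>i \<ge> t\<close>; and \<open>G\<^sup>e\<close> is \<open>G\<^sub>u\<close> for the \<open>u\<close> with \<open>\<phi>(u) = e\<close>.
\<close>

definition herbrand :: "'a::field_char_0 set \<Rightarrow> 'a set \<Rightarrow> 'a set \<Rightarrow> real \<Rightarrow> real"
  where "herbrand K L P u = integral {0..u}
    (\<lambda>t. real (card (ram_lower K L P (nat \<lceil>t\<rceil>))) / real (card (ram_lower K L P 0)))"

definition ram_upper ::
    "'a::field_char_0 set \<Rightarrow> 'a set \<Rightarrow> 'a set \<Rightarrow> nat \<Rightarrow> ('a \<Rightarrow> 'a) set"
  where "ram_upper K L P e =
    ram_lower K L P (nat \<lceil>THE u. u \<ge> 0 \<and> herbrand K L P u = real e\<rceil>)"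

section \<open>The ideal \<open>\<ff>\<close> and the fields \<open>L\<^sup>(\<^sup>\<cc>\<^sup>)\<close>\<close>

text \<open>
  For fixed \<open>p\<close> the groups for the various \<open>P\<close> over \<open>p\<close> are conjugate, so the universal quantifier
  over \<open>P\<close> is the same as a choice of any one \<open>P\<close>. The ideal is determined by its valuations.
\<close>

definition ram_ideal :: "'a::field_char_0 set \<Rightarrow> 'a set \<Rightarrow> 'a set"
  where "ram_ideal K L = (SOME I. I \<in> carrier (ideal_monoid K) \<and>
    (\<forall>p \<in> primes_of K. ideal_val K p I =
      (LEAST e. \<forall>P \<in> primes_over K L p. ram_upper K L P e = {\<one>\<^bsub>galois_group K L\<^esub>})))"

definition ram_field :: "'a::field_char_0 set \<Rightarrow> 'a set \<Rightarrow> 'a set \<Rightarrow> 'a set"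
  where "ram_field K L C = fixed_field L (generate (galois_group K L)
    (\<Union>p \<in> primes_of K. \<Union>P \<in> primes_over K L p. ram_upper K L P (ideal_val K p C)))"

section \<open>The monoids \<open>D\<close> and their inverse limit\<close>

text \<open>\<open>quot_field K L d\<close> is the field written \<open>L\<^sup>(\<^sup>\<ff>\<^sup>/\<^sup>\<dd>\<^sup>)\<close> in the literature.\<close>

definition quot_field :: "'a::field_char_0 set \<Rightarrow> 'a set \<Rightarrow> 'a set \<Rightarrow> 'a set"
  where "quot_field K L d = ram_field K L (ideal_quot K (ram_ideal K L) d)"

definition D_mult :: "'a::field_char_0 set \<Rightarrow> 'a set \<Rightarrow>
    'a set \<times> ('a \<Rightarrow> 'a) \<Rightarrow> 'a set \<times> ('a \<Rightarrow> 'a) \<Rightarrow> 'a set \<times> ('a \<Rightarrow> 'a)"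
  where "D_mult K L = (\<lambda>(d, \<sigma>) (d', \<sigma>').
    let d'' = ideal_gcd K (ram_ideal K L) (d \<otimes>\<^bsub>ideal_monoid K\<^esub> d');
        M = quot_field K L d''
    in (d'', restrict \<sigma> M \<otimes>\<^bsub>galois_group K M\<^esub> restrict \<sigma>' M))"

definition D_monoid :: "'a::field_char_0 set \<Rightarrow> 'a set \<Rightarrow> ('a set \<times> ('a \<Rightarrow> 'a)) monoid"
  where "D_monoid K L =
    \<lparr>carrier = (SIGMA d : {d \<in> carrier (ideal_monoid K). d divides\<^bsub>ideal_monoid K\<^esub> ram_ideal K L}.
       carrier (galois_group K (quot_field K L d))),
     monoid.mult = D_mult K L,
     one = (\<one>\<^bsub>ideal_monoid K\<^esub>, \<one>\<^bsub>galois_group K (quot_field K L \<one>\<^bsub>ideal_monoid K\<^esub>)\<^esub>)\<rparr>"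

definition D_transition :: "'a::field_char_0 set \<Rightarrow> 'a set \<Rightarrow>
    'a set \<times> ('a \<Rightarrow> 'a) \<Rightarrow> 'a set \<times> ('a \<Rightarrow> 'a)"
  where "D_transition K L = (\<lambda>(d', \<sigma>').
    let d = ideal_gcd K d' (ram_ideal K L) in (d, restrict \<sigma>' (quot_field K L d)))"

definition DG :: "'a::field_char_0 set \<Rightarrow> ('a set \<Rightarrow> 'a set \<times> ('a \<Rightarrow> 'a)) monoid"
  where "DG K = product_group {L. finite_galois K L} (D_monoid K)
    \<lparr>carrier := {x \<in> (\<Pi>\<^sub>E L \<in> {L. finite_galois K L}. carrier (D_monoid K L)).
       \<forall>L L'. finite_galois K L \<longrightarrow> finite_galois K L' \<longrightarrow> L \<subseteq> L' \<longrightarrow>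
         D_transition K L (x L') = x L}\<rparr>"

end

theory Submission
  imports
    Defs
    "Jordan_Normal_Form.Char_Poly"
    "HOL-Analysis.Equivalence_Measurable_On_Borel"
begin

text \<open>
  If \<open>(\<dd>, \<sigma>)(\<dd>', \<sigma>') = 1\<close> in \<open>D\<close>, then \<open>\<dd>\<close> contains \<open>gcd(\<ff>, \<dd>\<dd>') = (1)\<close>, so the units of \<open>D\<close> are the pairs
  \<open>((1), \<sigma>)\<close> with \<open>\<sigma>\<close> in the Galois group of \<open>L\<^sup>(\<^sup>\<ff>\<^sup>)\<close>. By the choice of \<open>\<ff>\<close> the ramification groups that cut
  out \<open>L\<^sup>(\<^sup>\<ff>\<^sup>)\<close> are trivial, so this field is \<open>L\<close>, and the units of the limit are the limit of the groups
  \<open>Gal(L/K)\<close>.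

  The substance is that \<open>\<ff>\<close> exists: for each \<open>P\<close> the upper ramification groups are eventually trivial
  and contain 1, for almost all \<open>P\<close> the inertia group is trivial, and there is an ideal with
  prescribed valuations. Unique factorisation of ideals is not needed. All of this follows from the
  finiteness of the quotients of the ring of integers by positive integers, with Nakayama's lemma
  in place of the invertibility of the primes.
\<close>

section \<open>Sums and products of algebraic integers\<close>

text \<open>\<open>ram_ideal\<close>, \<open>ideal_quot\<close>, \<open>ideal_val\<close> and the
  inverse of the Herbrand function are given by choice or description operators, so each says
  something only once a witness is known; this is why a statement about units needs so much
  arithmetic. The obstacle lies in the completion: to have a ring at all, multiplication by an
  element of L with a pole at P must be continuous, and for the ramification groups to become
  trivial the filtration by powers of P must be separated. Both come from one mechanism. Only
  finitely many ideals contain a given nonzero element, so the sums P^j + N with N nonzero become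
  stationary, and Nakayama's lemma turns this into a P^j \<subseteq> N with a outside P; the case N
  = 0 shows that the powers of P descend strictly. From the Herbrand function one takes that it is a
  bijection of the half line with phi(u) \<le> u, which puts G^e inside G_e and gives G^0 = G_0. In
  the limit, coherent automorphisms glue because the finite Galois fields cover the closure and any
  two lie in a third; conversely they are stable under every automorphism over K.\<close>

lemma algebraic_int_if_stable_span:
  fixes z :: "'a::field_char_0" and v :: "nat \<Rightarrow> 'a"
  assumes "i0 < n" "v i0 \<noteq> 0"
    and stable: "\<And>i. i < n \<Longrightarrow> z * v i = (\<Sum>j<n. of_int (A i j) * v j)"
  shows "algebraic_int z"
proof -
  define B where "B = Matrix.mat n n (\<lambda>(i, j). A i j)"
  define C where "C = map_mat (of_int :: int \<Rightarrow> 'a) B"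
  have B: "B \<in> carrier_mat n n" and C: "C \<in> carrier_mat n n" by (auto simp: B_def C_def)
  define w where "w = Matrix.vec n v"
  \<comment> \<open>Stability says that the integer matrix \<open>A\<close> has the nonzero vector
    \<open>v\<close> as an eigenvector for \<open>z\<close>; the characteristic polynomial, of which
    \<open>z\<close> is then a root, is monic with integer coefficients.\<close>
  have "eigenvector C w z"
    unfolding eigenvector_def
  proof (intro conjI)
    show "w \<noteq> 0\<^sub>v (dim_row C)"
      using assms(1,2) C by (metis carrier_matD(1) index_vec index_zero_vec(1) w_def)
    show "C *\<^sub>v w = z \<cdot>\<^sub>v w"
    proof (rule eq_vecI)
      fix i assume "i < dim_vec (z \<cdot>\<^sub>v w)"
      then have i: "i < n" by (simp add: w_def)
      then show "vec_index (C *\<^sub>v w) i = vec_index (z \<cdot>\<^sub>v w) i"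
        using stable[OF i] C
        by (simp add: w_def C_def B_def scalar_prod_def lessThan_atLeast0)
    qed (use C in \<open>simp add: w_def\<close>)
  qed (use C in \<open>simp add: w_def\<close>)
  then have "poly (char_poly C) z = 0"
    using eigenvalue_root_char_poly[OF C] by (auto simp: eigenvalue_def)
  moreover have "char_poly C = map_poly of_int (char_poly B)"
    unfolding C_def by (rule of_int_hom.char_poly_hom[OF B])
  moreover have "Polynomial.lead_coeff (char_poly B) = 1"
    using degree_monic_char_poly[OF B] by simp
  ultimately show ?thesis by (auto simp: algebraic_int_altdef_ipoly)
qed

lemma algebraic_int_power_reduce:
  fixes x :: "'a::field_char_0"
  assumes "algebraic_int x"
  obtains m :: nat and a :: "nat \<Rightarrow> int" where "m > 0" "x ^ m = (\<Sum>i<m. of_int (a i) * x ^ i)"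
proof -
  obtain p :: "int poly" where p: "poly (map_poly of_int p) x = 0" "Polynomial.lead_coeff p = 1"
    using assms by (auto simp: algebraic_int_altdef_ipoly)
  define m where "m = Polynomial.degree p"
  have d: "Polynomial.degree (map_poly (of_int::int \<Rightarrow> 'a) p) = m" by (simp add: m_def degree_map_poly)
  have "m > 0"
  proof (rule ccontr)
    assume "\<not> m > 0"
    then obtain c where "p = [:c:]" by (metis degree_eq_zeroE m_def not_gr_zero)
    with p show False by simp
  qed
  have "0 = (\<Sum>i\<le>m. of_int (Polynomial.coeff p i) * x ^ i)"
    using p(1) by (simp add: poly_altdef d coeff_map_poly flip: m_def)
  also have "\<dots> = (\<Sum>i<m. of_int (Polynomial.coeff p i) * x ^ i) + x ^ m"
    using p(2) unfolding lessThan_Suc_atMost[symmetric] sum.lessThan_Suc by (simp add: m_def)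
  finally have "x ^ m = (\<Sum>i<m. of_int (- Polynomial.coeff p i) * x ^ i)"
    by (simp add: sum_negf eq_neg_iff_add_eq_0 add.commute)
  with \<open>m > 0\<close> that[of m "\<lambda>i. - Polynomial.coeff p i"] show ?thesis by blast
qed

text \<open>The products x^i y^j with i < m and j < n span a group that is stable under x and under
  y, hence under x + y and x y; the stable-span criterion applies to both.\<close>

lemma
  fixes x y :: "'a::field_char_0"
  assumes x: "algebraic_int x" and y: "algebraic_int y"
  shows algebraic_int_add: "algebraic_int (x + y)"
    and algebraic_int_mult: "algebraic_int (x * y)"
proof -
  obtain m a where m: "m > 0" "x ^ m = (\<Sum>i<m. of_int (a i) * x ^ i)"
    using algebraic_int_power_reduce[OF x] by blast
  obtain n b where n: "n > 0" "y ^ n = (\<Sum>i<n. of_int (b i) * y ^ i)"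
    using algebraic_int_power_reduce[OF y] by blast
  \<comment> \<open>The pair (i, j) is coded as k = i n + j; \<open>v 0\<close> = 1 is the nonzero
    entry that the criterion asks for.\<close>
  define v where "v k = x ^ (k div n) * y ^ (k mod n)" for k
  define M where "M = {u. \<exists>c :: nat \<Rightarrow> int. u = (\<Sum>k<m*n. of_int (c k) * v k)}"
  have M_add: "s + t \<in> M" if "s \<in> M" "t \<in> M" for s t
  proof -
    obtain c d where "s = (\<Sum>k<m*n. of_int (c k) * v k)" "t = (\<Sum>k<m*n. of_int (d k) * v k)"
      using \<open>s \<in> M\<close> \<open>t \<in> M\<close> by (auto simp: M_def)
    then have "s + t = (\<Sum>k<m*n. of_int (c k + d k) * v k)"
      by (simp add: sum.distrib algebra_simps)
    then show ?thesis unfolding M_def mem_Collect_eq by (rule exI[of _ "\<lambda>k. c k + d k"])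
  qed
  have M_scale: "of_int r * s \<in> M" if "s \<in> M" for r s
  proof -
    obtain c where "s = (\<Sum>k<m*n. of_int (c k) * v k)"
      using \<open>s \<in> M\<close> by (auto simp: M_def)
    then have "of_int r * s = (\<Sum>k<m*n. of_int (r * c k) * v k)"
      by (simp add: sum_distrib_left algebra_simps)
    then show ?thesis unfolding M_def mem_Collect_eq by (rule exI[of _ "\<lambda>k. r * c k"])
  qed
  have M_sum: "(\<Sum>i\<in>I. f i) \<in> M" if "finite I" "\<And>i. i \<in> I \<Longrightarrow> f i \<in> M" for I :: "nat set" and f
  proof -
    have "0 \<in> M" unfolding M_def by (auto intro!: exI[of _ "\<lambda>_. 0"])
    with that show ?thesis by (induction rule: finite_induct) (auto intro: M_add)
  qed
  have M_v: "v k \<in> M" if "k < m * n" for k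
  proof -
    have "(\<Sum>l<m*n. of_int (if l = k then 1 else 0) * v l) = (\<Sum>l<m*n. if l = k then v l else 0)"
      by (rule sum.cong) auto
    also have "\<dots> = v k" using that by simp
    finally show ?thesis unfolding M_def by (auto intro!: exI[of _ "\<lambda>l. if l = k then 1 else 0"])
  qed
  have xy: "x ^ i * y ^ j \<in> M" if "i < m" "j < n" for i j
  proof -
    have "i * n + j < m * n"
    proof -
      have "i * n + j < Suc i * n" using that(2) by simp
      also have "\<dots> \<le> m * n" using that(1) by (intro mult_right_mono) auto
      finally show ?thesis .
    qed
    moreover have "v (i * n + j) = x ^ i * y ^ j" using that(2) by (simp add: v_def)
    ultimately show ?thesis using M_v by metis
  qed
  have xM: "x * v k \<in> M" and yM: "y * v k \<in> M" if "k < m * n" for k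
  proof -
    define i j where "i = k div n" and "j = k mod n"
    have i: "i < m" and j: "j < n"
      using that n(1) by (auto simp: i_def j_def less_mult_imp_div_less)
    have vk: "v k = x ^ i * y ^ j" by (simp add: v_def i_def j_def)
    show "x * v k \<in> M"
    proof (cases "Suc i < m")
      case True
      then show ?thesis using xy[OF True j] by (simp add: vk mult_ac)
    next
      \<comment> \<open>Only the top exponent leaves the spanning set, and \<open>m(2)\<close>
        rewrites x^m in lower powers.\<close>
      case False
      with i have "Suc i = m" by simp
      then have "x * v k = x ^ m * y ^ j" by (auto simp: vk)
      also have "\<dots> = (\<Sum>l<m. of_int (a l) * (x ^ l * y ^ j))"
        unfolding m(2) by (simp add: sum_distrib_right mult.assoc)
      also have "\<dots> \<in> M" using xy j by (intro M_sum M_scale) auto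
      finally show ?thesis .
    qed
    show "y * v k \<in> M"
    proof (cases "Suc j < n")
      case True
      then show ?thesis using xy[OF i True] by (simp add: vk mult_ac)
    next
      case False
      with j have "Suc j = n" by simp
      then have "y * v k = y ^ n * x ^ i" by (auto simp: vk)
      also have "\<dots> = (\<Sum>l<n. of_int (b l) * (x ^ i * y ^ l))"
        unfolding n(2) by (subst sum_distrib_right) (simp add: mult_ac)
      also have "\<dots> \<in> M" using xy i by (intro M_sum M_scale) auto
      finally show ?thesis .
    qed
  qed
  have int: "algebraic_int z" if z: "\<And>k. k < m * n \<Longrightarrow> z * v k \<in> M" for z
  proof -
    have "\<forall>k. \<exists>c. k < m * n \<longrightarrow> z * v k = (\<Sum>l<m*n. of_int (c l :: int) * v l)"
      using z unfolding M_def by blast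
    then obtain A where "\<And>k. k < m * n \<Longrightarrow> z * v k = (\<Sum>l<m*n. of_int (A k l :: int) * v l)"
      by metis
    moreover have "0 < m * n" "v 0 \<noteq> 0" using m n by (auto simp: v_def)
    ultimately show ?thesis by (rule algebraic_int_if_stable_span[rotated 2])
  qed
  show "algebraic_int (x + y)"
    using xM yM by (intro int) (auto simp: distrib_right intro: M_add)
  \<comment> \<open>For x y, the element \<open>y * v k\<close> is a combination and not a single
    generator, so stability under x is needed on all of \<open>M\<close>.\<close>
  have xM': "x * s \<in> M" if "s \<in> M" for s
  proof -
    obtain c where "s = (\<Sum>k<m*n. of_int (c k) * v k)"
      using \<open>s \<in> M\<close> by (auto simp: M_def)
    then have "x * s = (\<Sum>k<m*n. of_int (c k) * (x * v k))"
      by (simp add: sum_distrib_left algebra_simps)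
    also have "\<dots> \<in> M" by (intro M_sum M_scale xM) auto
    finally show ?thesis .
  qed
  show "algebraic_int (x * y)"
    using yM by (intro int) (simp add: mult.assoc xM')
qed

section \<open>Subrings and subfields of the ambient field\<close>

abbreviation ring_univ :: "'a::field ring" ("\<R>") where "\<R> \<equiv> ring_of_type_algebra"

lemma ring_univ_simps [simp]:
  "carrier \<R> = UNIV" "x \<otimes>\<^bsub>\<R>\<^esub> y = x * y" "x \<oplus>\<^bsub>\<R>\<^esub> y = x + y"
  "\<one>\<^bsub>\<R>\<^esub> = 1" "\<zero>\<^bsub>\<R>\<^esub> = 0"
  by (simp_all add: ring_of_type_algebra_def)

lemma ring_univ_a_inv [simp]: "\<ominus>\<^bsub>\<R>\<^esub> x = - x"
proof -
  interpret field "\<R> :: 'a ring" by (rule field_from_type_algebra)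
  show ?thesis by (rule minus_equality) auto
qed

lemma ring_univ_m_inv: "x \<noteq> 0 \<Longrightarrow> inv\<^bsub>\<R>\<^esub> x = inverse x"
proof -
  assume "x \<noteq> 0"
  interpret field "\<R> :: 'a ring" by (rule field_from_type_algebra)
  show ?thesis using \<open>x \<noteq> 0\<close> by (intro inv_unique'[symmetric]) auto
qed

lemma ring_univ_nat_pow [simp]: "x [^]\<^bsub>\<R>\<^esub> (n::nat) = x ^ n"
  by (induction n) (auto simp: mult.commute)

lemma set_ring_simps [simp]:
  "carrier (set_ring A) = A" "x \<otimes>\<^bsub>set_ring A\<^esub> y = x * y" "x \<oplus>\<^bsub>set_ring A\<^esub> y = x + y"
  "\<one>\<^bsub>set_ring A\<^esub> = 1" "\<zero>\<^bsub>set_ring A\<^esub> = 0"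
  by (simp_all add: set_ring_def ring_of_type_algebra_def)

lemma subring_iff:
  "subring A \<R> \<longleftrightarrow> 0 \<in> A \<and> 1 \<in> A \<and> (\<forall>x\<in>A. -x \<in> A) \<and> (\<forall>x\<in>A. \<forall>y\<in>A. x + y \<in> A \<and> x * y \<in> A)"
proof -
  interpret field "\<R> :: 'a ring" by (rule field_from_type_algebra)
  show ?thesis
  proof
    assume "subring A \<R>"
    from subringE[OF this] show "0 \<in> A \<and> 1 \<in> A \<and> (\<forall>x\<in>A. -x \<in> A) \<and> (\<forall>x\<in>A. \<forall>y\<in>A. x + y \<in> A \<and> x * y \<in> A)"
      by auto
  qed (intro subringI, auto)
qed

lemma subfield_inverse_closed:
  assumes "subfield A \<R>" "x \<in> A"
  shows "inverse x \<in> A"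
proof (cases "x = 0")
  case False
  interpret field "\<R> :: 'a ring" by (rule field_from_type_algebra)
  have "inv\<^bsub>\<R>\<^esub> x \<in> A - {\<zero>\<^bsub>\<R>\<^esub>}"
    using assms(2) False by (intro subfield_m_inv(1)[OF assms(1)]) simp
  then show ?thesis using ring_univ_m_inv[OF False] by simp
qed (use assms in simp)

lemma subfieldI_univ:
  assumes "subring A \<R>" "\<And>x. x \<in> A \<Longrightarrow> inverse x \<in> A"
  shows "subfield A \<R>"
proof -
  interpret field "\<R> :: 'a ring" by (rule field_from_type_algebra)
  show ?thesis
  proof (rule subfieldI'[OF assms(1)])
    fix k assume "k \<in> A - {\<zero>\<^bsub>\<R>\<^esub>}"
    then show "inv\<^bsub>\<R>\<^esub> k \<in> A" using assms(2) ring_univ_m_inv[of k] by simp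
  qed
qed

lemma subfield_iff:
  "subfield A \<R> \<longleftrightarrow> 0 \<in> A \<and> 1 \<in> A \<and> (\<forall>x\<in>A. -x \<in> A \<and> inverse x \<in> A) \<and> (\<forall>x\<in>A. \<forall>y\<in>A. x + y \<in> A \<and> x * y \<in> A)"
  using subfieldE(1)[of A \<R>] subfield_inverse_closed[of A] subfieldI_univ[of A]
  unfolding subring_iff by blast

context
  fixes A :: "'a::field set" assumes A: "subfield A \<R>"
begin

lemma subfield_zero: "0 \<in> A" and subfield_one: "1 \<in> A"
  and subfield_uminus: "x \<in> A \<Longrightarrow> - x \<in> A" and subfield_inverse: "x \<in> A \<Longrightarrow> inverse x \<in> A"
  and subfield_add: "x \<in> A \<Longrightarrow> y \<in> A \<Longrightarrow> x + y \<in> A"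
  and subfield_mult: "x \<in> A \<Longrightarrow> y \<in> A \<Longrightarrow> x * y \<in> A"
  using A by (auto simp: subfield_iff)

lemma subfield_diff: "x \<in> A \<Longrightarrow> y \<in> A \<Longrightarrow> x - y \<in> A"
  using subfield_add[of x "- y"] subfield_uminus by simp

lemma subfield_divide: "x \<in> A \<Longrightarrow> y \<in> A \<Longrightarrow> x / y \<in> A"
  using subfield_mult[of x "inverse y"] subfield_inverse by (simp add: divide_inverse)

lemma subfield_sum: "(\<And>i. i \<in> I \<Longrightarrow> f i \<in> A) \<Longrightarrow> sum f I \<in> A"
  by (induction I rule: infinite_finite_induct) (auto intro: subfield_zero subfield_add)

lemma subfield_of_nat: "of_nat n \<in> A"
  by (induction n) (auto intro: subfield_zero subfield_one subfield_add)

lemma subfield_of_int: "of_int i \<in> A"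
  by (cases i rule: int_cases2) (auto intro: subfield_of_nat subfield_uminus)

end

lemmas subfield_closed = subfield_zero subfield_one subfield_uminus subfield_inverse subfield_add
  subfield_mult subfield_diff subfield_divide subfield_sum subfield_of_nat subfield_of_int

section \<open>Homomorphisms of subfields and polynomials\<close>

text \<open>Polynomials live over the ambient field and the smaller field is a predicate on
  coefficients, so one type of polynomials serves all subfields at once.\<close>

definition poly_over :: "'a::field set \<Rightarrow> 'a poly \<Rightarrow> bool"
  where "poly_over F p \<longleftrightarrow> (\<forall>i. Polynomial.coeff p i \<in> F)"

text \<open>The leading coefficient is not normalised: \<open>m\<close> is determined up to a
  scalar, and arguments go through minimality of the degree.\<close>

definition min_poly :: "'a::field set \<Rightarrow> 'a \<Rightarrow> 'a poly \<Rightarrow> bool"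
  where "min_poly F x m \<longleftrightarrow> poly_over F m \<and> m \<noteq> 0 \<and> poly m x = 0 \<and>
    (\<forall>q. poly_over F q \<longrightarrow> q \<noteq> 0 \<longrightarrow> poly q x = 0 \<longrightarrow> Polynomial.degree m \<le> Polynomial.degree q)"

text \<open>Values outside \<open>F\<close> are unconstrained, so a restriction is the same function
  read on a smaller set. On a subfield, \<open>\<phi> 1 = 1\<close> forces injectivity.\<close>

definition hom_on :: "'a::field set \<Rightarrow> ('a \<Rightarrow> 'a) \<Rightarrow> bool"
  where "hom_on F \<phi> \<longleftrightarrow> \<phi> 1 = 1 \<and> (\<forall>x\<in>F. \<forall>y\<in>F. \<phi> (x + y) = \<phi> x + \<phi> y \<and> \<phi> (x * y) = \<phi> x * \<phi> y)"

lemma hom_on_subset: "hom_on E \<phi> \<Longrightarrow> F \<subseteq> E \<Longrightarrow> hom_on F \<phi>"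
  by (auto simp: hom_on_def subset_iff)

lemma poly_over_mono: "poly_over F p \<Longrightarrow> F \<subseteq> E \<Longrightarrow> poly_over E p"
  by (auto simp: poly_over_def)

lemma poly_over_pCons: "poly_over F (pCons a p) \<longleftrightarrow> a \<in> F \<and> poly_over F p"
  unfolding poly_over_def by (metis coeff_pCons_0 coeff_pCons_Suc not0_implies_Suc)

context
  fixes F :: "'a::field set" assumes F: "subfield F \<R>"
begin

lemma poly_over_0: "poly_over F 0" and poly_over_1: "poly_over F 1"
  using subfield_zero[OF F] subfield_one[OF F] by (auto simp: poly_over_def)

lemma poly_over_diff: "poly_over F p \<Longrightarrow> poly_over F q \<Longrightarrow> poly_over F (p - q)"
  using subfield_diff[OF F] by (auto simp: poly_over_def)

lemma poly_over_mult: "poly_over F p \<Longrightarrow> poly_over F q \<Longrightarrow> poly_over F (p * q)"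
  by (auto simp: poly_over_def coeff_mult intro!: subfield_sum[OF F] subfield_mult[OF F])

lemma poly_over_prod: "(\<And>i. i \<in> I \<Longrightarrow> poly_over F (f i)) \<Longrightarrow> poly_over F (prod f I)"
  by (induction I rule: infinite_finite_induct) (auto intro: poly_over_1 poly_over_mult)

lemma poly_over_monom: "c \<in> F \<Longrightarrow> poly_over F (Polynomial.monom c n)"
  using subfield_zero[OF F] by (auto simp: poly_over_def)

lemma poly_over_eval: "poly_over F p \<Longrightarrow> x \<in> F \<Longrightarrow> poly p x \<in> F"
  by (induction p) (auto simp: poly_over_pCons intro: subfield_zero[OF F] subfield_add[OF F] subfield_mult[OF F])

lemma poly_over_pderiv: "poly_over F p \<Longrightarrow> poly_over F (pderiv p)"
  using subfield_mult[OF F subfield_of_nat[OF F]] by (simp add: poly_over_def coeff_pderiv del: of_nat_Suc)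

text \<open>One step of long division, cancelling the leading term of \<open>p\<close>; induction on
  the degree of \<open>p\<close> iterates it where it is used.\<close>

lemma poly_over_reduce:
  assumes "poly_over F p" "poly_over F m" "m \<noteq> 0" "p \<noteq> 0" "Polynomial.degree m \<le> Polynomial.degree p"
  obtains q r where "poly_over F q" "poly_over F r" "p = q * m + r"
    "r = 0 \<or> Polynomial.degree r < Polynomial.degree p"
proof -
  define d where "d = Polynomial.degree p - Polynomial.degree m"
  define c where "c = Polynomial.lead_coeff p / Polynomial.lead_coeff m"
  define q where "q = Polynomial.monom c d"
  define r where "r = p - q * m"
  have "c \<noteq> 0" using assms by (simp add: c_def)
  have "c \<in> F" using assms by (simp add: c_def poly_over_def subfield_divide[OF F])
  then have q: "poly_over F q" by (simp add: q_def poly_over_monom)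
  have lq: "Polynomial.degree q = d" "Polynomial.coeff q d = c" "q \<noteq> 0"
    using \<open>c \<noteq> 0\<close> by (simp_all add: q_def degree_monom_eq monom_eq_0_iff)
  have dq: "Polynomial.degree (q * m) = Polynomial.degree p"
    unfolding degree_mult_eq[OF lq(3) assms(3)] lq(1) using assms(5) by (simp add: d_def)
  have "Polynomial.lead_coeff (q * m) = Polynomial.lead_coeff p"
    unfolding lead_coeff_mult lq using assms(3) by (simp add: c_def)
  then have "Polynomial.coeff r (Polynomial.degree p) = 0" by (simp add: r_def dq)
  moreover have "Polynomial.degree r \<le> Polynomial.degree p"
    unfolding r_def by (rule degree_diff_le) (simp_all add: dq)
  ultimately have "r = 0 \<or> Polynomial.degree r < Polynomial.degree p"
    using eq_zero_or_degree_less by blast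
  moreover have "poly_over F r" using assms q by (simp add: r_def poly_over_diff poly_over_mult)
  moreover have "p = q * m + r" by (simp add: r_def)
  ultimately show ?thesis using q by (intro that)
qed

lemma min_poly_exists:
  assumes "algebraic_over F x"
  obtains m where "min_poly F x m"
proof -
  define P where "P p \<longleftrightarrow> poly_over F p \<and> p \<noteq> 0 \<and> poly p x = 0" for p
  obtain p where "P p" using assms by (auto simp: algebraic_over_def P_def poly_over_def)
  define m where "m = arg_min Polynomial.degree P"
  have "P m" using arg_min_natI[of P p Polynomial.degree] \<open>P p\<close> by (simp add: m_def)
  moreover have "Polynomial.degree m \<le> Polynomial.degree q" if "P q" for q
    using arg_min_nat_le[of P q Polynomial.degree] that by (simp add: m_def)
  ultimately show ?thesis using that unfolding P_def min_poly_def by blast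
qed

text \<open>Bridge to the extension theory of HOL-Algebra, whose polynomials are coefficient lists
  headed by the leading coefficient; reversing the list translates between the two notions.\<close>

lemma algebraic_over_iff: "algebraic_over F x \<longleftrightarrow> (ring.algebraic \<R> over F) x"
proof -
  interpret R: field "\<R> :: 'a ring" by (rule field_from_type_algebra)
  have eval: "R.eval p x = poly (Poly (rev p)) x" for p
    by (induction p) (auto simp: Poly_snoc poly_monom)
  show ?thesis
  proof
    assume "algebraic_over F x"
    then obtain p where p: "poly_over F p" "p \<noteq> 0" "poly p x = 0"
      by (auto simp: algebraic_over_def poly_over_def)
    define q where "q = rev (coeffs p)"
    have "q \<noteq> []" using p by (simp add: q_def)
    moreover have "q \<in> carrier (F[X]\<^bsub>\<R>\<^esub>)"
      using p by (auto simp: q_def univ_poly_def polynomial_def coeffs_def poly_over_def last_coeffs_eq_coeff_degree hd_rev)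
    moreover have "R.eval q x = \<zero>\<^bsub>\<R>\<^esub>" using p by (simp add: eval q_def)
    ultimately show "(R.algebraic over F) x" using R.algebraicI by blast
  next
    assume "(R.algebraic over F) x"
    then obtain q where q: "q \<in> carrier (F[X]\<^bsub>\<R>\<^esub>)" "q \<noteq> []" "R.eval q x = 0"
      using R.algebraicE[OF subfieldE(1)[OF F]] by (metis UNIV_I ring_univ_simps(1,5))
    have "poly_over F (Poly (rev q))"
      using q subfield_zero[OF F] by (auto simp: poly_over_def univ_poly_def polynomial_def nth_default_def)
        (metis in_mono length_rev nth_mem set_rev)
    moreover have "Poly (rev q) \<noteq> 0"
    proof
      assume "Poly (rev q) = 0"
      moreover have "Polynomial.coeff (Poly (rev q)) (length q - 1) = hd q"
        using q(2) by (simp add: nth_default_def rev_nth hd_conv_nth)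
      ultimately show False using q by (auto simp: univ_poly_def polynomial_def)
    qed
    ultimately show "algebraic_over F x" using q(3) by (auto simp: algebraic_over_def poly_over_def eval)
  qed
qed

context
  fixes \<phi> assumes \<phi>: "hom_on F \<phi>"
begin

lemma hom_on_add: "x \<in> F \<Longrightarrow> y \<in> F \<Longrightarrow> \<phi> (x + y) = \<phi> x + \<phi> y"
  and hom_on_mult: "x \<in> F \<Longrightarrow> y \<in> F \<Longrightarrow> \<phi> (x * y) = \<phi> x * \<phi> y"
  and hom_on_one: "\<phi> 1 = 1"
  using \<phi> by (auto simp: hom_on_def)

lemma hom_on_zero: "\<phi> 0 = 0"
  using hom_on_add[of 0 0] subfield_zero[OF F] by (metis add_cancel_right_right add.right_neutral)

lemma hom_on_uminus: "x \<in> F \<Longrightarrow> \<phi> (- x) = - \<phi> x"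
  using hom_on_add[of x "- x"] subfield_uminus[OF F, of x] by (simp add: hom_on_zero eq_neg_iff_add_eq_0 add.commute)

lemma hom_on_diff: "x \<in> F \<Longrightarrow> y \<in> F \<Longrightarrow> \<phi> (x - y) = \<phi> x - \<phi> y"
  using hom_on_add[of x "- y"] subfield_uminus[OF F, of y] by (simp add: hom_on_uminus)

lemma hom_on_eq_0_iff: "x \<in> F \<Longrightarrow> \<phi> x = 0 \<longleftrightarrow> x = 0"
proof
  assume x: "x \<in> F" "\<phi> x = 0"
  show "x = 0"
  proof (rule ccontr)
    assume "x \<noteq> 0"
    then have "\<phi> (x * inverse x) = 1" by (simp add: hom_on_one)
    with x show False using hom_on_mult[of x "inverse x"] subfield_inverse[OF F] by auto
  qed
qed (simp add: hom_on_zero)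

lemma hom_on_inj: "inj_on \<phi> F"
proof (rule inj_onI)
  fix x y assume "x \<in> F" "y \<in> F" "\<phi> x = \<phi> y"
  then show "x = y" using hom_on_eq_0_iff[of "x - y"] subfield_diff[OF F] by (simp add: hom_on_diff)
qed

lemma hom_on_sum: "(\<And>i. i \<in> I \<Longrightarrow> f i \<in> F) \<Longrightarrow> \<phi> (sum f I) = (\<Sum>i\<in>I. \<phi> (f i))"
proof (induction I rule: infinite_finite_induct)
  case (insert i I)
  then have "\<phi> (f i + sum f I) = \<phi> (f i) + \<phi> (sum f I)"
    by (intro hom_on_add subfield_sum[OF F]) auto
  with insert show ?case by simp
qed (auto simp: hom_on_zero)

lemma coeff_map_hom: "Polynomial.coeff (map_poly \<phi> p) i = \<phi> (Polynomial.coeff p i)"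
  by (simp add: coeff_map_poly hom_on_zero)

lemma map_hom_pCons: "map_poly \<phi> (pCons a p) = pCons (\<phi> a) (map_poly \<phi> p)"
  by (rule poly_eqI) (simp add: coeff_map_hom coeff_pCons split: nat.split)

lemma map_hom_degree:
  assumes "poly_over F p"
  shows "Polynomial.degree (map_poly \<phi> p) = Polynomial.degree p"
proof (cases "p = 0")
  case False
  then have "Polynomial.coeff (map_poly \<phi> p) (Polynomial.degree p) \<noteq> 0"
    using assms by (simp add: coeff_map_hom hom_on_eq_0_iff poly_over_def)
  then show ?thesis by (intro antisym degree_map_poly_le le_degree)
qed simp

lemma map_hom_add: "poly_over F p \<Longrightarrow> poly_over F q \<Longrightarrow> map_poly \<phi> (p + q) = map_poly \<phi> p + map_poly \<phi> q"
  by (rule poly_eqI) (simp add: coeff_map_hom poly_over_def hom_on_add)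

lemma map_hom_mult:
  assumes "poly_over F p" "poly_over F q"
  shows "map_poly \<phi> (p * q) = map_poly \<phi> p * map_poly \<phi> q"
  using assms subfield_mult[OF F]
  by (intro poly_eqI) (simp add: coeff_map_hom poly_over_def coeff_mult hom_on_sum hom_on_mult)

lemma map_hom_poly:
  assumes "poly_over F p" "x \<in> F"
  shows "\<phi> (poly p x) = poly (map_poly \<phi> p) (\<phi> x)"
  using assms(1)
proof (induction p)
  case (pCons a p)
  then show ?case using assms(2)
    by (simp add: poly_over_pCons map_hom_pCons hom_on_add hom_on_mult
        subfield_mult[OF F] poly_over_eval)
qed (simp add: hom_on_zero)

lemma hom_on_image_subring:
  "subring (\<phi> ` F) \<R>"
  unfolding subring_iff
proof (intro conjI ballI)
  show "0 \<in> \<phi> ` F" using hom_on_zero subfield_zero[OF F] by force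
  show "1 \<in> \<phi> ` F" using hom_on_one subfield_one[OF F] by force
next
  fix x y assume "x \<in> \<phi> ` F" "y \<in> \<phi> ` F"
  then obtain u v where "u \<in> F" "v \<in> F" "x = \<phi> u" "y = \<phi> v" by auto
  then show "x + y \<in> \<phi> ` F" "x * y \<in> \<phi> ` F"
    using subfield_add[OF F] subfield_mult[OF F] by (auto simp flip: hom_on_add hom_on_mult)
next
  fix x assume "x \<in> \<phi> ` F"
  then show "- x \<in> \<phi> ` F" using subfield_uminus[OF F] by (auto simp flip: hom_on_uminus)
qed

end

end

text \<open>\<open>\<phi>\<close> fixes the coefficients of \<open>P\<close>, so it sends roots to
  roots; being injective on a finite set, it is onto.\<close>

lemma hom_on_permutes_roots:
  assumes "subfield E \<R>" "hom_on E \<phi>" "poly_over K P" "K \<subseteq> E" "\<And>x. x \<in> K \<Longrightarrow> \<phi> x = x"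
    and "P \<noteq> 0" "{z. poly P z = 0} \<subseteq> E"
  shows "\<phi> ` {z. poly P z = 0} = {z. poly P z = 0}"
proof (rule endo_inj_surj)
  show "finite {z. poly P z = 0}" using assms(6) by (rule poly_roots_finite)
  show "inj_on \<phi> {z. poly P z = 0}"
    using hom_on_inj[OF assms(1,2)] assms(7) by (rule inj_on_subset)
  have "map_poly \<phi> P = P"
    using assms(3,5) by (intro poly_eqI) (simp add: coeff_map_hom[OF assms(1,2)] poly_over_def)
  moreover have "\<phi> (poly P z) = poly (map_poly \<phi> P) (\<phi> z)" if "z \<in> E" for z
    using map_hom_poly[OF assms(1,2) poly_over_mono[OF assms(3,4)] that] .
  ultimately have "poly P (\<phi> z) = \<phi> (poly P z)" if "z \<in> E" for z
    using that by simp
  then show "\<phi> ` {z. poly P z = 0} \<subseteq> {z. poly P z = 0}"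
    using hom_on_zero[OF assms(1,2)] assms(7) by auto
qed

section \<open>Extending homomorphisms along finite algebraic extensions\<close>

abbreviation "simple_ext \<equiv> ring.simple_extension \<R>"
abbreviation "finite_ext \<equiv> ring.finite_extension \<R>"

lemma simple_ext_poly:
  fixes F :: "'a::field set"
  assumes "subfield F \<R>" "z \<in> simple_ext F x"
  obtains q where "poly_over F q" "z = poly q x"
proof -
  interpret R: field "\<R> :: 'a ring" by (rule field_from_type_algebra)
  have "\<exists>q. poly_over F q \<and> z = poly q x"
    using assms(2)
  proof (induction rule: R.simple_extension.induct)
    case zero
    then show ?case using poly_over_0[OF assms(1)] by (intro exI[of _ 0]) auto
  next
    case (lin k1 k2)
    then obtain q where "poly_over F q" "k1 = poly q x" by auto
    with lin show ?case by (intro exI[of _ "pCons k2 q"]) (auto simp: poly_over_pCons)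
  qed
  with that show ?thesis by blast
qed

text \<open>The extension has to send q(x) to the value at y of q with its coefficients moved by
  \<open>\<phi>\<close>. It is well defined because a polynomial over F that vanishes at x is a
  multiple of m, and the image of m vanishes at y.\<close>

lemma hom_on_extend_simple:
  fixes F :: "'a::field set"
  assumes F: "subfield F \<R>" and \<phi>: "hom_on F \<phi>"
    and min: "min_poly F x m" and y: "poly (map_poly \<phi> m) y = 0"
  obtains \<psi> where "hom_on (simple_ext F x) \<psi>" "\<And>z. z \<in> F \<Longrightarrow> \<psi> z = \<phi> z" "\<psi> x = y"
proof -
  have m: "poly_over F m" "m \<noteq> 0" and mx: "poly m x = 0"
    using min by (auto simp: min_poly_def)
  \<comment> \<open>Subtracting a multiple of \<open>m\<close> lowers the degree, and the remainder
    still vanishes at \<open>x\<close>.\<close>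
  have ker: "poly (map_poly \<phi> p) y = 0" if "poly_over F p" "poly p x = 0" for p
    using that
  proof (induction "Polynomial.degree p" arbitrary: p rule: less_induct)
    case less
    show ?case
    proof (cases "p = 0")
      case False
      then obtain q r where qr: "poly_over F q" "poly_over F r" "p = q * m + r"
          "r = 0 \<or> Polynomial.degree r < Polynomial.degree p"
        using poly_over_reduce[OF F less(2) m] min less(2,3) unfolding min_poly_def by metis
      have "poly r x = 0" using qr(3) less(3) mx by simp
      then have "poly (map_poly \<phi> r) y = 0" using qr less(1)[of r] by auto
      then show ?thesis
        using qr m(1) y by (simp add: map_hom_add[OF F \<phi>] map_hom_mult[OF F \<phi>] poly_over_mult[OF F])
    qed auto
  qed
  \<comment> \<open>An arbitrary representing polynomial; \<open>ker\<close>, applied to the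
    difference of two representatives, makes the value independent of the choice.\<close>
  define Q where "Q z = (SOME q. poly_over F q \<and> z = poly q x)" for z
  define \<psi> where "\<psi> z = poly (map_poly \<phi> (Q z)) y" for z
  have \<psi>: "\<psi> (poly q x) = poly (map_poly \<phi> q) y" if q: "poly_over F q" for q
  proof -
    define q' where "q' = Q (poly q x)"
    have q': "poly_over F q'" "poly q x = poly q' x"
      using someI[of "\<lambda>p. poly_over F p \<and> poly q x = poly p x" q] q by (auto simp: q'_def Q_def)
    have "poly (map_poly \<phi> (q' - q)) y = 0"
      using q q' by (intro ker poly_over_diff[OF F]) auto
    moreover have "map_poly \<phi> q' = map_poly \<phi> (q' - q) + map_poly \<phi> q"
      using map_hom_add[OF F \<phi> poly_over_diff[OF F q'(1) q] q] by simp
    ultimately show ?thesis by (simp add: \<psi>_def q'_def)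
  qed
  show ?thesis
  proof
    have c: "\<psi> z = \<phi> z" if "z \<in> F" for z
      using \<psi>[of "[:z:]"] that by (simp add: poly_over_pCons poly_over_0[OF F] map_hom_pCons[OF F \<phi>])
    then show "\<psi> z = \<phi> z" if "z \<in> F" for z using that .
    show "\<psi> x = y"
      using \<psi>[of "[:0, 1:]"] subfield_zero[OF F] subfield_one[OF F]
      by (simp add: poly_over_pCons poly_over_0[OF F] map_hom_pCons[OF F \<phi>] hom_on_one[OF F \<phi>] hom_on_zero[OF F \<phi>])
    show "hom_on (simple_ext F x) \<psi>"
      unfolding hom_on_def
    proof (intro conjI ballI)
      show "\<psi> 1 = 1" using c[OF subfield_one[OF F]] hom_on_one[OF F \<phi>] by simp
    next
      fix u v assume "u \<in> simple_ext F x" "v \<in> simple_ext F x"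
      then obtain p q where p: "poly_over F p" "u = poly p x" and q: "poly_over F q" "v = poly q x"
        by (meson simple_ext_poly[OF F])
      have "poly_over F (p + q)" using p q subfield_add[OF F] by (auto simp: poly_over_def)
      from \<psi>[OF this] show "\<psi> (u + v) = \<psi> u + \<psi> v"
        using p q by (simp add: \<psi> map_hom_add[OF F \<phi>])
      from \<psi>[OF poly_over_mult[OF F p(1) q(1)]] show "\<psi> (u * v) = \<psi> u * \<psi> v"
        using p q by (simp add: \<psi> map_hom_mult[OF F \<phi>])
    qed
  qed
qed

lemma algebraic_over_mono: "algebraic_over F x \<Longrightarrow> F \<subseteq> E \<Longrightarrow> algebraic_over E x"
  unfolding algebraic_over_def by blast

lemma subfield_finite_ext:
  fixes F :: "'a::field set"
  assumes "subfield F \<R>" "\<And>x. x \<in> set xs \<Longrightarrow> algebraic_over F x"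
  shows "subfield (finite_ext F xs) \<R>" "F \<subseteq> finite_ext F xs" "set xs \<subseteq> finite_ext F xs"
    "ring.finite_dimension \<R> F (finite_ext F xs)"
proof -
  interpret R: field "\<R> :: 'a ring" by (rule field_from_type_algebra)
  show "subfield (finite_ext F xs) \<R>" "F \<subseteq> finite_ext F xs" "set xs \<subseteq> finite_ext F xs"
    "ring.finite_dimension \<R> F (finite_ext F xs)"
    using R.finite_extension_is_subfield[OF assms(1)] R.finite_extension_finite_dimension(1)[OF assms(1)]
      R.finite_extension_incl R.finite_extension_mem[OF subfieldE(1)[OF assms(1)]] assms(2)
      algebraic_over_iff[OF assms(1)] by auto
qed

text \<open>Generators are adjoined one at a time. Moving the coefficients of the minimal polynomial
  by an injective map keeps its degree, which is positive, so the algebraically closed ambient field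
  has a root to which the new generator can go.\<close>

lemma hom_on_extend_finite:
  fixes F :: "'a::alg_closed_field set"
  assumes F: "subfield F \<R>" and "hom_on F \<phi>" "\<And>x. x \<in> set xs \<Longrightarrow> algebraic_over F x"
  shows "\<exists>\<psi>. hom_on (finite_ext F xs) \<psi> \<and> (\<forall>z\<in>F. \<psi> z = \<phi> z)"
  using assms(3)
proof (induction xs)
  case Nil
  interpret R: field "\<R> :: 'a ring" by (rule field_from_type_algebra)
  show ?case using assms(2) by auto
next
  case (Cons x xs)
  interpret R: field "\<R> :: 'a ring" by (rule field_from_type_algebra)
  define E where "E = finite_ext F xs"
  have E: "subfield E \<R>" "F \<subseteq> E" using subfield_finite_ext[OF F, of xs] Cons by (auto simp: E_def)
  obtain \<psi> where \<psi>: "hom_on E \<psi>" "\<And>z. z \<in> F \<Longrightarrow> \<psi> z = \<phi> z" using Cons by (auto simp: E_def)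
  have "algebraic_over E x" using algebraic_over_mono[OF Cons(2) E(2)] by simp
  then obtain m where min: "min_poly E x m" by (rule min_poly_exists[OF E(1)])
  then have m: "poly_over E m" "m \<noteq> 0" "poly m x = 0" by (auto simp: min_poly_def)
  have "Polynomial.degree m \<noteq> 0"
  proof
    assume "Polynomial.degree m = 0"
    then obtain c where "m = [:c:]" by (rule degree_eq_zeroE)
    with m(2,3) show False by simp
  qed
  moreover have "Polynomial.degree (map_poly \<psi> m) = Polynomial.degree m"
    by (rule map_hom_degree[OF E(1) \<psi>(1) m(1)])
  ultimately obtain y where "poly (map_poly \<psi> m) y = 0"
    using alg_closed_imp_poly_has_root[of "map_poly \<psi> m"] by auto
  from hom_on_extend_simple[OF E(1) \<psi>(1) min this]
  obtain \<rho> where "hom_on (simple_ext E x) \<rho>" "\<And>z. z \<in> E \<Longrightarrow> \<rho> z = \<psi> z" by metis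
  then have "hom_on (finite_ext F (x # xs)) \<rho> \<and> (\<forall>z\<in>F. \<rho> z = \<phi> z)"
    using \<psi>(2) E(2) by (auto simp: E_def)
  then show ?case by (rule exI[of _ \<rho>])
qed

section \<open>Finite Galois extensions\<close>

lemma mem_galois_group:
  "\<sigma> \<in> carrier (galois_group K L) \<longleftrightarrow>
    \<sigma> \<in> extensional L \<and> bij_betw \<sigma> L L \<and> 
    (\<forall>x\<in>L. \<forall>y\<in>L. \<sigma> (x + y) = \<sigma> x + \<sigma> y \<and> \<sigma> (x * y) = \<sigma> x * \<sigma> y) \<and> \<sigma> 1 = 1 \<and> (\<forall>x\<in>K. \<sigma> x = x)"
  by (auto simp: galois_group_def aut_fixing_def Bij_def Ring.ring_hom_def bij_betw_imp_funcset dest: bij_betwE)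

lemma galois_group_hom_on: "\<sigma> \<in> carrier (galois_group K L) \<Longrightarrow> hom_on L \<sigma>"
  by (auto simp: mem_galois_group hom_on_def)

lemma galois_group_fixes: "\<sigma> \<in> carrier (galois_group K L) \<Longrightarrow> x \<in> K \<Longrightarrow> \<sigma> x = x"
  by (simp add: mem_galois_group)

lemma galois_group_simps:
  "\<one>\<^bsub>galois_group K L\<^esub> = (\<lambda>x\<in>L. x)"
  "\<sigma> \<in> carrier (galois_group K L) \<Longrightarrow> \<tau> \<in> carrier (galois_group K L) \<Longrightarrow>
    \<sigma> \<otimes>\<^bsub>galois_group K L\<^esub> \<tau> = compose L \<sigma> \<tau>"
  by (auto simp: galois_group_def aut_fixing_def BijGroup_def Bij_def bij_betw_imp_funcset)

lemma galois_group_mem_closed: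
  "\<sigma> \<in> carrier (galois_group K L) \<Longrightarrow> x \<in> L \<Longrightarrow> \<sigma> x \<in> L"
  by (auto simp: mem_galois_group bij_betw_def)

lemma group_galois_group:
  assumes L: "subfield L \<R>" and "K \<subseteq> L"
  shows "group (galois_group K L)"
proof -
  interpret B: group "BijGroup L" by (rule group_BijGroup)
  have "subgroup (carrier (galois_group K L)) (BijGroup L)"
  proof (rule B.subgroupI)
    show "carrier (galois_group K L) \<subseteq> carrier (BijGroup L)"
      by (auto simp: galois_group_def aut_fixing_def BijGroup_def)
    have "(\<lambda>x\<in>L. x) \<in> carrier (galois_group K L)"
      using assms subfield_closed[OF L] id_Bij[of L] by (auto simp: mem_galois_group Bij_def)
    then show "carrier (galois_group K L) \<noteq> {}" by blast
  next
    fix \<sigma> assume \<sigma>: "\<sigma> \<in> carrier (galois_group K L)"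
    then have b: "\<sigma> \<in> Bij L" by (auto simp: mem_galois_group Bij_def)
    define \<tau> where "\<tau> = (\<lambda>x\<in>L. inv_into L \<sigma> x)"
    have "inv\<^bsub>BijGroup L\<^esub> \<sigma> = \<tau>" using b by (simp add: inv_BijGroup \<tau>_def)
    moreover have "\<tau> \<in> carrier (galois_group K L)"
    proof -
      have bij: "bij_betw \<sigma> L L" using \<sigma> by (simp add: mem_galois_group)
      have \<tau>: "\<tau> x \<in> L" "\<sigma> (\<tau> x) = x" if "x \<in> L" for x
        using that bij by (auto simp: \<tau>_def bij_betw_def inv_into_into f_inv_into_f)
      have eqI: "\<tau> x = y" if "x \<in> L" "y \<in> L" "\<sigma> y = x" for x y
        using that bij by (auto simp: \<tau>_def bij_betw_def)
      show ?thesis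
        unfolding mem_galois_group
      proof (intro conjI ballI)
        show "\<tau> \<in> extensional L" "bij_betw \<tau> L L" 
          using restrict_inv_into_Bij[OF b] by (auto simp: \<tau>_def Bij_def)
        show "\<tau> 1 = 1" using \<sigma> subfield_closed[OF L] by (auto intro!: eqI simp: mem_galois_group)
        show "\<tau> x = x" if "x \<in> K" for x using \<sigma> that \<open>K \<subseteq> L\<close> by (auto intro!: eqI simp: mem_galois_group)
        fix x y assume xy: "x \<in> L" "y \<in> L"
        note \<tau>xy = \<tau>[OF xy(1)] \<tau>[OF xy(2)]
        have "\<sigma> (\<tau> x + \<tau> y) = x + y" "\<sigma> (\<tau> x * \<tau> y) = x * y"
          using \<sigma> \<tau>xy by (simp_all add: mem_galois_group)
        then show "\<tau> (x + y) = \<tau> x + \<tau> y" "\<tau> (x * y) = \<tau> x * \<tau> y"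
          using xy \<tau>xy by (auto intro!: eqI subfield_add[OF L] subfield_mult[OF L])
      qed
    qed
    ultimately show "inv\<^bsub>BijGroup L\<^esub> \<sigma> \<in> carrier (galois_group K L)" by simp
  next
    fix \<sigma> \<tau> assume *: "\<sigma> \<in> carrier (galois_group K L)" "\<tau> \<in> carrier (galois_group K L)"
    have "compose L \<sigma> \<tau> \<in> carrier (galois_group K L)"
      using * galois_group_mem_closed[OF *(2)] subfield_closed[OF L] \<open>K \<subseteq> L\<close>
      unfolding mem_galois_group by (auto simp: bij_betw_compose compose_eq)
    moreover have "\<sigma> \<otimes>\<^bsub>BijGroup L\<^esub> \<tau> = compose L \<sigma> \<tau>"
      using * by (auto simp: BijGroup_def mem_galois_group Bij_def)
    ultimately show "\<sigma> \<otimes>\<^bsub>BijGroup L\<^esub> \<tau> \<in> carrier (galois_group K L)" by simp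
  qed
  from B.subgroup_imp_group[OF this] show ?thesis
    by (simp add: galois_group_def aut_fixing_def)
qed

lemma restrict_galois_group:
  assumes "subfield L \<R>" "hom_on E \<phi>" "L \<subseteq> E" "\<phi> ` L = L" "K \<subseteq> L" "\<And>x. x \<in> K \<Longrightarrow> \<phi> x = x"
  shows "restrict \<phi> L \<in> carrier (galois_group K L)"
proof -
  note L = hom_on_subset[OF assms(2,3)]
  have "bij_betw (restrict \<phi> L) L L"
    using hom_on_inj[OF assms(1) L] assms(4) by (simp add: bij_betw_def inj_on_def)
  then show ?thesis
    using assms subfield_closed[OF assms(1)] hom_on_add[OF assms(1) L] hom_on_mult[OF assms(1) L]
      hom_on_one[OF assms(1) L]
    unfolding mem_galois_group by auto
qed

text \<open>Separability in characteristic 0. Write m = (X - y) g and take a root of g. If y were a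
  root of g, it would be a root of the derivative of m, a nonzero polynomial over K of smaller
  degree.\<close>

lemma other_root_exists:
  fixes K :: "'a::{alg_closed_field, field_char_0} set"
  assumes K: "subfield K \<R>" and "y \<notin> K"
    and min: "min_poly K y m"
  obtains y' where "poly m y' = 0" "y' \<noteq> y"
proof -
  have m: "poly_over K m" "m \<noteq> 0" "poly m y = 0" using min by (auto simp: min_poly_def)
  obtain g where g: "m = [:- y, 1:] * g" using m(3) by (metis dvdE poly_eq_0_iff_dvd)
  then have "g \<noteq> 0" using m(2) by auto
  have "Polynomial.degree m = Suc (Polynomial.degree g)"
    unfolding g using \<open>g \<noteq> 0\<close> by (subst degree_mult_eq) auto
  \<comment> \<open>A constant g would make m a scalar multiple of X - y, and its coefficients would
    put \<open>y\<close> in \<open>K\<close>.\<close>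
  have "Polynomial.degree g \<noteq> 0"
  proof
    assume "Polynomial.degree g = 0"
    then obtain c where "g = [:c:]" by (metis degree_eq_zeroE)
    with \<open>g \<noteq> 0\<close> have "m = [:- y * c, c:]" "c \<noteq> 0" by (auto simp: g)
    then have "- y * c \<in> K" "c \<in> K" using m(1) by (auto simp: poly_over_pCons)
    then have "- ((- y * c) / c) \<in> K" by (intro subfield_uminus[OF K] subfield_divide[OF K])
    with \<open>c \<noteq> 0\<close> \<open>y \<notin> K\<close> show False by simp
  qed
  then obtain y' where y': "poly g y' = 0" using alg_closed_imp_poly_has_root[of g] by auto
  have "poly g y \<noteq> 0"
  proof
    assume "poly g y = 0"
    then have "poly (pderiv m) y = 0" by (simp add: g pderiv_mult pderiv_pCons del: mult_pCons_left)
    moreover have "pderiv m \<noteq> 0"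
      using \<open>Polynomial.degree m = _\<close> by (metis nat.distinct(1) pderiv_eq_0_iff)
    ultimately have "Polynomial.degree m \<le> Polynomial.degree (pderiv m)"
      using poly_over_pderiv[OF K m(1)] min unfolding min_poly_def by blast
    with \<open>Polynomial.degree m = _\<close> show False by (simp add: degree_pderiv)
  qed
  with y' have "y' \<noteq> y" "poly m y' = 0" by (auto simp: g)
  with that show ?thesis by blast
qed

text \<open>\<open>L\<close> is generated over \<open>K\<close> by all roots of a polynomial
  vanishing on \<open>S\<close>. An element y outside K is moved as follows: send it to another root
  of its minimal polynomial and extend to a field containing L; the extension permutes the
  generating roots, so it maps L onto itself.\<close>

theorem finite_galois_exists:
  fixes K :: "'a::{alg_closed_field, field_char_0} set"
  assumes K: "subfield K \<R>" and alg: "\<And>x :: 'a. algebraic_over K x" and "finite S"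
  obtains L where "finite_galois K L" "S \<subseteq> L"
proof -
  interpret R: field "\<R> :: 'a ring" by (rule field_from_type_algebra)
  have "\<exists>p. poly_over K p \<and> p \<noteq> 0 \<and> poly p x = 0" for x
    using alg[of x] by (auto simp: algebraic_over_def poly_over_def)
  then obtain p where p: "\<And>x. poly_over K (p x)" "\<And>x. p x \<noteq> 0" "\<And>x. poly (p x) x = 0" by metis
  define P where "P = (\<Prod>x\<in>S. p x)"
  define Z where "Z = {z. poly P z = 0}"
  have P: "poly_over K P" unfolding P_def by (rule poly_over_prod[OF K p(1)])
  have P0: "P \<noteq> 0" using p(2) \<open>finite S\<close> by (simp add: P_def)
  have "S \<subseteq> Z"
  proof
    fix x assume "x \<in> S"
    then have "poly P x = 0" unfolding P_def poly_prod using p(3) \<open>finite S\<close> by (intro prod_zero) auto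
    then show "x \<in> Z" by (simp add: Z_def)
  qed
  have "finite Z" using poly_roots_finite[OF P0] by (simp add: Z_def)
  then obtain xs where xs: "set xs = Z" using finite_list by blast
  define L where "L = finite_ext K xs"
  note L = subfield_finite_ext[OF K alg, of xs, folded L_def]
  have ZL: "Z \<subseteq> L" using L(3) xs by simp
  \<comment> \<open>As the least subring over \<open>K\<close> and \<open>Z\<close>,
    \<open>L\<close> is compared with a subring by testing \<open>K\<close> and \<open>Z\<close>;
    this serves both inclusions between \<open>L\<close> and its image under
    \<open>\<rho>\<close>.\<close>
  have minimal: "L \<subseteq> A" if "subring A \<R>" "K \<subseteq> A" "Z \<subseteq> A" for A
    unfolding L_def by (rule R.finite_extension_subring_incl[OF that(1,2)]) (use that(3) xs in simp)
  have "fixed_field L (carrier (galois_group K L)) = K"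
  proof (intro subset_antisym subsetI)
    fix y assume "y \<in> K"
    then show "y \<in> fixed_field L (carrier (galois_group K L))"
      using L(2) galois_group_fixes[of _ K L y] unfolding fixed_field_def by blast
  next
    fix y assume y: "y \<in> fixed_field L (carrier (galois_group K L))"
    show "y \<in> K"
    proof (rule ccontr)
      assume "y \<notin> K"
      obtain m where m: "min_poly K y m" using min_poly_exists[OF K alg] .
      obtain y' where y': "poly m y' = 0" "y' \<noteq> y" using other_root_exists[OF K \<open>y \<notin> K\<close> m] .
      have id: "hom_on K id" by (simp add: hom_on_def)
      have "poly (map_poly id m) y' = 0" using y' by simp
      then obtain \<psi> where \<psi>: "hom_on (simple_ext K y) \<psi>" "\<And>z. z \<in> K \<Longrightarrow> \<psi> z = id z" "\<psi> y = y'"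
        by (rule hom_on_extend_simple[OF K id m]) blast
      define F where "F = simple_ext K y"
      have ext: "finite_ext K [y] = F" by (simp add: F_def)
      have F: "subfield F \<R>" "K \<subseteq> F" "y \<in> F"
        using subfield_finite_ext(1-3)[OF K alg, of "[y]", unfolded ext] by simp_all
      \<comment> \<open>The roots are adjoined to K(y) and not to K, so that the extension still
        sends y to y'.\<close>
      have "\<exists>\<rho>. hom_on (finite_ext F xs) \<rho> \<and> (\<forall>z\<in>F. \<rho> z = \<psi> z)"
        by (rule hom_on_extend_finite[OF F(1) \<psi>(1)[folded F_def] algebraic_over_mono[OF alg F(2)]])
      then obtain \<rho> where \<rho>: "hom_on (finite_ext F xs) \<rho>" "\<And>z. z \<in> F \<Longrightarrow> \<rho> z = \<psi> z" by blast
      have LE: "L \<subseteq> finite_ext F xs" unfolding L_def by (rule R.mono_finite_extension[OF F(2)])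
      have \<rho>L: "hom_on L \<rho>" using hom_on_subset[OF \<rho>(1) LE] .
      have \<rho>K: "\<rho> z = z" if "z \<in> K" for z using \<rho>(2)[OF subsetD[OF F(2) that]] \<psi>(2)[OF that] by simp
      have \<rho>Z: "\<rho> ` Z = Z"
        unfolding Z_def by (rule hom_on_permutes_roots[OF L(1) \<rho>L P L(2) \<rho>K P0 ZL[unfolded Z_def]])
      have "subring {z \<in> L. \<rho> z \<in> L} \<R>"
        unfolding subring_iff
        by (simp add: subfield_zero[OF L(1)] subfield_one[OF L(1)] subfield_uminus[OF L(1)] subfield_add[OF L(1)] subfield_mult[OF L(1)] hom_on_zero[OF L(1) \<rho>L] hom_on_one[OF L(1) \<rho>L] hom_on_uminus[OF L(1) \<rho>L]
            hom_on_add[OF L(1) \<rho>L] hom_on_mult[OF L(1) \<rho>L])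
      then have "L \<subseteq> {z \<in> L. \<rho> z \<in> L}"
      proof (rule minimal)
        show "K \<subseteq> {z \<in> L. \<rho> z \<in> L}" using L(2) \<rho>K by (simp add: subset_iff)
        show "Z \<subseteq> {z \<in> L. \<rho> z \<in> L}" using ZL \<rho>Z by blast
      qed
      moreover have "L \<subseteq> \<rho> ` L"
      proof (rule minimal[OF hom_on_image_subring[OF L(1) \<rho>L]])
        show "K \<subseteq> \<rho> ` L"
        proof
          fix z assume "z \<in> K"
          then show "z \<in> \<rho> ` L" using \<rho>K L(2) by (intro image_eqI[of _ _ z]) auto
        qed
        show "Z \<subseteq> \<rho> ` L" using \<rho>Z ZL by blast
      qed
      ultimately have "\<rho> ` L = L" by auto
      then have "restrict \<rho> L \<in> carrier (galois_group K L)"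
        using restrict_galois_group[OF L(1) \<rho>L _ _ L(2) \<rho>K] by simp
      moreover have "\<rho> y \<noteq> y" using \<rho>(2)[OF F(3)] \<psi>(3) y'(2) by simp
      moreover have "y \<in> L" "\<And>\<sigma>. \<sigma> \<in> carrier (galois_group K L) \<Longrightarrow> \<sigma> y = y"
        using y unfolding fixed_field_def by blast+
      ultimately have "restrict \<rho> L y = y" "y \<in> L" "\<rho> y \<noteq> y" by blast+
      then show False by simp
    qed
  qed
  then have "finite_galois K L" using L by (simp add: finite_galois_def)
  with that show ?thesis using \<open>S \<subseteq> Z\<close> ZL by blast
qed

text \<open>An automorphism is determined by its values on a finite spanning list of L over K, and
  each value is one of the finitely many roots of a polynomial over K.\<close>

lemma finite_galois_group:
  fixes K :: "'a::field_char_0 set"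
  assumes K: "subfield K \<R>" and alg: "\<And>x :: 'a. algebraic_over K x" and KL: "finite_galois K L"
  shows "finite (carrier (galois_group K L))"
proof -
  interpret R: field "\<R> :: 'a ring" by (rule field_from_type_algebra)
  have L: "subfield L \<R>" "K \<subseteq> L" "R.finite_dimension K L" using KL by (auto simp: finite_galois_def)
  obtain Us where Us: "R.Span K Us = L"
    using R.exists_base[OF K] R.finite_dimensionE[OF K L(3)] by blast
  have UsL: "set Us \<subseteq> L" unfolding Us[symmetric] by (rule R.Span_base_incl[OF K]) simp
  have "\<exists>p. poly_over K p \<and> p \<noteq> 0 \<and> poly p x = 0" for x
    using alg[of x] by (auto simp: algebraic_over_def poly_over_def)
  then obtain p where p: "\<And>x. poly_over K (p x)" "\<And>x. p x \<noteq> 0" "\<And>x. poly (p x) x = 0" by metis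
  define G where "G = carrier (galois_group K L)"
  have agree: "z \<in> L \<and> \<sigma> z = \<tau> z"
    if "\<sigma> \<in> G" "\<tau> \<in> G" "\<And>u. u \<in> set Vs \<Longrightarrow> \<sigma> u = \<tau> u" "set Vs \<subseteq> L" "z \<in> R.Span K Vs" for \<sigma> \<tau> Vs z
    using that(3-)
  proof (induction Vs arbitrary: z)
    case Nil
    have "\<sigma> 0 = 0" "\<tau> 0 = 0"
      using hom_on_zero[OF L(1) galois_group_hom_on] that(1,2) by (auto simp: G_def)
    with Nil show ?case using subfield_zero[OF L(1)] by simp
  next
    case (Cons v Vs)
    then obtain k w where "k \<in> K" "w \<in> R.Span K Vs" "z = k * v + w"
      by (auto simp: R.line_extension_mem_iff)
    with Cons have "k \<in> L" "w \<in> L" "v \<in> L" "\<sigma> w = \<tau> w" "\<sigma> v = \<tau> v" "z = k * v + w" "k \<in> K"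
      using L(2) by auto
    moreover from this have "k * v \<in> L" by (intro subfield_mult[OF L(1)])
    ultimately show ?case
      using that(1,2) by (simp add: G_def mem_galois_group subfield_add[OF L(1)])
  qed
  have "inj_on (\<lambda>\<sigma>. restrict \<sigma> (set Us)) G"
  proof (rule inj_onI)
    fix \<sigma> \<tau> assume *: "\<sigma> \<in> G" "\<tau> \<in> G" "restrict \<sigma> (set Us) = restrict \<tau> (set Us)"
    then have "\<sigma> u = \<tau> u" if "u \<in> set Us" for u using that by (metis restrict_apply')
    then have "\<sigma> z = \<tau> z" if "z \<in> L" for z using agree[OF *(1,2) _ UsL] that Us by auto
    moreover have "\<sigma> \<in> extensional L" "\<tau> \<in> extensional L" using * by (auto simp: G_def mem_galois_group)
    ultimately show "\<sigma> = \<tau>" by (rule extensionalityI[rotated 2])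
  qed
  moreover have "(\<lambda>\<sigma>. restrict \<sigma> (set Us)) ` G \<subseteq> (\<Pi>\<^sub>E u\<in>set Us. {z. poly (p u) z = 0})"
  proof clarify
    fix \<sigma> assume "\<sigma> \<in> G"
    then have h: "hom_on L \<sigma>" and fix_K: "\<And>x. x \<in> K \<Longrightarrow> \<sigma> x = x"
      by (auto simp: G_def galois_group_hom_on mem_galois_group)
    have "poly (p u) (\<sigma> u) = 0" if "u \<in> L" for u
    proof -
      have "map_poly \<sigma> (p u) = p u"
        using p(1)[of u] fix_K by (intro poly_eqI) (simp add: coeff_map_hom[OF L(1) h] poly_over_def)
      then show ?thesis
        using map_hom_poly[OF L(1) h poly_over_mono[OF p(1) L(2)] that, of u] p(3)
        by (simp add: hom_on_zero[OF L(1) h])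
    qed
    then show "restrict \<sigma> (set Us) \<in> (\<Pi>\<^sub>E u\<in>set Us. {z. poly (p u) z = 0})" using UsL by auto
  qed
  moreover have "finite (\<Pi>\<^sub>E u\<in>set Us. {z. poly (p u) z = 0})"
    using p(2) by (intro finite_PiE) (auto simp: poly_roots_finite)
  ultimately have "finite G" by (rule inj_on_finite)
  then show ?thesis by (simp add: G_def)
qed

text \<open>The roots of the orbit polynomial \<open>\<Prod>(X - \<sigma> x)\<close>, which has coefficients in \<open>K\<close>, all lie in \<open>L\<close>.\<close>
lemma finite_galois_normal:
  fixes K :: "'a::field_char_0 set"
  assumes K: "subfield K \<R>" and alg: "\<And>x :: 'a. algebraic_over K x" and KL: "finite_galois K L"
    and E: "subfield E \<R>" "L \<subseteq> E" and \<phi>: "hom_on E \<phi>" "\<And>x. x \<in> K \<Longrightarrow> \<phi> x = x"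
  shows "\<phi> ` L = L"
proof -
  have L: "subfield L \<R>" "K \<subseteq> L" using KL by (auto simp: finite_galois_def)
  define G where "G = carrier (galois_group K L)"
  interpret G: group "galois_group K L" by (rule group_galois_group[OF L])
  \<comment> \<open>It is enough to cover \<open>L\<close> by subsets that \<open>\<phi>\<close>
    maps onto themselves; for \<open>x\<close> the orbit under the Galois group serves.\<close>
  have "\<exists>Z. x \<in> Z \<and> Z \<subseteq> L \<and> \<phi> ` Z = Z" if "x \<in> L" for x
  proof -
    define Z where "Z = (\<lambda>\<sigma>. \<sigma> x) ` G"
    have "finite Z" using finite_galois_group[OF K alg KL] by (simp add: Z_def G_def)
    have ZL: "Z \<subseteq> L" using \<open>x \<in> L\<close> by (auto simp: Z_def G_def galois_group_mem_closed)
    have "(\<lambda>x\<in>L. x) \<in> G" using G.one_closed by (simp add: G_def galois_group_simps)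
    then have "x \<in> Z" using \<open>x \<in> L\<close> unfolding Z_def by (metis (no_types, lifting) image_eqI restrict_apply')
    define P where "P = (\<Prod>z\<in>Z. [:- z, 1:])"
    have roots: "{z. poly P z = 0} = Z" using \<open>finite Z\<close> by (auto simp: P_def poly_prod)
    have lin: "poly_over L [:- z, 1:]" if "z \<in> L" for z
      using subfield_uminus[OF L(1) that] subfield_one[OF L(1)] by (simp add: poly_over_pCons poly_over_0[OF L(1)])
    have "poly_over L P"
      unfolding P_def using ZL by (intro poly_over_prod[OF L(1)] lin) auto
    have "poly_over K P"
      unfolding poly_over_def
    proof
      fix i
      \<comment> \<open>Acting on coefficients, \<open>\<tau>\<close> turns each factor X - z into X
        - \<tau> z, and it permutes the orbit; invariant coefficients lie in the fixed field, which
        is \<open>K\<close>.\<close>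
      have "\<tau> (Polynomial.coeff P i) = Polynomial.coeff P i" if "\<tau> \<in> G" for \<tau>
      proof -
        have \<tau>: "hom_on L \<tau>" using that by (simp add: G_def galois_group_hom_on)
        have "map_poly \<tau> (\<Prod>z\<in>Y. [:- z, 1:]) = (\<Prod>z\<in>Y. [:- \<tau> z, 1:])" if "finite Y" "Y \<subseteq> L" for Y
          using that
        proof (induction rule: finite_induct)
          case empty
          show ?case using \<tau> by (simp add: hom_on_def map_poly_1')
        next
          case (insert y Y)
          have "map_poly \<tau> ([:- y, 1:] * (\<Prod>z\<in>Y. [:- z, 1:])) = map_poly \<tau> [:- y, 1:] * map_poly \<tau> (\<Prod>z\<in>Y. [:- z, 1:])"
            using insert by (intro map_hom_mult[OF L(1) \<tau>] poly_over_prod[OF L(1)] lin) auto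
          moreover have "map_poly \<tau> [:- y, 1:] = [:- \<tau> y, 1:]"
            using insert by (simp add: map_hom_pCons[OF L(1) \<tau>] hom_on_one[OF L(1) \<tau>] hom_on_uminus[OF L(1) \<tau>])
          ultimately show ?case using insert by simp
        qed
        then have "map_poly \<tau> P = (\<Prod>z\<in>Z. [:- \<tau> z, 1:])" using \<open>finite Z\<close> ZL by (simp add: P_def)
        also have "\<dots> = P"
        proof -
          have inj: "inj_on \<tau> Z" using hom_on_inj[OF L(1) \<tau>] ZL by (rule inj_on_subset)
          have "\<tau> ` Z \<subseteq> Z"
          proof clarify
            fix z assume "z \<in> Z"
            then obtain \<sigma> where "\<sigma> \<in> G" "z = \<sigma> x" unfolding Z_def by blast
            moreover have "\<tau> \<otimes>\<^bsub>galois_group K L\<^esub> \<sigma> \<in> G" using \<open>\<tau> \<in> G\<close> \<open>\<sigma> \<in> G\<close> unfolding G_def by (rule G.m_closed)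
            moreover have "(\<tau> \<otimes>\<^bsub>galois_group K L\<^esub> \<sigma>) x = \<tau> (\<sigma> x)"
              using \<open>x \<in> L\<close> galois_group_simps(2) \<open>\<tau> \<in> G\<close> \<open>\<sigma> \<in> G\<close> unfolding G_def by (metis compose_eq)
            ultimately show "\<tau> z \<in> Z" unfolding Z_def by (metis imageI)
          qed
          then have "\<tau> ` Z = Z" using \<open>finite Z\<close> inj by (simp add: endo_inj_surj)
          then show ?thesis using prod.reindex[OF inj, of "\<lambda>z. [:- z, 1:]"] by (simp only: P_def o_def)
        qed
        finally have "Polynomial.coeff (map_poly \<tau> P) i = Polynomial.coeff P i" by (simp only:)
        then show ?thesis unfolding coeff_map_hom[OF L(1) \<tau>] .
      qed
      then have "Polynomial.coeff P i \<in> fixed_field L (carrier (galois_group K L))"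
        using \<open>poly_over L P\<close> unfolding fixed_field_def poly_over_def G_def by blast
      then show "Polynomial.coeff P i \<in> K" using KL by (simp add: finite_galois_def)
    qed
    moreover have "P \<noteq> 0" using \<open>finite Z\<close> by (simp add: P_def)
    ultimately have "\<phi> ` Z = Z"
      using hom_on_permutes_roots[OF E(1) \<phi>(1) \<open>poly_over K P\<close> order_trans[OF L(2) E(2)] \<phi>(2) \<open>P \<noteq> 0\<close>]
        order_trans[OF ZL E(2)] unfolding roots by blast
    with \<open>x \<in> Z\<close> ZL show ?thesis by blast
  qed
  then show ?thesis by blast
qed

section \<open>Rings of integers have finite quotients\<close>

definition additive :: "'a::ab_group_add set \<Rightarrow> bool"
  where "additive A \<longleftrightarrow> 0 \<in> A \<and> (\<forall>x\<in>A. \<forall>y\<in>A. x - y \<in> A)"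

context
  fixes A :: "'a::ring_1 set" assumes A: "additive A"
begin

lemma additive_zero: "0 \<in> A" and additive_diff: "x \<in> A \<Longrightarrow> y \<in> A \<Longrightarrow> x - y \<in> A"
  using A by (auto simp: additive_def)

lemma additive_uminus: "x \<in> A \<Longrightarrow> - x \<in> A"
  using additive_diff[of 0 x] additive_zero by simp

lemma additive_add: "x \<in> A \<Longrightarrow> y \<in> A \<Longrightarrow> x + y \<in> A"
  using additive_diff[of x "- y"] additive_uminus by simp

lemma additive_of_nat: "x \<in> A \<Longrightarrow> of_nat n * x \<in> A"
  by (induction n) (auto simp: distrib_right intro: additive_zero additive_add)

lemma additive_of_int: "x \<in> A \<Longrightarrow> of_int i * x \<in> A"
  by (cases i rule: int_cases2) (auto intro: additive_of_nat additive_uminus)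

end

lemmas additive_closed = additive_zero additive_diff additive_uminus additive_add additive_of_nat additive_of_int

text \<open>Two nonzero rationals have a common measure: for b / c = u / v in lowest terms, a Bezout
  combination g of b and c satisfies b = u g and c = v g. Induction merges the generators one after
  another.\<close>

lemma finite_subset_of_rational_group_cyclic:
  fixes B :: "'a::field_char_0 set"
  assumes B: "additive B" "B \<subseteq> \<rat>" and "finite T" "T \<subseteq> B"
  shows "\<exists>c\<in>B. \<forall>t\<in>T. \<exists>k. t = of_int k * c"
  using assms(3,4)
proof (induction rule: finite_induct)
  case empty
  then show ?case using additive_zero[OF B(1)] by blast
next
  case (insert b T)
  then obtain c where c: "c \<in> B" "\<And>t. t \<in> T \<Longrightarrow> \<exists>k. t = of_int k * c" by auto
  have "b \<in> B" using insert by simp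
  show ?case
  proof (cases "c = 0")
    case True
    then have "\<exists>k. t = of_int k * b" if "t \<in> insert b T" for t
      using that c(2)[of t] by (cases "t = b") (auto intro: exI[of _ 1] exI[of _ 0])
    with \<open>b \<in> B\<close> show ?thesis by blast
  next
    case False
    have "b / c \<in> \<rat>" using \<open>b \<in> B\<close> c(1) B(2) by (auto intro: Rats_divide)
    then obtain u v :: int where uv: "v > 0" "Rings.coprime u v" "b / c = of_int u / of_int v"
      by (auto elim: Rats_cases')
    obtain \<alpha> \<beta> where bez: "\<alpha> * u + \<beta> * v = 1" using bezout_int[of u v] uv(2) by auto
    \<comment> \<open>With \<alpha> u + \<beta> v = 1 this generates the group spanned by b and c;
      the relation v b = u c yields both quotients.\<close>
    define g where "g = of_int \<alpha> * b + of_int \<beta> * c"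
    have vb: "of_int v * b = of_int u * c" using uv False by (simp add: field_simps)
    have one: "of_int \<alpha> * of_int u + of_int \<beta> * of_int v = (1::'a)"
      using arg_cong[OF bez, of "of_int :: int \<Rightarrow> 'a"] by simp
    have "of_int v * g = of_int \<alpha> * (of_int v * b) + of_int \<beta> * of_int v * c"
      by (simp add: g_def algebra_simps)
    also have "\<dots> = (of_int \<alpha> * of_int u + of_int \<beta> * of_int v) * c"
      unfolding vb by (simp add: algebra_simps)
    finally have cg: "c = of_int v * g" using one by simp
    have "of_int u * g = of_int \<alpha> * of_int u * b + of_int \<beta> * (of_int u * c)"
      by (simp add: g_def algebra_simps)
    also have "\<dots> = (of_int \<alpha> * of_int u + of_int \<beta> * of_int v) * b"
      unfolding vb[symmetric] by (simp add: algebra_simps)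
    finally have bg: "b = of_int u * g" using one by simp
    have "g \<in> B" using \<open>b \<in> B\<close> c(1) by (auto simp: g_def intro: additive_closed[OF B(1)])
    moreover have "\<exists>k. t = of_int k * g" if t: "t \<in> insert b T" for t
    proof (cases "t = b")
      case True
      with bg show ?thesis by blast
    next
      case False
      with t obtain k where "t = of_int k * c" using c(2) by blast
      then have "t = of_int (k * v) * g" using cg by (simp add: mult.assoc)
      then show ?thesis by blast
    qed
    ultimately show ?thesis by blast
  qed
qed

text \<open>Finitely many elements that are pairwise incongruent modulo n B lie in a cyclic subgroup
  of B, so there are at most n of them, even if \<open>B\<close> is not finitely generated. A
  largest such set is a system of representatives.\<close>

lemma rational_group_finite_quotient:
  fixes B :: "'a::field_char_0 set"
  assumes B: "additive B" "B \<subseteq> \<rat>" and "n > 0"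
  shows "\<exists>F. finite F \<and> F \<subseteq> B \<and> (\<forall>x\<in>B. \<exists>f\<in>F. \<exists>y\<in>B. x = f + of_nat n * y)"
proof -
  define incong where "incong T \<longleftrightarrow> finite T \<and> T \<subseteq> B \<and>
    (\<forall>s\<in>T. \<forall>t\<in>T. s \<noteq> t \<longrightarrow> \<not> (\<exists>y\<in>B. s = t + of_nat n * y))" for T
  have card: "card T \<le> n" if "incong T" for T
  proof -
    have T: "finite T" "T \<subseteq> B" using that by (auto simp: incong_def)
    obtain c where c: "c \<in> B" "\<And>t. t \<in> T \<Longrightarrow> \<exists>k. t = of_int k * c"
      using finite_subset_of_rational_group_cyclic[OF B T] by blast
    then obtain k where k: "\<And>t. t \<in> T \<Longrightarrow> t = of_int (k t) * c" by metis
    have "inj_on (\<lambda>t. k t mod int n) T"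
    proof (rule inj_onI, rule ccontr)
      fix s t assume st: "s \<in> T" "t \<in> T" "k s mod int n = k t mod int n" "s \<noteq> t"
      then have "int n dvd k s - k t" by (simp add: mod_eq_dvd_iff)
      then obtain l where "k s - k t = int n * l" by (rule dvdE)
      then have l: "k s = k t + int n * l" by simp
      have "s = of_int (k s) * c" "t = of_int (k t) * c" using k st by auto
      then have "s = t + of_nat n * (of_int l * c)" using l by (simp add: algebra_simps)
      moreover have "of_int l * c \<in> B" using c(1) by (rule additive_of_int[OF B(1)])
      ultimately have "\<exists>y\<in>B. s = t + of_nat n * y" by blast
      moreover have "\<not> (\<exists>y\<in>B. s = t + of_nat n * y)" using that st(1,2,4) unfolding incong_def by simp
      ultimately show False by contradiction
    qed
    then have "card T = card ((\<lambda>t. k t mod int n) ` T)" by (simp add: card_image)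
    also have "\<dots> \<le> card {0..<int n}" using \<open>n > 0\<close> by (intro card_mono) auto
    finally show ?thesis by simp
  qed
  have "incong {}" by (simp add: incong_def)
  then have "\<exists>T. incong T \<and> (\<forall>T'. incong T' \<longrightarrow> card T' \<le> card T)"
    using card by (intro ex_has_greatest_nat[of incong "{}" card "Suc n"]) (simp_all add: less_Suc_eq_le)
  then obtain T where T: "incong T" "\<And>T'. incong T' \<Longrightarrow> card T' \<le> card T" by blast
  have "\<exists>f\<in>T. \<exists>y\<in>B. x = f + of_nat n * y" if "x \<in> B" for x
  proof (cases "x \<in> T")
    case True
    then show ?thesis using additive_zero[OF B(1)] by (intro bexI[of _ x] bexI[of _ 0]) auto
  next
    case False
    show ?thesis
    proof (rule ccontr)
      assume *: "\<not> ?thesis"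
      have **: "\<not> (\<exists>y\<in>B. f = x + of_nat n * y)" if "f \<in> T" for f
      proof
        assume "\<exists>y\<in>B. f = x + of_nat n * y"
        then obtain y where "y \<in> B" "f = x + of_nat n * y" by blast
        then have "- y \<in> B" "x = f + of_nat n * (- y)" using additive_uminus[OF B(1)] by auto
        with * that show False by blast
      qed
      have "incong (insert x T)"
        unfolding incong_def
      proof (intro conjI ballI impI)
        show "finite (insert x T)" "insert x T \<subseteq> B" using T(1) \<open>x \<in> B\<close> by (auto simp: incong_def)
        fix s t assume "s \<in> insert x T" "t \<in> insert x T" "s \<noteq> t"
        then consider "s = x" "t \<in> T" | "t = x" "s \<in> T" | "s \<in> T" "t \<in> T" by blast
        then show "\<not> (\<exists>y\<in>B. s = t + of_nat n * y)"
        proof cases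
          case 1
          with * show ?thesis by blast
        next
          case 2
          with ** show ?thesis by blast
        next
          case 3
          with T(1) \<open>s \<noteq> t\<close> show ?thesis by (simp add: incong_def)
        qed
      qed
      from T(2)[OF this] False T(1) show False by (simp add: incong_def)
    qed
  qed
  with T(1) show ?thesis by (auto simp: incong_def)
qed

lemma subfield_Rats: "subfield (\<rat> :: 'a::field_char_0 set) \<R>"
  by (auto simp: subfield_iff)

text \<open>Induction on the dimension, splitting off a line \<rat> v: representatives for
  \<open>A\<close> are sums of lifted representatives of its v-coordinates and representatives of
  \<open>A \<inter> E\<close>.\<close>

lemma finite_quotient_of_finite_dimension:
  fixes E :: "'a::field_char_0 set"
  assumes "ring.dimension \<R> d \<rat> E" "additive A" "A \<subseteq> E" "n > 0"
  shows "\<exists>F. finite F \<and> F \<subseteq> A \<and> (\<forall>x\<in>A. \<exists>f\<in>F. \<exists>y\<in>A. x = f + of_nat n * y)"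
proof -
  interpret R: field "\<R> :: 'a ring" by (rule field_from_type_algebra)
  show ?thesis
    using assms(1-3)
  proof (induction d "\<rat> :: 'a set" E arbitrary: A rule: R.dimension.induct)
    case zero_dim
    then have "A = {0}" using additive_zero[of A] by auto
    then show ?case by (intro exI[of _ "{0}"]) auto
  next
    case (Suc_dim v E d A)
    note A = Suc_dim(5)
    note E = R.space_subgroup_props[OF subfield_Rats Suc_dim(3)]
    have addE: "additive E"
      unfolding additive_def using E(2) E(3)[of _ "- _"] E(4) by fastforce
    \<comment> \<open>The group of v-coordinates of elements of \<open>A\<close>, a subgroup of
      \<rat>.\<close>
    define B where "B = {q \<in> \<rat>. \<exists>e\<in>E. q * v + e \<in> A}"
    have addB: "additive B"
      unfolding additive_def
    proof (intro conjI ballI)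
      show "0 \<in> B" using additive_zero[OF A] additive_zero[OF addE] by (auto simp: B_def intro!: bexI[of _ 0])
    next
      fix x y assume "x \<in> B" "y \<in> B"
      then obtain e f where *: "x \<in> \<rat>" "y \<in> \<rat>" "e \<in> E" "f \<in> E" "x * v + e \<in> A" "y * v + f \<in> A"
        by (auto simp: B_def)
      then have "(x - y) * v + (e - f) \<in> A" 
        using additive_diff[OF A *(5,6)] by (simp add: algebra_simps)
      then show "x - y \<in> B" using * additive_diff[OF addE] by (auto simp: B_def)
    qed
    obtain F1 where F1: "finite F1" "F1 \<subseteq> B" "\<And>x. x \<in> B \<Longrightarrow> \<exists>f\<in>F1. \<exists>y\<in>B. x = f + of_nat n * y"
      using rational_group_finite_quotient[OF addB _ \<open>n > 0\<close>] by (auto simp: B_def)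
    have addAE: "additive (A \<inter> E)" using A addE unfolding additive_def by simp
    have "\<exists>F. finite F \<and> F \<subseteq> A \<inter> E \<and> (\<forall>x\<in>A \<inter> E. \<exists>f\<in>F. \<exists>y\<in>A \<inter> E. x = f + of_nat n * y)"
      by (rule Suc_dim(4)[OF addAE Int_lower2])
    then obtain F2 where F2: "finite F2" "F2 \<subseteq> A \<inter> E"
        "\<And>x. x \<in> A \<inter> E \<Longrightarrow> \<exists>f\<in>F2. \<exists>y\<in>A \<inter> E. x = f + of_nat n * y"
      by metis
    \<comment> \<open>\<open>a q\<close> is a lift of \<open>q\<close> to \<open>A\<close>; it need
      not be additive in \<open>q\<close>, so sums are controlled only modulo
      \<open>E\<close>.\<close>
    have "\<forall>q\<in>B. \<exists>a\<in>A. a - q * v \<in> E" by (force simp: B_def)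
    then obtain a where a: "\<And>q. q \<in> B \<Longrightarrow> a q \<in> A" "\<And>q. q \<in> B \<Longrightarrow> a q - q * v \<in> E" by metis
    define F where "F = (\<lambda>(f, g). a f + g) ` (F1 \<times> F2)"
    have "finite F" using F1(1) F2(1) by (simp add: F_def)
    moreover have "F \<subseteq> A" using F1(2) F2(2) a(1) by (auto simp: F_def intro!: additive_add[OF A])
    moreover have "\<exists>f\<in>F. \<exists>y\<in>A. x = f + of_nat n * y" if "x \<in> A" for x
    proof -
      have "x \<in> R.line_extension \<rat> v E" using Suc_dim(6) that by blast
      then obtain q e where q: "q \<in> \<rat>" "e \<in> E" "x = q * v + e"
        by (auto simp: R.line_extension_mem_iff)
      then have "q \<in> B" using that by (auto simp: B_def)
      then obtain f c where f: "f \<in> F1" "c \<in> B" "q = f + of_nat n * c" using F1(3) by blast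
      have fB: "f \<in> B" using f F1 by auto
      \<comment> \<open>The v-coordinates cancel because q = f + n c, and what remains lies in
        \<open>A \<inter> E\<close>.\<close>
      have "x - a f - of_nat n * a c = e - (a f - f * v) - of_nat n * (a c - c * v)"
        using f(3) q(3) by (simp add: algebra_simps)
      also have "\<dots> \<in> E"
        by (rule additive_diff[OF addE additive_diff[OF addE q(2) a(2)[OF fB]] additive_of_nat[OF addE a(2)[OF f(2)]]])
      finally have "x - a f - of_nat n * a c \<in> A \<inter> E"
        using that a(1)[OF fB] a(1)[OF f(2)] by (auto intro: additive_closed[OF A])
      then obtain g y where "g \<in> F2" "y \<in> A" "x - a f - of_nat n * a c = g + of_nat n * y"
        using F2(3) by blast
      then have "a f + g \<in> F" "a c + y \<in> A" "x = (a f + g) + of_nat n * (a c + y)"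
        using f a(1)[OF f(2)] by (auto simp: F_def algebra_simps intro: additive_add[OF A])
      then show ?thesis by blast
    qed
    ultimately show ?case by blast
  qed
qed

section \<open>Integers of a number field: denominators, and the ideals containing a given
  element\<close>

definition ints :: "'a::field_char_0 set \<Rightarrow> 'a set"
  where "ints L = {x \<in> L. algebraic_int x}"

lemma ring_of_integers_simps [simp]:
  "carrier (ring_of_integers L) = ints L" "x \<otimes>\<^bsub>ring_of_integers L\<^esub> y = x * y"
  "x \<oplus>\<^bsub>ring_of_integers L\<^esub> y = x + y"
  "\<one>\<^bsub>ring_of_integers L\<^esub> = 1" "\<zero>\<^bsub>ring_of_integers L\<^esub> = 0"
  by (simp_all add: ring_of_integers_def ints_def)

text \<open>If a is the leading coefficient and d the degree of an integer polynomial of x, then a x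
  is integral: the powers of a x below d span a stable group.\<close>

lemma int_multiple_of_algebraic:
  fixes x :: "'a::field_char_0"
  assumes "algebraic x"
  obtains n :: nat where "n > 0" "algebraic_int (of_nat n * x)"
proof -
  obtain p where p: "p \<noteq> 0" "poly (map_poly of_int p) x = 0" using assms by (auto elim: algebraicE')
  define d where "d = Polynomial.degree p"
  define a where "a = Polynomial.lead_coeff p"
  define b where "b = Polynomial.coeff p"
  have "a \<noteq> 0" using p by (simp add: a_def)
  have "d \<noteq> 0"
  proof
    assume "d = 0"
    then obtain c where "p = [:c:]" unfolding d_def by (rule degree_eq_zeroE)
    with p show False by simp
  qed
  have "0 = (\<Sum>i\<le>d. of_int (b i) * x ^ i)"
    using p(2) by (simp add: poly_altdef coeff_map_poly degree_map_poly d_def b_def)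
  then have top: "of_int a * x ^ d = (\<Sum>i<d. of_int (- b i) * x ^ i)"
    unfolding lessThan_Suc_atMost[symmetric] sum.lessThan_Suc
    by (simp add: a_def b_def d_def sum_negf eq_neg_iff_add_eq_0 add.commute)
  define z where "z = of_int a * x"
  define v where "v i = of_int (a ^ i) * x ^ i" for i
  \<comment> \<open>The companion matrix of a x: a shift in every row but the last, and there the
    relation for a x^d multiplied by a^(d - 1).\<close>
  define A where "A i j = (if Suc i < d then (if j = Suc i then 1 else 0) else - b j * a ^ (d - 1 - j))" for i j
  have "z * v i = (\<Sum>j<d. of_int (A i j) * v j)" if "i < d" for i
  proof (cases "Suc i < d")
    case True
    then have "(\<Sum>j<d. of_int (A i j) * v j) = (\<Sum>j<d. if j = Suc i then v j else 0)"
      by (intro sum.cong) (auto simp: A_def)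
    then show ?thesis using True by (simp add: v_def z_def mult_ac)
  next
    case False
    with that have d: "d = Suc i" by simp
    have "(\<Sum>j<d. of_int (A i j) * v j) = (\<Sum>j<d. of_int (a ^ i) * (of_int (- b j) * x ^ j))"
    proof (rule sum.cong)
      fix j assume "j \<in> {..<d}"
      then have "a ^ (i - j) * a ^ j = a ^ i" by (simp add: d flip: power_add)
      then have "of_int (a ^ (i - j)) * of_int (a ^ j) = (of_int (a ^ i) :: 'a)"
        by (metis of_int_mult)
      then show "of_int (A i j) * v j = of_int (a ^ i) * (of_int (- b j) * x ^ j)"
        using False by (simp add: A_def v_def d mult_ac) 
    qed simp
    also have "\<dots> = of_int (a ^ i) * (of_int a * x ^ d)" unfolding top by (simp add: sum_distrib_left)
    also have "\<dots> = z * v i" by (simp add: z_def v_def d mult_ac)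
    finally show ?thesis ..
  qed
  then have z: "algebraic_int z"
    by (intro algebraic_int_if_stable_span[of 0 d v z A]) (use \<open>d \<noteq> 0\<close> in \<open>auto simp: v_def\<close>)
  \<comment> \<open>\<open>a\<close> may be negative; passing to its absolute value changes
    \<open>z\<close> at most by a sign.\<close>
  have "of_nat (nat \<bar>a\<bar>) = (of_int \<bar>a\<bar> :: 'a)" by (rule of_nat_nat) simp
  then have "of_nat (nat \<bar>a\<bar>) * x = z \<or> of_nat (nat \<bar>a\<bar>) * x = - z"
    unfolding z_def by (simp add: abs_if)
  with z have "algebraic_int (of_nat (nat \<bar>a\<bar>) * x)" by auto
  with that[of "nat \<bar>a\<bar>"] \<open>a \<noteq> 0\<close> show ?thesis by simp
qed

locale num_field =
  fixes L :: "'a::field_char_0 set"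
  assumes number_field: "number_field L"
begin

lemma L: "subfield L \<R>"
  using number_field by (simp add: number_field_def)

lemmas L_closed = subfield_closed[OF L]

lemma ints_closed:
  "0 \<in> ints L" "1 \<in> ints L" "x \<in> ints L \<Longrightarrow> - x \<in> ints L"
  "x \<in> ints L \<Longrightarrow> y \<in> ints L \<Longrightarrow> x + y \<in> ints L" "x \<in> ints L \<Longrightarrow> y \<in> ints L \<Longrightarrow> x * y \<in> ints L"
  "x \<in> ints L \<Longrightarrow> y \<in> ints L \<Longrightarrow> x - y \<in> ints L" "of_nat n \<in> ints L"
  using L_closed algebraic_int_add[of x y] algebraic_int_mult[of x y] algebraic_int_add[of x "- y"]
  by (auto simp: ints_def)

lemma ints_subset: "ints L \<subseteq> L"
  by (auto simp: ints_def)

sublocale OL: domain "ring_of_integers L"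
proof -
  have "cring (ring_of_integers L)"
  proof (intro cringI abelian_groupI comm_monoidI)
    fix x assume "x \<in> carrier (ring_of_integers L)"
    then show "\<exists>y\<in>carrier (ring_of_integers L). y \<oplus>\<^bsub>ring_of_integers L\<^esub> x = \<zero>\<^bsub>ring_of_integers L\<^esub>"
      using ints_closed by (auto intro!: bexI[of _ "- x"])
  qed (auto simp: ints_closed algebra_simps)
  then show "domain (ring_of_integers L)"
    by (intro domain.intro domain_axioms.intro) auto
qed

lemma OL_a_inv [simp]: "x \<in> ints L \<Longrightarrow> \<ominus>\<^bsub>ring_of_integers L\<^esub> x = - x"
  by (rule OL.minus_equality) (auto simp: ints_closed)

lemma ideal_iff:
  "ideal I (ring_of_integers L) \<longleftrightarrow> I \<subseteq> ints L \<and> 0 \<in> I \<and> (\<forall>x\<in>I. \<forall>y\<in>I. x + y \<in> I) \<and> (\<forall>a\<in>ints L. \<forall>x\<in>I. a * x \<in> I)"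
    (is "?lhs \<longleftrightarrow> ?rhs")
proof
  assume ?lhs
  then interpret I: ideal I "ring_of_integers L" .
  show ?rhs using I.a_subset I.zero_closed I.a_closed I.I_l_closed by auto
next
  assume I: ?rhs
  show ?lhs
  proof (rule idealI[OF OL.ring_axioms])
    show "subgroup I (add_monoid (ring_of_integers L))"
    proof (rule OL.add.subgroupI)
      fix x assume "x \<in> I"
      then have "- 1 * x \<in> I" "x \<in> ints L" using I ints_closed by blast+
      then show "\<ominus>\<^bsub>ring_of_integers L\<^esub> x \<in> I" by simp
    qed (use I in auto)
    show "a \<otimes>\<^bsub>ring_of_integers L\<^esub> x \<in> I" if "a \<in> I" "x \<in> carrier (ring_of_integers L)" for a x
      using I that by (metis mult.commute ring_of_integers_simps(1,2))
  qed (use I in auto)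
qed

abbreviation "Ideal I \<equiv> ideal I (ring_of_integers L)"

lemma ideal_closed:
  assumes "Ideal I"
  shows "I \<subseteq> ints L" "0 \<in> I" "x \<in> I \<Longrightarrow> y \<in> I \<Longrightarrow> x + y \<in> I" "a \<in> ints L \<Longrightarrow> x \<in> I \<Longrightarrow> a * x \<in> I"
    "x \<in> I \<Longrightarrow> - x \<in> I" "x \<in> I \<Longrightarrow> y \<in> I \<Longrightarrow> x - y \<in> I" "a \<in> ints L \<Longrightarrow> x \<in> I \<Longrightarrow> x * a \<in> I"
proof -
  note I = assms[unfolded ideal_iff]
  show "I \<subseteq> ints L" "0 \<in> I" and add: "\<And>x y. x \<in> I \<Longrightarrow> y \<in> I \<Longrightarrow> x + y \<in> I"
    and mult: "\<And>a x. a \<in> ints L \<Longrightarrow> x \<in> I \<Longrightarrow> a * x \<in> I"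
    using I by auto
  show "a \<in> ints L \<Longrightarrow> x \<in> I \<Longrightarrow> x * a \<in> I" using mult[of a x] by (simp add: mult.commute)
  show minus: "\<And>x. x \<in> I \<Longrightarrow> - x \<in> I"
    using mult[of "- 1"] ints_closed by force
  show "x \<in> I \<Longrightarrow> y \<in> I \<Longrightarrow> x - y \<in> I" using add[of x "- y"] minus by simp
qed

lemma int_multiple:
  assumes "x \<in> L"
  obtains n :: nat where "n > 0" "of_nat n * x \<in> ints L"
proof -
  interpret R: field "\<R> :: 'a ring" by (rule field_from_type_algebra)
  have "algebraic_over \<rat> x"
    using R.finite_dimension_imp_algebraic[OF subfield_Rats subfieldE(1)[OF L] _ assms] number_field
    by (simp add: algebraic_over_iff[OF subfield_Rats] number_field_def)
  then have "algebraic x" by (auto simp: algebraic_over_def algebraic_altdef)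
  then obtain n :: nat where "n > 0" "algebraic_int (of_nat n * x)" by (rule int_multiple_of_algebraic)
  with that assms L_closed show ?thesis by (auto simp: ints_def)
qed

text \<open>Clear the denominator of \<open>inverse x\<close>: if n / x is integral, it is the
  cofactor.\<close>

lemma divides_nat:
  assumes "x \<in> ints L" "x \<noteq> 0"
  obtains n :: nat and y where "n > 0" "y \<in> ints L" "of_nat n = x * y"
proof -
  have "inverse x \<in> L" using assms ints_subset L_closed by auto
  then obtain n :: nat where "n > 0" "of_nat n * inverse x \<in> ints L" by (rule int_multiple)
  with that[of n "of_nat n * inverse x"] assms show ?thesis by auto
qed

lemma ideal_contains_nat:
  assumes "Ideal I" "I \<noteq> {0}"
  obtains n :: nat where "n > 0" "of_nat n \<in> I"
proof -
  obtain x where x: "x \<in> I" "x \<noteq> 0" using assms ideal_closed(2)[OF assms(1)] by auto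
  then have "x \<in> ints L" using ideal_closed(1)[OF assms(1)] by auto
  from divides_nat[OF this x(2)] obtain n y where "n > 0" "y \<in> ints L" "of_nat n = x * y" .
  with that[of n] ideal_closed(7)[OF assms(1) _ x(1)] show ?thesis by metis
qed

lemma finite_quotient:
  assumes "n > 0"
  obtains F where "finite F" "F \<subseteq> ints L" "\<And>x. x \<in> ints L \<Longrightarrow> \<exists>f\<in>F. \<exists>y\<in>ints L. x = f + of_nat n * y"
proof -
  interpret R: field "\<R> :: 'a ring" by (rule field_from_type_algebra)
  obtain d where d: "R.dimension d \<rat> L"
    using number_field by (auto simp: number_field_def R.finite_dimension_def)
  have "additive (ints L)" unfolding additive_def using ints_closed(1,6) by simp
  from finite_quotient_of_finite_dimension[OF d this ints_subset assms]
  obtain F where "finite F" "F \<subseteq> ints L" "\<forall>x\<in>ints L. \<exists>f\<in>F. \<exists>y\<in>ints L. x = f + of_nat n * y" by metis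
  then show ?thesis by (intro that[of F]) simp_all
qed

lemma mem_ideal_cong_nat:
  assumes "Ideal I" "of_nat n \<in> I" "y \<in> ints L"
  shows "f + of_nat n * y \<in> I \<longleftrightarrow> f \<in> I"
  using ideal_closed(3)[OF assms(1), of f "of_nat n * y"] ideal_closed(6)[OF assms(1), of "f + of_nat n * y" "of_nat n * y"]
    ideal_closed(7)[OF assms(1,3,2)] by auto

text \<open>An ideal containing n is a union of residue classes modulo n, so it is determined by
  which of the finitely many representatives it contains.\<close>

lemma finite_ideals_containing_nat:
  assumes "n > 0"
  shows "finite {I. Ideal I \<and> of_nat n \<in> I}"
proof -
  obtain F where F: "finite F" "F \<subseteq> ints L" "\<And>x. x \<in> ints L \<Longrightarrow> \<exists>f\<in>F. \<exists>y\<in>ints L. x = f + of_nat n * y"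
    using finite_quotient[OF assms] by metis
  have "inj_on (\<lambda>I. F \<inter> I) {I. Ideal I \<and> of_nat n \<in> I}"
  proof (rule inj_onI)
    have sub: "x \<in> J" if "Ideal I" "of_nat n \<in> I" "Ideal J" "of_nat n \<in> J" "F \<inter> I = F \<inter> J" "x \<in> I" for I J x
    proof -
      have "x \<in> ints L" using that ideal_closed(1) by auto
      then obtain f y where "f \<in> F" "y \<in> ints L" "x = f + of_nat n * y" using F(3) by blast
      with that mem_ideal_cong_nat[of I n y f] mem_ideal_cong_nat[of J n y f] show ?thesis by auto
    qed
    fix I J assume "I \<in> {I. Ideal I \<and> of_nat n \<in> I}" "J \<in> {I. Ideal I \<and> of_nat n \<in> I}" "F \<inter> I = F \<inter> J"
    then show "I = J" using sub[of I J] sub[of J I] by auto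
  qed
  moreover have "(\<lambda>I. F \<inter> I) ` {I. Ideal I \<and> of_nat n \<in> I} \<subseteq> Pow F" by auto
  ultimately show ?thesis using F(1) by (meson finite_Pow_iff inj_on_finite)
qed

text \<open>The finiteness behind the stabilisation arguments below: \<open>x\<close> divides a
  positive integer, which then lies in each of these ideals.\<close>

lemma finite_ideals_containing:
  assumes "x \<in> ints L" "x \<noteq> 0"
  shows "finite {I. Ideal I \<and> x \<in> I}"
proof -
  obtain n y where n: "n > 0" "y \<in> ints L" "of_nat n = x * y" using divides_nat[OF assms] .
  have "{I. Ideal I \<and> x \<in> I} \<subseteq> {I. Ideal I \<and> of_nat n \<in> I}"
    using n ideal_closed(7) by auto
  then show ?thesis using finite_ideals_containing_nat[OF n(1)] finite_subset by blast
qed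

text \<open>The generators are a positive integer n in I and the representatives modulo n that lie
  in I. Generation is expressed through the ideals \<open>J\<close> above them, the form in which
  \<open>nakayama\<close> takes it.\<close>

lemma ideal_finitely_generated:
  assumes "Ideal I" "I \<noteq> {0}"
  obtains S where "finite S" "S \<subseteq> I" "\<And>J. Ideal J \<Longrightarrow> S \<subseteq> J \<Longrightarrow> I \<subseteq> J"
proof -
  obtain n :: nat where n: "n > 0" "of_nat n \<in> I" using ideal_contains_nat[OF assms] .
  obtain F where F: "finite F" "F \<subseteq> ints L" "\<And>x. x \<in> ints L \<Longrightarrow> \<exists>f\<in>F. \<exists>y\<in>ints L. x = f + of_nat n * y"
    using finite_quotient[OF n(1)] by metis
  have "I \<subseteq> J" if J: "Ideal J" "insert (of_nat n) (F \<inter> I) \<subseteq> J" for J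
  proof
    fix x assume "x \<in> I"
    then have "x \<in> ints L" using ideal_closed(1)[OF assms(1)] by auto
    then obtain f y where "f \<in> F" "y \<in> ints L" "x = f + of_nat n * y" using F(3) by blast
    with \<open>x \<in> I\<close> J mem_ideal_cong_nat[OF assms(1) n(2), of y f] mem_ideal_cong_nat[OF J(1), of n y f]
    show "x \<in> J" by auto
  qed
  with that[of "insert (of_nat n) (F \<inter> I)"] F(1) n(2) show ?thesis by auto
qed

section \<open>Powers of primes\<close>

abbreviation "iprod \<equiv> ideal_prod (ring_of_integers L)"

lemma iprod_ideal: "Ideal I \<Longrightarrow> Ideal J \<Longrightarrow> Ideal (iprod I J)"
  by (rule OL.ideal_prod_is_ideal)

lemma iprod_subset: "Ideal I \<Longrightarrow> Ideal J \<Longrightarrow> iprod I J \<subseteq> I \<inter> J"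
  by (rule OL.ideal_prod_inter)

lemma iprod_mem: "x \<in> I \<Longrightarrow> y \<in> J \<Longrightarrow> x * y \<in> iprod I J"
  using ideal_prod.prod[of x I y J "ring_of_integers L"] by simp

lemma iprod_least:
  assumes "Ideal N" "\<And>x y. x \<in> I \<Longrightarrow> y \<in> J \<Longrightarrow> x * y \<in> N"
  shows "iprod I J \<subseteq> N"
proof
  fix s assume "s \<in> iprod I J"
  then show "s \<in> N"
    by (induction rule: ideal_prod.induct) (use assms ideal_closed(3)[OF assms(1)] in auto)
qed

lemma ideal_add_principal:
  assumes "Ideal N" "s \<in> ints L"
  shows "Ideal {x + s * c | x c. x \<in> N \<and> c \<in> ints L}"
  unfolding ideal_iff
proof (intro conjI ballI subsetI)
  fix a x assume "a \<in> ints L" "x \<in> {x + s * c | x c. x \<in> N \<and> c \<in> ints L}"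
  then obtain y c where yc: "x = y + s * c" "y \<in> N" "c \<in> ints L" by auto
  then have "a * x = a * y + s * (a * c)" by (simp add: algebra_simps)
  with yc \<open>a \<in> ints L\<close> ideal_closed(4)[OF assms(1)] ints_closed(5)
  show "a * x \<in> {x + s * c | x c. x \<in> N \<and> c \<in> ints L}" by blast
next
  fix x y assume "x \<in> {x + s * c | x c. x \<in> N \<and> c \<in> ints L}" "y \<in> {x + s * c | x c. x \<in> N \<and> c \<in> ints L}"
  then obtain x' c y' d where "x = x' + s * c" "x' \<in> N" "c \<in> ints L" "y = y' + s * d" "y' \<in> N" "d \<in> ints L" by auto
  then have "x + y = (x' + y') + s * (c + d)" "x' + y' \<in> N" "c + d \<in> ints L"
    using ideal_closed(3)[OF assms(1)] ints_closed by (auto simp: algebra_simps)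
  then show "x + y \<in> {x + s * c | x c. x \<in> N \<and> c \<in> ints L}" by blast
next
  show "0 \<in> {x + s * c | x c. x \<in> N \<and> c \<in> ints L}"
    using ideal_closed(2)[OF assms(1)] ints_closed(1) by force
next
  fix x assume "x \<in> {x + s * c | x c. x \<in> N \<and> c \<in> ints L}"
  then show "x \<in> ints L" using ideal_closed(1)[OF assms(1)] assms(2) ints_closed by auto
qed

text \<open>Induction on the number of generators: replacing \<open>N\<close> by \<open>N + s O\<close> removes the generator \<open>s\<close>.\<close>
lemma nakayama:
  assumes P: "Ideal P" and M: "Ideal M" and S: "finite S" "S \<subseteq> M"
    and "Ideal N" "\<And>J. Ideal J \<Longrightarrow> S \<subseteq> J \<Longrightarrow> N \<subseteq> J \<Longrightarrow> M \<subseteq> J"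
    and "\<And>J. Ideal J \<Longrightarrow> iprod P M \<subseteq> J \<Longrightarrow> N \<subseteq> J \<Longrightarrow> M \<subseteq> J"
  shows "\<exists>a. 1 - a \<in> P \<and> (\<forall>x\<in>M. a * x \<in> N)"
  using S assms(5-)
proof (induction arbitrary: N rule: finite_induct)
  case empty
  then have "M \<subseteq> N" by blast
  then show ?case using ideal_closed(2)[OF P] by (intro exI[of _ 1]) auto
next
  case (insert s S)
  have s: "s \<in> M" "s \<in> ints L" using insert(4) ideal_closed(1)[OF M] by auto
  define N' where "N' = {x + s * c | x c. x \<in> N \<and> c \<in> ints L}"
  have N': "Ideal N'" unfolding N'_def by (rule ideal_add_principal[OF insert(5) s(2)])
  have NN': "N \<subseteq> N'" unfolding N'_def using ints_closed(1) by force
  have sN': "s \<in> N'" unfolding N'_def using ints_closed(2) ideal_closed(2)[OF insert(5)] by force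
  have "\<exists>a. 1 - a \<in> P \<and> (\<forall>x\<in>M. a * x \<in> N')"
  proof (rule insert.IH)
    show "S \<subseteq> M" using insert by auto
    show "M \<subseteq> J" if "Ideal J" "S \<subseteq> J" "N' \<subseteq> J" for J
      using insert(6)[OF that(1)] that sN' NN' by auto
    show "M \<subseteq> J" if "Ideal J" "iprod P M \<subseteq> J" "N' \<subseteq> J" for J
      using insert(7)[OF that(1,2)] that NN' by auto
  qed (rule N')
  then obtain a where a: "1 - a \<in> P" "\<And>x. x \<in> M \<Longrightarrow> a * x \<in> N'" by auto
  have aO: "a \<in> ints L" using a(1) ideal_closed(1)[OF P] ints_closed(6)[OF ints_closed(2), of "1 - a"] by auto
  \<comment> \<open>The elements that \<open>a\<close> sends into N + s P. This ideal contains P M,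
    because \<open>a\<close> sends \<open>M\<close> into N + s O, and it contains \<open>N\<close>;
    so it contains \<open>M\<close>, in particular \<open>s\<close>.\<close>
  define J where "J = {x \<in> ints L. \<exists>n\<in>N. \<exists>c\<in>P. a * x = n + s * c}"
  have "Ideal J"
    unfolding ideal_iff
  proof (intro conjI ballI)
    show "J \<subseteq> ints L" by (auto simp: J_def)
    show "0 \<in> J" using ints_closed(1) ideal_closed(2)[OF insert(5)] ideal_closed(2)[OF P] by (force simp: J_def)
  next
    fix x y assume "x \<in> J" "y \<in> J"
    then obtain m n c d where *: "x \<in> ints L" "y \<in> ints L" "m \<in> N" "n \<in> N" "c \<in> P" "d \<in> P" "a * x = m + s * c" "a * y = n + s * d"
      by (auto simp: J_def)
    then have "a * (x + y) = (m + n) + s * (c + d)" by (simp add: algebra_simps)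
    with * ints_closed(4) ideal_closed(3)[OF insert(5)] ideal_closed(3)[OF P] show "x + y \<in> J"
      unfolding J_def by blast
  next
    fix b x assume "b \<in> ints L" "x \<in> J"
    then obtain m c where *: "x \<in> ints L" "m \<in> N" "c \<in> P" "a * x = m + s * c" by (auto simp: J_def)
    have "a * (b * x) = b * (a * x)" by (rule mult.left_commute)
    also have "\<dots> = b * m + s * (b * c)" unfolding *(4) by (simp add: algebra_simps)
    finally have "a * (b * x) = b * m + s * (b * c)" .
    with * \<open>b \<in> ints L\<close> ints_closed(5) ideal_closed(4)[OF insert(5)] ideal_closed(4)[OF P] show "b * x \<in> J"
      unfolding J_def by blast
  qed
  moreover have "iprod P M \<subseteq> J"
  proof (rule iprod_least[OF \<open>Ideal J\<close>])
    fix p m assume pm: "p \<in> P" "m \<in> M"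
    then obtain x c where x: "x \<in> N" "c \<in> ints L" "a * m = x + s * c"
      using a(2)[OF pm(2)] by (auto simp: N'_def)
    have "a * (p * m) = p * (a * m)" by (simp add: mult_ac)
    also have "\<dots> = p * x + s * (p * c)" unfolding x(3) by (simp add: algebra_simps)
    finally have "a * (p * m) = p * x + s * (p * c)" .
    moreover have "p \<in> ints L" "m \<in> ints L" using pm ideal_closed(1)[OF P] ideal_closed(1)[OF M] by auto
    moreover have "p * c \<in> P" using ideal_closed(7)[OF P] pm x by auto
    ultimately show "p * m \<in> J"
      using x ints_closed(5) ideal_closed(4)[OF insert(5)] unfolding J_def by blast
  qed
  moreover have "N \<subseteq> J"
  proof
    fix x assume "x \<in> N"
    then have "x \<in> ints L" "a * x \<in> N" using ideal_closed[OF insert(5)] aO by auto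
    then show "x \<in> J" using ideal_closed(2)[OF P] by (force simp: J_def)
  qed
  ultimately have "M \<subseteq> J" using insert(7) by blast
  \<comment> \<open>Applied to \<open>s\<close> itself this reads (a - c) s \<in> N with c in P, so
    \<open>a - c\<close> absorbs the generator that was set aside.\<close>
  then obtain n c where nc: "n \<in> N" "c \<in> P" "a * s = n + s * c" using s(1) by (auto simp: J_def)
  then have acs: "(a - c) * s \<in> N" by (simp add: algebra_simps)
  have cO: "c \<in> ints L" using nc ideal_closed(1)[OF P] by auto
  show ?case
  \<comment> \<open>\<open>a\<close> carries \<open>M\<close> into N + s O, and \<open>a - c\<close>
    carries that into \<open>N\<close>; the product is 1 modulo \<open>P\<close>, since
    \<open>a\<close> is and \<open>c\<close> lies in \<open>P\<close>.\<close>
  proof (intro exI[of _ "(a - c) * a"] conjI ballI)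
    have "1 - (a - c) * a = (1 - a) + a * (1 - a) + a * c" by (simp add: algebra_simps)
    also have "\<dots> \<in> P" using a(1) nc(2) aO by (intro ideal_closed(3,4)[OF P])
    finally show "1 - (a - c) * a \<in> P" .
    fix x assume "x \<in> M"
    then obtain y d where y: "y \<in> N" "d \<in> ints L" "a * x = y + s * d"
      using a(2)[of x] by (auto simp: N'_def)
    have "(a - c) * a * x = (a - c) * (a * x)" by (simp add: mult.assoc)
    also have "\<dots> = (a - c) * y + (a - c) * s * d" unfolding y(3) by (simp add: algebra_simps)
    also have "\<dots> \<in> N"
      by (rule ideal_closed(3)[OF insert(5) ideal_closed(4)[OF insert(5) ints_closed(6)[OF aO cO] y(1)]
            ideal_closed(7)[OF insert(5) y(2) acs]])
    finally show "(a - c) * a * x \<in> N" .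
  qed
qed

abbreviation ipow (infixr "\<up>" 75)
  where "P \<up> k \<equiv> P [^]\<^bsub>ideal_monoid L\<^esub> (k::nat)"

lemma ideal_monoid_simps [simp]:
  "carrier (ideal_monoid L) = {I. Ideal I \<and> I \<noteq> {0}}" "I \<otimes>\<^bsub>ideal_monoid L\<^esub> J = iprod I J"
  "\<one>\<^bsub>ideal_monoid L\<^esub> = ints L"
  by (simp_all add: ideal_monoid_def ideals_set_def)

lemma ipow_0 [simp]: "P \<up> 0 = ints L" and ipow_Suc [simp]: "P \<up> Suc k = iprod (P \<up> k) P"
  by (simp_all add: nat_pow_def)

lemma ideal_ints: "Ideal (ints L)"
  using OL.oneideal by simp

lemma iprod_ints: "Ideal I \<Longrightarrow> iprod (ints L) I = I" "Ideal I \<Longrightarrow> iprod I (ints L) = I"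
  using OL.ideal_prod_one[of I] OL.ideal_prod_commute[OF OL.oneideal, of I] by simp_all

lemma ideal_eq_ints:
  assumes "Ideal I" "1 \<in> I"
  shows "I = ints L"
  using ideal_closed(1)[OF assms(1)] ideal_closed(4)[OF assms(1) _ assms(2)] by auto

lemma ipow_ideal: "Ideal P \<Longrightarrow> Ideal (P \<up> k)"
  by (induction k) (auto simp: ideal_ints iprod_ideal)

lemma ipow_antimono:
  assumes P: "Ideal P" and "k \<le> l"
  shows "P \<up> l \<subseteq> P \<up> k"
  using assms(2)
proof (induction rule: dec_induct)
  case (step l)
  have "P \<up> Suc l \<subseteq> P \<up> l" using iprod_subset[OF ipow_ideal[OF P] P] by simp
  with step show ?case by blast
qed simp

lemma nonzeroE:
  assumes "Ideal I" "I \<noteq> {0}"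
  obtains x where "x \<in> I" "x \<noteq> 0"
proof -
  have "0 \<in> I" using assms(1) by (rule ideal_closed(2))
  with assms(2) have "\<exists>x\<in>I. x \<noteq> 0" by blast
  then show ?thesis using that by blast
qed

lemma iprod_nonzero:
  assumes "Ideal I" "I \<noteq> {0}" "Ideal J" "J \<noteq> {0}"
  shows "iprod I J \<noteq> {0}"
proof -
  obtain x where "x \<in> I" "x \<noteq> 0" using nonzeroE[OF assms(1,2)] .
  moreover obtain y where "y \<in> J" "y \<noteq> 0" using nonzeroE[OF assms(3,4)] .
  ultimately have "x * y \<in> iprod I J" "x * y \<noteq> 0" by (simp_all add: iprod_mem)
  then show "iprod I J \<noteq> {0}" by blast
qed

lemma ints_nonzero: "ints L \<noteq> {0}"
  using ints_closed(2) by (metis singletonD zero_neq_one)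

lemma ipow_nonzero: "Ideal P \<Longrightarrow> P \<noteq> {0} \<Longrightarrow> P \<up> k \<noteq> {0}"
  by (induction k) (simp_all add: ints_nonzero iprod_nonzero ipow_ideal)

end

section \<open>A nonzero prime and the strict descent of its powers\<close>

locale num_field_prime = num_field +
  fixes P assumes prime: "P \<in> primes_of L"
begin

lemma maxP: "maximalideal P (ring_of_integers L)" and P_nonzero: "P \<noteq> {0}"
  using prime by (auto simp: primes_of_def)

lemma P: "Ideal P"
  using maxP by (rule maximalideal.axioms)

lemma one_notin_P: "1 \<notin> P"
  using ideal_eq_ints[OF P] maximalideal.I_notcarr[OF maxP] by auto

lemma P_prime: "x \<in> ints L \<Longrightarrow> y \<in> ints L \<Longrightarrow> x * y \<in> P \<Longrightarrow> x \<in> P \<or> y \<in> P"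
  using primeideal.I_prime[OF OL.maximalideal_prime[OF maxP]] by auto

text \<open>By maximality, P + b O is the whole ring.\<close>

lemma P_inverse:
  assumes "b \<in> ints L - P"
  obtains c where "c \<in> ints L" "1 - b * c \<in> P"
proof -
  define J where "J = {x + b * c | x c. x \<in> P \<and> c \<in> ints L}"
  have J: "Ideal J" unfolding J_def using ideal_add_principal[OF P] assms by blast
  have "P \<subseteq> J" using ints_closed(1) by (force simp: J_def)
  moreover have "b \<in> J" using ints_closed(2) ideal_closed(2)[OF P] by (force simp: J_def)
  ultimately have "J = ints L"
    using maximalideal.I_maximal[OF maxP J] ideal_closed(1)[OF J] assms by auto
  then have "1 \<in> J" using ints_closed(2) by simp
  then obtain x c where "x \<in> P" "c \<in> ints L" "1 = x + b * c" unfolding J_def by blast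
  with that[of c] show ?thesis by (metis add_diff_cancel_right')
qed

text \<open>Inverses lift by multiplying errors: if 1 - b c lies in P^k and 1 - b d in P, the
  product lies in P^(k+1) and has again the form 1 - b c'.\<close>

lemma P_pow_inverse:
  assumes "b \<in> ints L - P"
  shows "\<exists>c\<in>ints L. 1 - b * c \<in> P \<up> k"
proof (induction k)
  case 0
  then show ?case using ints_closed assms by (intro bexI[of _ 1]) auto
next
  case (Suc k)
  then obtain c where c: "c \<in> ints L" "1 - b * c \<in> P \<up> k" by blast
  obtain d where d: "d \<in> ints L" "1 - b * d \<in> P" using P_inverse[OF assms] .
  have "(1 - b * c) * (1 - b * d) \<in> P \<up> Suc k" using iprod_mem[OF c(2) d(2)] by simp
  moreover have "(1 - b * c) * (1 - b * d) = 1 - b * (c + d - b * c * d)" by (simp add: algebra_simps)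
  moreover have "c + d - b * c * d \<in> ints L" using c d assms ints_closed by auto
  ultimately show ?case by metis
qed

text \<open>The ideals P^j + N all contain a fixed nonzero element of N, so they are finite in
  number; as they descend, two consecutive ones agree. The conclusion expresses that P^j is inside
  P^(j+1) + N, testing the sum against the ideals above it.\<close>

lemma P_pow_eventually_constant:
  assumes N: "Ideal N" "N \<noteq> {0}"
  shows "\<exists>j. \<forall>J. Ideal J \<longrightarrow> P \<up> Suc j \<subseteq> J \<longrightarrow> N \<subseteq> J \<longrightarrow> P \<up> j \<subseteq> J"
proof -
  obtain x where x: "x \<in> N" "x \<noteq> 0" using nonzeroE[OF N] .
  \<comment> \<open>\<open>H j\<close> is the sum P^j + N, described as the least ideal above
    both.\<close>
  define H where "H j = \<Inter>{J. Ideal J \<and> P \<up> j \<subseteq> J \<and> N \<subseteq> J}" for j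
  have HI: "Ideal (H j)" for j
  proof -
    have "ints L \<in> {J. Ideal J \<and> P \<up> j \<subseteq> J \<and> N \<subseteq> J}"
      using ideal_ints ideal_closed(1)[OF ipow_ideal[OF P]] ideal_closed(1)[OF N(1)] by auto
    then show ?thesis unfolding H_def by (intro OL.i_Intersect) auto
  qed
  have "range H \<subseteq> {I. Ideal I \<and> x \<in> I}" using HI x(1) by (auto simp: H_def)
  moreover have "x \<in> ints L" using ideal_closed(1)[OF N(1)] x by auto
  ultimately have "finite (range H)" using finite_ideals_containing x(2) finite_subset by blast
  then have "\<not> inj H" using finite_imageD by blast
  then obtain i j where "H i = H j" "i < j" by (metis injI linorder_neqE_nat)
  have mono: "H l \<subseteq> H k" if "k \<le> l" for k l
    using ipow_antimono[OF P that] unfolding H_def by blast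
  have "H i \<subseteq> H (Suc i)" using \<open>H i = H j\<close> mono[of "Suc i" j] \<open>i < j\<close> by auto
  then have "P \<up> i \<subseteq> J" if "Ideal J" "P \<up> Suc i \<subseteq> J" "N \<subseteq> J" for J
    using that unfolding H_def by blast
  then show ?thesis by blast
qed

text \<open>Nakayama's lemma for M = P^j, where P M = P^(j+1). The multiplier is 1 modulo P, hence a
  unit in the local ring: locally at P, the power P^j is contained in N.\<close>

lemma P_pow_nakayama:
  assumes N: "Ideal N" and j: "\<And>J. Ideal J \<Longrightarrow> P \<up> Suc j \<subseteq> J \<Longrightarrow> N \<subseteq> J \<Longrightarrow> P \<up> j \<subseteq> J"
  obtains a where "a \<in> ints L - P" "\<And>x. x \<in> P \<up> j \<Longrightarrow> a * x \<in> N"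
proof -
  note M = ipow_ideal[OF P, of j] ipow_nonzero[OF P P_nonzero, of j]
  obtain S where S: "finite S" "S \<subseteq> P \<up> j" "\<And>J. Ideal J \<Longrightarrow> S \<subseteq> J \<Longrightarrow> P \<up> j \<subseteq> J"
    using ideal_finitely_generated[OF M] by metis
  have "iprod P (P \<up> j) = P \<up> Suc j" using OL.ideal_prod_commute[OF P M(1)] by simp
  then obtain a where a: "1 - a \<in> P" "\<And>x. x \<in> P \<up> j \<Longrightarrow> a * x \<in> N"
    using nakayama[OF P M(1) S(1,2) N] S(3) j by metis
  have "a \<notin> P" using ideal_closed(3)[OF P a(1), of a] one_notin_P by auto
  moreover have "a \<in> ints L" using a(1) ideal_closed(1)[OF P] ints_closed(6)[OF ints_closed(2), of "1 - a"] by auto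
  ultimately show ?thesis using that a by blast
qed

text \<open>Equality would allow N = 0 in \<open>P_pow_nakayama\<close>, giving a nonzero element
  that annihilates the nonzero ideal P^j.\<close>

lemma ipow_Suc_neq: "P \<up> Suc j \<noteq> P \<up> j"
proof
  assume eq: "P \<up> Suc j = P \<up> j"
  have "Ideal {0}" using OL.zeroideal by simp
  then obtain a where "a \<in> ints L - P" "\<And>x. x \<in> P \<up> j \<Longrightarrow> a * x \<in> {0}"
    using P_pow_nakayama[of "{0}" j] eq by auto
  moreover have "a \<noteq> 0" using \<open>a \<in> ints L - P\<close> ideal_closed(2)[OF P] by auto
  ultimately have "P \<up> j \<subseteq> {0}" by auto
  with ipow_nonzero[OF P P_nonzero, of j] ideal_closed(2)[OF ipow_ideal[OF P], of j] show False by auto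
qed

section \<open>The local filtration\<close>

abbreviation "U \<equiv> local_power L P"

lemma U_I: "a \<in> P \<up> k \<Longrightarrow> b \<in> ints L - P \<Longrightarrow> a / b \<in> U k"
  by (auto simp: local_power_def)

lemma U_E:
  assumes "x \<in> U k"
  obtains a b where "a \<in> P \<up> k" "b \<in> ints L" "b \<notin> P" "b \<noteq> 0" "x = a / b"
  using assms ideal_closed(2)[OF P] by (auto simp: local_power_def)

lemma ipow_subset_U: "P \<up> k \<subseteq> U k"
  using U_I[of _ k 1] ints_closed(2) one_notin_P by auto

lemma U_subset: "U k \<subseteq> L"
  using ideal_closed(1)[OF ipow_ideal[OF P]] ints_subset by (auto elim!: U_E intro!: L_closed)

lemma U_antimono: "k \<le> l \<Longrightarrow> U l \<subseteq> U k"
  using ipow_antimono[OF P, of k l] by (auto elim!: U_E intro!: U_I)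

lemma units_mult: "b \<in> ints L \<Longrightarrow> b \<notin> P \<Longrightarrow> d \<in> ints L \<Longrightarrow> d \<notin> P \<Longrightarrow> b * d \<in> ints L - P"
  using P_prime[of b d] ints_closed by auto

lemma U_0: "0 \<in> U k"
  using ipow_subset_U ideal_closed(2)[OF ipow_ideal[OF P]] by blast

lemma U_uminus: "x \<in> U k \<Longrightarrow> - x \<in> U k"
proof (elim U_E)
  fix a b assume "a \<in> P \<up> k" "b \<in> ints L" "b \<notin> P" "x = a / b"
  then show ?thesis using U_I[of "- a" k b] ideal_closed(5)[OF ipow_ideal[OF P]] by auto
qed

lemma U_add: "x \<in> U k \<Longrightarrow> y \<in> U k \<Longrightarrow> x + y \<in> U k"
proof (elim U_E)
  fix a b c d assume *: "a \<in> P \<up> k" "b \<in> ints L" "b \<notin> P" "b \<noteq> 0" "x = a / b"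
    "c \<in> P \<up> k" "d \<in> ints L" "d \<notin> P" "d \<noteq> 0" "y = c / d"
  then have "x + y = (d * a + b * c) / (b * d)" by (simp add: field_simps)
  moreover have "d * a + b * c \<in> P \<up> k" using * by (intro ideal_closed(3,4)[OF ipow_ideal[OF P]])
  ultimately show ?thesis using U_I units_mult * by metis
qed

lemma U_diff: "x \<in> U k \<Longrightarrow> y \<in> U k \<Longrightarrow> x - y \<in> U k"
  using U_add[of x k "- y"] U_uminus by simp

lemma U_mult: "x \<in> U 0 \<Longrightarrow> y \<in> U k \<Longrightarrow> x * y \<in> U k"
proof (elim U_E)
  fix a b c d assume *: "a \<in> P \<up> 0" "b \<in> ints L" "b \<notin> P" "b \<noteq> 0" "x = a / b"
    "c \<in> P \<up> k" "d \<in> ints L" "d \<notin> P" "d \<noteq> 0" "y = c / d"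
  then have "x * y = (a * c) / (b * d)" by simp
  moreover have "a * c \<in> P \<up> k" using * by (intro ideal_closed(4)[OF ipow_ideal[OF P]]) auto
  ultimately show ?thesis using U_I units_mult * by metis
qed

text \<open>For x = a / b, an inverse c of b modulo P^k gives x = c a + (1 - b c) x, where both
  terms lie in P^k.\<close>

lemma U_inter_ints: "x \<in> ints L \<Longrightarrow> x \<in> U k \<Longrightarrow> x \<in> P \<up> k"
proof (elim U_E)
  fix a b assume *: "x \<in> ints L" "a \<in> P \<up> k" "b \<in> ints L" "b \<notin> P" "b \<noteq> 0" "x = a / b"
  obtain c where c: "c \<in> ints L" "1 - b * c \<in> P \<up> k" using P_pow_inverse[of b k] * by blast
  have "x = c * a + (1 - b * c) * x" using * by (simp add: field_simps)
  moreover have "c * a + (1 - b * c) * x \<in> P \<up> k"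
    using * c by (intro ideal_closed(3,4,7)[OF ipow_ideal[OF P]])
  ultimately show ?thesis by metis
qed

text \<open>\<open>x\<close> may have a pole at P. If n x is integral, then x maps n P^k into P^k,
  so a power P^j that is locally inside n P^k will do; it is provided by stabilisation of the sums
  P^j + n P^k and Nakayama's lemma.\<close>

lemma U_mult_continuous:
  assumes "x \<in> L"
  shows "\<exists>j. \<forall>u\<in>U j. x * u \<in> U k"
proof -
  obtain n where n: "n > 0" "of_nat n * x \<in> ints L" using int_multiple[OF assms] .
  \<comment> \<open>The ideal n P^k; it is nonzero, as the stabilisation requires.\<close>
  define N where "N = iprod {of_nat n * c | c. c \<in> ints L} (P \<up> k)"
  have "Ideal {0}" using OL.zeroideal by simp
  then have principal: "Ideal {of_nat n * c | c. c \<in> ints L}"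
    using ideal_add_principal[of "{0}" "of_nat n"] ints_closed(7) by simp
  have N: "Ideal N" "N \<noteq> {0}"
  proof -
    have "of_nat n \<in> {of_nat n * c :: 'a | c. c \<in> ints L}" using ints_closed(2) by force
    moreover have "of_nat n \<noteq> (0 :: 'a)" using n(1) by simp
    ultimately have "{of_nat n * c | c. c \<in> ints L} \<noteq> {0}" by (metis singletonD)
    then show "Ideal N" "N \<noteq> {0}"
      using principal iprod_ideal iprod_nonzero ipow_ideal[OF P] ipow_nonzero[OF P P_nonzero] by (auto simp: N_def)
  qed
  have N_sub: "\<exists>y\<in>P \<up> k. z = of_nat n * y" if "z \<in> N" for z
    using that unfolding N_def
  proof (induction rule: ideal_prod.induct)
    case (prod i j)
    then show ?case using ideal_closed(4)[OF ipow_ideal[OF P]] by (auto simp: mult.assoc)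
  next
    case (sum s1 s2)
    then obtain y1 y2 where "y1 \<in> P \<up> k" "y2 \<in> P \<up> k" "s1 = of_nat n * y1" "s2 = of_nat n * y2" by auto
    then show ?case using ideal_closed(3)[OF ipow_ideal[OF P]]
      by (intro bexI[of _ "y1 + y2"]) (auto simp: algebra_simps)
  qed
  obtain j where j: "\<And>J. Ideal J \<Longrightarrow> P \<up> Suc j \<subseteq> J \<Longrightarrow> N \<subseteq> J \<Longrightarrow> P \<up> j \<subseteq> J"
    using P_pow_eventually_constant[OF N] by blast
  obtain a where a: "a \<in> ints L - P" "\<And>x. x \<in> P \<up> j \<Longrightarrow> a * x \<in> N"
    using P_pow_nakayama[OF N(1) j] by metis
  have "a \<noteq> 0" using a(1) ideal_closed(2)[OF P] by auto
  have "x * u \<in> U k" if "u \<in> U j" for u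
    using that
  proof (elim U_E)
    fix v b assume *: "v \<in> P \<up> j" "b \<in> ints L" "b \<notin> P" "b \<noteq> 0" "u = v / b"
    obtain y where y: "y \<in> P \<up> k" "a * v = of_nat n * y" using N_sub[OF a(2)[OF *(1)]] by blast
    have "v = of_nat n * y / a" using y(2) \<open>a \<noteq> 0\<close> by (simp add: field_simps)
    \<comment> \<open>The factor n cancels the pole of x, and a moves to the denominator, which
      stays outside P.\<close>
    then have "x * u = ((of_nat n * x) * y) / (a * b)" using * by simp
    moreover have "(of_nat n * x) * y \<in> P \<up> k" using n(2) y(1) by (rule ideal_closed(4)[OF ipow_ideal[OF P]])
    ultimately show ?thesis using U_I units_mult a * by (metis DiffE)
  qed
  then show ?thesis by blast
qed

text \<open>A nonzero such element would have a nonzero integral multiple in every power of P; only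
  finitely many ideals contain that multiple, so two powers would coincide, against their strict
  descent.\<close>

lemma U_Inter:
  assumes "\<And>k. x \<in> U k"
  shows "x = 0"
proof (rule ccontr)
  assume "x \<noteq> 0"
  obtain n where n: "n > 0" "of_nat n * x \<in> ints L" using int_multiple U_subset assms by blast
  define y where "y = of_nat n * x"
  have y: "y \<in> ints L" "y \<noteq> 0" using n \<open>x \<noteq> 0\<close> by (auto simp: y_def)
  have "of_nat n \<in> U 0" using ints_closed(7) ipow_subset_U[of 0] by auto
  then have "y \<in> P \<up> k" for k using U_inter_ints[OF y(1)] U_mult assms by (auto simp: y_def)
  then have "range (\<lambda>k. P \<up> k) \<subseteq> {I. Ideal I \<and> y \<in> I}" using ipow_ideal[OF P] by auto
  then have "finite (range (\<lambda>k. P \<up> k))" using finite_ideals_containing[OF y] finite_subset by blast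
  then have "\<not> inj (\<lambda>k. P \<up> k)" using finite_imageD by blast
  then obtain i j where "P \<up> i = P \<up> j" "i < j" by (metis (mono_tags, lifting) injI linorder_neqE_nat)
  then have "P \<up> Suc i = P \<up> i"
    using ipow_antimono[OF P, of i "Suc i"] ipow_antimono[OF P, of "Suc i" j] by auto
  then show False using ipow_Suc_neq by blast
qed

end

section \<open>Ideals with prescribed valuations\<close>

context num_field
begin

lemma primes_ideal: "p \<in> primes_of L \<Longrightarrow> Ideal p" "p \<in> primes_of L \<Longrightarrow> p \<noteq> {0}"
  by (auto simp: primes_of_def dest: maximalideal.axioms)

text \<open>An element j of J outside p has an inverse c modulo p. If p^n J were inside p^(n+1),
  then x = x (1 - j c) + x j c would put every x of p^n into p^(n+1).\<close>

lemma ideal_val_eqI: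
  assumes p: "p \<in> primes_of L" and J: "Ideal J" "\<not> J \<subseteq> p" and I: "I = iprod (p \<up> n) J"
  shows "ideal_val L p I = n"
proof -
  interpret p: num_field_prime L p using p by unfold_locales
  have "J \<noteq> {0}" using J ideal_closed(2)[OF p.P] by auto
  then have "p \<up> n divides\<^bsub>ideal_monoid L\<^esub> I" using I J by (auto simp: factor_def)
  moreover have "m \<le> n" if m: "p \<up> m divides\<^bsub>ideal_monoid L\<^esub> I" for m
  proof (rule ccontr)
    assume "\<not> m \<le> n"
    obtain C where C: "Ideal C" "I = iprod (p \<up> m) C" using m by (auto simp: factor_def)
    then have "I \<subseteq> p \<up> m" using iprod_subset[OF ipow_ideal[OF p.P]] by auto
    also have "\<dots> \<subseteq> p \<up> Suc n" using \<open>\<not> m \<le> n\<close> by (intro ipow_antimono[OF p.P]) auto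
    finally have IS: "I \<subseteq> p \<up> Suc n" .
    obtain j where j: "j \<in> J" "j \<in> ints L - p" using J ideal_closed(1)[OF J(1)] by auto
    obtain c where c: "c \<in> ints L" "1 - j * c \<in> p" using p.P_inverse[OF j(2)] .
    have "p \<up> n \<subseteq> p \<up> Suc n"
    proof
      fix x assume x: "x \<in> p \<up> n"
      have "x * (1 - j * c) \<in> p \<up> Suc n" using iprod_mem[OF x c(2)] by simp
      moreover have "x * j \<in> p \<up> Suc n" using iprod_mem[OF x j(1)] IS I by auto
      moreover have "x = x * (1 - j * c) + (x * j) * c" by (simp add: algebra_simps)
      ultimately show "x \<in> p \<up> Suc n"
        using ideal_closed(3,7)[OF ipow_ideal[OF p.P, of "Suc n"]] c(1) by metis
    qed
    with ipow_antimono[OF p.P, of n "Suc n"] have "p \<up> Suc n = p \<up> n" by (simp only: subset_antisym le_SucI order_refl)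
    then show False using p.ipow_Suc_neq[of n] by contradiction
  qed
  ultimately show ?thesis unfolding ideal_val_def by (rule Greatest_equality)
qed

lemma prime_not_subset: "p \<in> primes_of L \<Longrightarrow> q \<in> primes_of L \<Longrightarrow> q \<subseteq> p \<Longrightarrow> q = p"
  using maximalideal.I_maximal[of q "ring_of_integers L" p] maximalideal.I_notcarr[of p "ring_of_integers L"]
    primes_ideal(1)[of p] ideal_closed(1)[of p] by (auto simp: primes_of_def)

lemma iprod_not_subset:
  assumes "p \<in> primes_of L" "Ideal I" "Ideal J" "\<not> I \<subseteq> p" "\<not> J \<subseteq> p"
  shows "\<not> iprod I J \<subseteq> p"
proof
  interpret p: num_field_prime L p using assms(1) by unfold_locales
  assume "iprod I J \<subseteq> p"
  obtain x y where "x \<in> I" "x \<notin> p" "y \<in> J" "y \<notin> p" using assms by blast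
  moreover from this have "x * y \<in> p" using iprod_mem \<open>iprod I J \<subseteq> p\<close> by blast
  ultimately show False using p.P_prime ideal_closed(1)[OF assms(2)] ideal_closed(1)[OF assms(3)] by blast
qed

lemma ipow_not_subset:
  assumes "p \<in> primes_of L" "q \<in> primes_of L" "p \<noteq> q"
  shows "\<not> q \<up> k \<subseteq> p"
proof (induction k)
  case 0
  interpret p: num_field_prime L p using assms(1) by unfold_locales
  show ?case using p.one_notin_P ints_closed(2) by auto
next
  case (Suc k)
  have "\<not> q \<subseteq> p" using prime_not_subset[OF assms(1,2)] assms(3) by blast
  from iprod_not_subset[OF assms(1) ipow_ideal[OF primes_ideal(1)[OF assms(2)]] primes_ideal(1)[OF assms(2)] Suc this]
  show ?case by simp
qed

text \<open>The ideal is the product of the powers p^(n p) over \<open>S\<close>. Recording a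
  cofactor outside p, and not the valuation, lets the induction multiply cofactors and is the input
  of \<open>ideal_val_eqI\<close>.\<close>

lemma ideal_with_valuations_exists:
  assumes "finite S" "S \<subseteq> primes_of L" "\<And>p. p \<in> primes_of L - S \<Longrightarrow> n p = 0"
  shows "\<exists>I. Ideal I \<and> I \<noteq> {0} \<and> (\<forall>p\<in>primes_of L. \<exists>J. Ideal J \<and> \<not> J \<subseteq> p \<and> I = iprod (p \<up> n p) J)"
  using assms
proof (induction arbitrary: n rule: finite_induct)
  case empty
  have "\<not> ints L \<subseteq> p" if "p \<in> primes_of L" for p
  proof -
    interpret p: num_field_prime L p using that by unfold_locales
    show ?thesis using p.one_notin_P ints_closed(2) by auto
  qed
  then show ?case using empty ideal_ints ints_nonzero iprod_ints by (intro exI[of _ "ints L"]) auto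
next
  case (insert q S)
  \<comment> \<open>Exponent 0 at \<open>q\<close> makes the induction hypothesis apply to
    \<open>S\<close>; its clause at \<open>q\<close> then says that \<open>I\<close> is not
    contained in \<open>q\<close>.\<close>
  define n' where "n' = n(q := 0)"
  have q: "q \<in> primes_of L" using insert by simp
  have "\<exists>I. Ideal I \<and> I \<noteq> {0} \<and> (\<forall>p\<in>primes_of L. \<exists>J. Ideal J \<and> \<not> J \<subseteq> p \<and> I = iprod (p \<up> n' p) J)"
    using insert by (intro insert.IH) (auto simp: n'_def)
  then obtain I where I: "Ideal I" "I \<noteq> {0}"
      "\<And>p. p \<in> primes_of L \<Longrightarrow> \<exists>J. Ideal J \<and> \<not> J \<subseteq> p \<and> I = iprod (p \<up> n' p) J" by blast
  define Q where "Q = q \<up> n q"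
  have Q: "Ideal Q" "Q \<noteq> {0}"
    using ipow_ideal ipow_nonzero primes_ideal[OF q] by (auto simp: Q_def)
  have "\<exists>J. Ideal J \<and> \<not> J \<subseteq> p \<and> iprod Q I = iprod (p \<up> n p) J" if p: "p \<in> primes_of L" for p
  proof (cases "p = q")
    case True
    then have "\<not> I \<subseteq> p" using I(3)[OF p] iprod_ints by (auto simp: n'_def)
    with I(1) True show ?thesis by (auto simp: Q_def)
  next
    case False
    then obtain J where J: "Ideal J" "\<not> J \<subseteq> p" "I = iprod (p \<up> n p) J"
      using I(3)[OF p] by (auto simp: n'_def)
    have pn: "Ideal (p \<up> n p)" using ipow_ideal primes_ideal p by auto
    have "iprod Q I = iprod (p \<up> n p) (iprod Q J)"
      using OL.ideal_prod_assoc[OF Q(1) pn J(1)] OL.ideal_prod_assoc[OF pn Q(1) J(1)]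
        OL.ideal_prod_commute[OF Q(1) pn] by (simp add: J(3))
    moreover have "\<not> Q \<subseteq> p" unfolding Q_def by (rule ipow_not_subset[OF p q False])
    ultimately show ?thesis using iprod_not_subset[OF p Q(1) J(1)] J(2) iprod_ideal[OF Q(1) J(1)] by blast
  qed
  with iprod_ideal[OF Q(1) I(1)] iprod_nonzero[OF Q I(1,2)] show ?case by blast
qed

end

section \<open>The completion\<close>

context num_field_prime
begin

abbreviation "C \<equiv> cauchy_ring L P"
abbreviation "N \<equiv> null_ideal L P"
abbreviation "CL \<equiv> completion L P"

lemma cauchy_simps [simp]:
  "s \<otimes>\<^bsub>C\<^esub> t = (\<lambda>n. s n * t n)" "s \<oplus>\<^bsub>C\<^esub> t = (\<lambda>n. s n + t n)"
  "\<one>\<^bsub>C\<^esub> = (\<lambda>n. 1)" "\<zero>\<^bsub>C\<^esub> = (\<lambda>n. 0)"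
  by (simp_all add: cauchy_ring_def)

lemma mem_C:
  "s \<in> carrier C \<longleftrightarrow> (\<forall>n. s n \<in> L) \<and> (\<forall>k. \<exists>M. \<forall>m\<ge>M. \<forall>n\<ge>M. s m - s n \<in> U k)"
  by (auto simp: cauchy_ring_def)

lemma C_mem_L: "s \<in> carrier C \<Longrightarrow> s n \<in> L"
  by (simp add: mem_C)

lemma C_cauchy:
  assumes "s \<in> carrier C"
  obtains M where "\<And>m n. m \<ge> M \<Longrightarrow> n \<ge> M \<Longrightarrow> s m - s n \<in> U k"
  using assms unfolding mem_C by meson

lemma C_I:
  assumes "\<And>n. s n \<in> L" "\<And>k. \<exists>M. \<forall>m\<ge>M. \<forall>n\<ge>M. s m - s n \<in> U k"
  shows "s \<in> carrier C"
  using assms by (simp add: mem_C)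

lemma C_const: "x \<in> L \<Longrightarrow> (\<lambda>n. x) \<in> carrier C"
  by (simp add: mem_C U_0)

lemma C_add:
  assumes s: "s \<in> carrier C" and t: "t \<in> carrier C"
  shows "(\<lambda>n. s n + t n) \<in> carrier C"
proof (rule C_I)
  show "s n + t n \<in> L" for n by (rule subfield_add[OF L C_mem_L[OF s] C_mem_L[OF t]])
  fix k
  obtain M1 where 1: "\<And>m n. m \<ge> M1 \<Longrightarrow> n \<ge> M1 \<Longrightarrow> s m - s n \<in> U k" using C_cauchy[OF s] by metis
  obtain M2 where 2: "\<And>m n. m \<ge> M2 \<Longrightarrow> n \<ge> M2 \<Longrightarrow> t m - t n \<in> U k" using C_cauchy[OF t] by metis
  have "s m + t m - (s n + t n) \<in> U k" if "m \<ge> max M1 M2" "n \<ge> max M1 M2" for m n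
    using U_add[OF 1[of m n] 2[of m n]] that by (simp add: algebra_simps)
  then show "\<exists>M. \<forall>m\<ge>M. \<forall>n\<ge>M. s m + t m - (s n + t n) \<in> U k" by blast
qed

lemma C_uminus:
  assumes s: "s \<in> carrier C"
  shows "(\<lambda>n. - s n) \<in> carrier C"
proof (rule C_I)
  show "- s n \<in> L" for n by (rule subfield_uminus[OF L C_mem_L[OF s]])
  fix k
  obtain M where 1: "\<And>m n. m \<ge> M \<Longrightarrow> n \<ge> M \<Longrightarrow> s m - s n \<in> U k" using C_cauchy[OF s] by metis
  have "- s m - - s n \<in> U k" if "m \<ge> M" "n \<ge> M" for m n
    using U_uminus[OF 1[OF that]] by simp
  then show "\<exists>M. \<forall>m\<ge>M. \<forall>n\<ge>M. - s m - - s n \<in> U k" by blast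
qed

text \<open>The form of boundedness needed for products: late terms differ from one term
  \<open>s M\<close> by elements of U 0, which preserve U k, and multiplication by
  \<open>s M\<close> is continuous.\<close>

lemma C_bounded:
  assumes s: "s \<in> carrier C"
  obtains j M where "\<And>n u. n \<ge> M \<Longrightarrow> u \<in> U j \<Longrightarrow> s n * u \<in> U k"
proof -
  obtain M where M: "\<And>m n. m \<ge> M \<Longrightarrow> n \<ge> M \<Longrightarrow> s m - s n \<in> U 0" using C_cauchy[OF s] by metis
  obtain j where j: "\<forall>u\<in>U j. s M * u \<in> U k" using U_mult_continuous[OF C_mem_L[OF s]] by blast
  have "s n * u \<in> U k" if "n \<ge> M" "u \<in> U (max j k)" for n u
  proof -
    have "u \<in> U j" "u \<in> U k" using that(2) U_antimono[of j "max j k"] U_antimono[of k "max j k"] by auto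
    then have "s M * u + (s n - s M) * u \<in> U k"
      using bspec[OF j] M[OF that(1), of M] by (simp add: U_add U_mult)
    then show ?thesis by (simp add: algebra_simps)
  qed
  then show ?thesis using that by blast
qed

lemma C_mult:
  assumes s: "s \<in> carrier C" and t: "t \<in> carrier C"
  shows "(\<lambda>n. s n * t n) \<in> carrier C"
proof (rule C_I)
  show "s n * t n \<in> L" for n by (rule subfield_mult[OF L C_mem_L[OF s] C_mem_L[OF t]])
  fix k
  obtain j1 M1 where 1: "\<And>n u. n \<ge> M1 \<Longrightarrow> u \<in> U j1 \<Longrightarrow> s n * u \<in> U k" using C_bounded[OF s] by metis
  obtain j2 M2 where 2: "\<And>n u. n \<ge> M2 \<Longrightarrow> u \<in> U j2 \<Longrightarrow> t n * u \<in> U k" using C_bounded[OF t] by metis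
  obtain M3 where 3: "\<And>m n. m \<ge> M3 \<Longrightarrow> n \<ge> M3 \<Longrightarrow> s m - s n \<in> U j2" using C_cauchy[OF s] by metis
  obtain M4 where 4: "\<And>m n. m \<ge> M4 \<Longrightarrow> n \<ge> M4 \<Longrightarrow> t m - t n \<in> U j1" using C_cauchy[OF t] by metis
  define M where "M = Max {M1, M2, M3, M4}"
  have M: "M1 \<le> M" "M2 \<le> M" "M3 \<le> M" "M4 \<le> M" by (simp_all add: M_def)
  have "s m * t m - s n * t n \<in> U k" if "m \<ge> M" "n \<ge> M" for m n
  proof -
    have "s m * (t m - t n) + t n * (s m - s n) \<in> U k"
      using that M by (intro U_add 1 2 3 4) simp_all
    then show ?thesis by (simp add: algebra_simps)
  qed
  then show "\<exists>M. \<forall>m\<ge>M. \<forall>n\<ge>M. s m * t m - s n * t n \<in> U k" by blast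
qed

sublocale C: cring C
proof (intro cringI abelian_groupI comm_monoidI)
  fix s assume "s \<in> carrier C"
  then show "\<exists>t\<in>carrier C. t \<oplus>\<^bsub>C\<^esub> s = \<zero>\<^bsub>C\<^esub>"
    by (intro bexI[OF _ C_uminus]) auto
qed (simp_all add: C_add C_mult C_const L_closed algebra_simps)

lemma C_a_inv [simp]: "s \<in> carrier C \<Longrightarrow> \<ominus>\<^bsub>C\<^esub> s = (\<lambda>n. - s n)"
  by (rule C.minus_equality) (simp_all add: C_uminus)

lemma mem_N:
  "s \<in> N \<longleftrightarrow> s \<in> carrier C \<and> (\<forall>k. \<exists>M. \<forall>n\<ge>M. s n \<in> U k)"
  by (simp add: null_ideal_def)

lemma N_E:
  assumes "s \<in> N"
  obtains M where "\<And>n. n \<ge> M \<Longrightarrow> s n \<in> U k"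
  using assms unfolding mem_N by meson

lemma N_mult:
  assumes s: "s \<in> carrier C" and t: "t \<in> N"
  shows "(\<lambda>n. s n * t n) \<in> N"
  unfolding mem_N
proof (intro conjI allI)
  show "(\<lambda>n. s n * t n) \<in> carrier C" using C_mult s t by (simp add: mem_N)
  fix k
  obtain j M1 where 1: "\<And>n u. n \<ge> M1 \<Longrightarrow> u \<in> U j \<Longrightarrow> s n * u \<in> U k" using C_bounded[OF s] by metis
  obtain M2 where 2: "\<And>n. n \<ge> M2 \<Longrightarrow> t n \<in> U j" using N_E[OF t] by metis
  have "s n * t n \<in> U k" if "n \<ge> max M1 M2" for n using that by (intro 1 2) simp_all
  then show "\<exists>M. \<forall>n\<ge>M. s n * t n \<in> U k" by blast
qed

sublocale N: ideal N C
proof (rule idealI[OF C.ring_axioms])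
  show "subgroup N (add_monoid C)"
  proof (rule C.add.subgroupI)
    show "N \<subseteq> carrier C" by (auto simp: mem_N)
    have "(\<lambda>n. 0) \<in> N" by (simp add: mem_N C_const L_closed U_0)
    then show "N \<noteq> {}" by blast
  next
    fix s assume s: "s \<in> N"
    then have sC: "s \<in> carrier C" by (simp add: mem_N)
    have "\<exists>M. \<forall>n\<ge>M. - s n \<in> U k" for k
    proof -
      obtain M where "\<And>n. n \<ge> M \<Longrightarrow> s n \<in> U k" using N_E[OF s] by metis
      then show ?thesis using U_uminus by blast
    qed
    then show "\<ominus>\<^bsub>C\<^esub> s \<in> N" using sC by (simp add: mem_N C_uminus)
  next
    fix s t assume st: "s \<in> N" "t \<in> N"
    then have "s \<in> carrier C" "t \<in> carrier C" by (simp_all add: mem_N)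
    moreover have "\<exists>M. \<forall>n\<ge>M. s n + t n \<in> U k" for k
    proof -
      obtain M1 where 1: "\<And>n. n \<ge> M1 \<Longrightarrow> s n \<in> U k" using N_E[OF st(1)] by metis
      obtain M2 where 2: "\<And>n. n \<ge> M2 \<Longrightarrow> t n \<in> U k" using N_E[OF st(2)] by metis
      have "s n + t n \<in> U k" if "n \<ge> max M1 M2" for n using that by (intro U_add 1 2) simp_all
      then show ?thesis by blast
    qed
    ultimately show "s \<oplus>\<^bsub>C\<^esub> t \<in> N" by (simp add: mem_N C_add)
  qed
next
  fix s t assume "s \<in> N" "t \<in> carrier C"
  then show "t \<otimes>\<^bsub>C\<^esub> s \<in> N" using N_mult by simp
  then show "s \<otimes>\<^bsub>C\<^esub> t \<in> N" by (simp add: mult.commute)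
qed

sublocale CL: ring CL
  unfolding completion_def by (rule N.quotient_is_ring)

sublocale emb: ring_hom_ring C CL "\<lambda>s. N +>\<^bsub>C\<^esub> s"
  unfolding completion_def by (rule N.rcos_ring_hom_ring)

lemma CL_zero: "\<zero>\<^bsub>CL\<^esub> = N"
  by (simp add: completion_def FactRing_def)

lemma completion_emb_closed: "x \<in> L \<Longrightarrow> completion_emb L P x \<in> carrier CL"
  unfolding completion_emb_def by (rule emb.hom_closed) (rule C_const)

lemma completion_emb_diff:
  assumes "x \<in> L" "y \<in> L"
  shows "completion_emb L P x \<ominus>\<^bsub>CL\<^esub> completion_emb L P y = completion_emb L P (x - y)"
proof -
  have "completion_emb L P x \<ominus>\<^bsub>CL\<^esub> completion_emb L P y = N +>\<^bsub>C\<^esub> ((\<lambda>n. x) \<oplus>\<^bsub>C\<^esub> \<ominus>\<^bsub>C\<^esub> (\<lambda>n. y))"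
    unfolding completion_emb_def a_minus_def
    using emb.hom_add[OF C_const[OF assms(1)] C.a_inv_closed[OF C_const[OF assms(2)]]]
      emb.hom_a_inv[OF C_const[OF assms(2)]] by (simp only:)
  also have "\<dots> = completion_emb L P (x - y)"
    by (simp add: C_const[OF assms(2)] completion_emb_def)
  finally show ?thesis .
qed

lemma completion_emb_mem_closure:
  assumes "x \<in> S" "x \<in> L"
  shows "completion_emb L P x \<in> completion_closure L P S"
proof -
  have "(\<lambda>n. x) \<in> completion_emb L P x"
    unfolding completion_emb_def using C_const[OF assms(2)] N.a_rcos_self[of "\<lambda>n. x"] by simp
  then show ?thesis
    using completion_emb_closed[OF assms(2)] assms(1) by (auto simp: completion_closure_def)
qed

lemma closure_subset: "S \<subseteq> T \<Longrightarrow> completion_closure L P S \<subseteq> completion_closure L P T"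
  unfolding completion_closure_def by blast

text \<open>U k is closed: the constant sequence differs from a sequence in U k by a null sequence,
  whose late terms lie in U k.\<close>

lemma emb_mem_closure_U:
  assumes "x \<in> L" "completion_emb L P x \<in> completion_closure L P (U k)"
  shows "x \<in> U k"
proof -
  obtain s where s: "s \<in> N +>\<^bsub>C\<^esub> (\<lambda>n. x)" "range s \<subseteq> U k"
    using assms(2) by (auto simp: completion_closure_def completion_emb_def)
  then obtain h where h: "h \<in> N" "s = (\<lambda>n. h n + x)"
    by (auto simp: a_r_coset_def r_coset_def)
  obtain M where "\<And>n. n \<ge> M \<Longrightarrow> h n \<in> U k" using N_E[OF h(1)] by metis
  then have "h M \<in> U k" by simp
  moreover have "h M + x \<in> U k" using s(2) h(2) by auto
  ultimately have "h M + x - h M \<in> U k" by (intro U_diff)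
  then show ?thesis by simp
qed

section \<open>Ramification groups\<close>

lemma id_mem_local_ram_lower:
  "(\<lambda>A\<in>carrier CL. A) \<in> local_ram_lower K L P i"
proof -
  have "(\<lambda>A\<in>carrier CL. A) \<in> carrier (local_galois_group K L P)"
    using id_Bij[of "carrier CL"]
    by (auto simp: local_galois_group_def aut_fixing_def Ring.ring_hom_def completion_closure_def)
  moreover have "A \<ominus>\<^bsub>CL\<^esub> A \<in> completion_closure L P (U (i + 1))" if "A \<in> carrier CL" for A
  proof -
    \<comment> \<open>The zero of the completion is the coset \<open>N\<close> itself, and the zero
      sequence is a representative of it with values in U (i + 1).\<close>
    have "A \<ominus>\<^bsub>CL\<^esub> A = N" unfolding CL.minus_eq CL.r_neg[OF that] by (rule CL_zero)
    moreover have "(\<lambda>n. 0) \<in> N" using N.zero_closed by simp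
    moreover have "N \<in> carrier CL" using CL.zero_closed by (simp add: CL_zero)
    ultimately show ?thesis using U_0 unfolding completion_closure_def by (auto intro!: bexI[of _ "\<lambda>n. 0"])
  qed
  ultimately show ?thesis by (auto simp: local_ram_lower_def completion_closure_def)
qed

lemma one_mem_ram_lower:
  assumes "K \<subseteq> L"
  shows "\<one>\<^bsub>galois_group K L\<^esub> \<in> ram_lower K L P i"
proof -
  interpret G: group "galois_group K L" by (rule group_galois_group[OF L assms])
  have "\<forall>x\<in>L. (\<lambda>A\<in>carrier CL. A) (completion_emb L P x) = completion_emb L P (\<one>\<^bsub>galois_group K L\<^esub> x)"
    using completion_emb_closed by (simp add: galois_group_simps)
  then show ?thesis
    using id_mem_local_ram_lower[of K i] G.one_closed unfolding ram_lower_def by blast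
qed

lemma ram_lower_antimono:
  assumes "i \<le> j"
  shows "ram_lower K L P j \<subseteq> ram_lower K L P i"
proof -
  have "completion_closure L P (U (j + 1)) \<subseteq> completion_closure L P (U (i + 1))"
    using assms by (intro closure_subset U_antimono) simp
  then have "local_ram_lower K L P j \<subseteq> local_ram_lower K L P i"
    unfolding local_ram_lower_def by blast
  then show ?thesis unfolding ram_lower_def by blast
qed

text \<open>The condition on the completion is tested on the image of \<open>x\<close> and pulled
  back: the closure of U (i + 1) meets L in U (i + 1), and this meets the integers in
  P^(i+1).\<close>

lemma ram_lower_diff:
  assumes "\<tau> \<in> ram_lower K L P i" "x \<in> ints L" "\<tau> x \<in> ints L"
  shows "\<tau> x - x \<in> P \<up> (i + 1)"
proof -
  have xL: "x \<in> L" "\<tau> x \<in> L" using assms ints_subset by auto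
  obtain \<sigma> where \<sigma>: "\<sigma> \<in> local_ram_lower K L P i" "\<sigma> (completion_emb L P x) = completion_emb L P (\<tau> x)"
    using assms(1) xL(1) unfolding ram_lower_def by blast
  have "x \<in> U 0" using ipow_subset_U[of 0] assms(2) by auto
  then have "completion_emb L P x \<in> completion_closure L P (U 0)"
    using xL by (intro completion_emb_mem_closure)
  then have "\<sigma> (completion_emb L P x) \<ominus>\<^bsub>CL\<^esub> completion_emb L P x \<in> completion_closure L P (U (i + 1))"
    using \<sigma>(1) unfolding local_ram_lower_def by blast
  then have "completion_emb L P (\<tau> x - x) \<in> completion_closure L P (U (i + 1))"
    using completion_emb_diff xL \<sigma>(2) by simp
  then have "\<tau> x - x \<in> U (i + 1)" using emb_mem_closure_U L_closed(7)[OF xL(2,1)] by blast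
  then show ?thesis using U_inter_ints ints_closed(6)[OF assms(3,2)] by blast
qed

end

text \<open>\<open>\<tau>\<close> fixes the rational integers, hence the coefficients of a monic
  integral equation of \<open>x\<close>.\<close>

lemma algebraic_int_hom:
  assumes L: "subfield L \<R>" and \<tau>: "hom_on L \<tau>" and x: "x \<in> L" "algebraic_int x"
  shows "algebraic_int (\<tau> x)"
proof -
  obtain p where p: "Polynomial.lead_coeff p = 1" "\<And>i. Polynomial.coeff p i \<in> \<int>" "poly p x = 0"
    using x(2) by (auto elim: algebraic_int.cases)
  have nat: "\<tau> (of_nat n) = of_nat n" for n
    by (induction n) (simp_all add: hom_on_zero[OF L \<tau>] hom_on_one[OF L \<tau>] hom_on_add[OF L \<tau>] subfield_one[OF L] subfield_of_nat[OF L])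
  have "\<tau> (of_int n) = of_int n" for n
    by (cases n rule: int_cases2) (simp_all add: nat hom_on_uminus[OF L \<tau>] subfield_of_nat[OF L])
  then have "\<tau> (Polynomial.coeff p i) = Polynomial.coeff p i" for i
    using p(2)[of i] by (metis Ints_cases)
  then have "map_poly \<tau> p = p" by (intro poly_eqI) (simp add: coeff_map_hom[OF L \<tau>])
  moreover have "poly_over L p"
    using p(2) subfield_of_int[OF L] unfolding poly_over_def by (metis Ints_cases)
  ultimately have "poly p (\<tau> x) = \<tau> (poly p x)" using map_hom_poly[OF L \<tau> _ x(1)] by simp
  then show ?thesis
    using p by (intro algebraic_int.intros[of p]) (simp_all add: hom_on_zero[OF L \<tau>])
qed

lemma galois_group_ints:
  assumes "subfield L \<R>" and \<tau>: "\<tau> \<in> carrier (galois_group K L)" and "x \<in> ints L"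
  shows "\<tau> x \<in> ints L"
proof -
  have x: "x \<in> L" "algebraic_int x" using assms(3) by (simp_all add: ints_def)
  have "\<tau> x \<in> L" using \<tau> x(1) by (rule galois_group_mem_closed)
  moreover have "algebraic_int (\<tau> x)"
    using assms(1) galois_group_hom_on[OF \<tau>] x by (rule algebraic_int_hom)
  ultimately show ?thesis by (simp add: ints_def)
qed

lemma (in num_field) galois_eq_one_if_fixes_ints:
  assumes \<tau>: "\<tau> \<in> carrier (galois_group K L)" and fixed: "\<And>x. x \<in> ints L \<Longrightarrow> \<tau> x = x"
  shows "\<tau> = \<one>\<^bsub>galois_group K L\<^esub>"
proof -
  note h = galois_group_hom_on[OF \<tau>]
  have "\<tau> x = x" if x: "x \<in> L" for x
  proof -
    obtain n where n: "n > 0" "of_nat n * x \<in> ints L" using int_multiple[OF x] .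
    have "\<tau> (of_nat n * x) = of_nat n * \<tau> x"
      using fixed[OF ints_closed(7)] hom_on_mult[OF L h subfield_of_nat[OF L] x] by simp
    then have "of_nat n * \<tau> x = of_nat n * x" using fixed[OF n(2)] by metis
    moreover have "of_nat n \<noteq> (0 :: 'a)" using n(1) by simp
    ultimately show ?thesis by (metis mult_left_cancel)
  qed
  moreover have "\<tau> \<in> extensional L" using \<tau> by (simp add: mem_galois_group)
  ultimately show ?thesis unfolding galois_group_simps by (intro extensionalityI[of _ L]) auto
qed

text \<open>The filtration is separated, so an automorphism in all the groups fixes every integer
  and is 1. Each of the finitely many others is missing from some group, and the largest of the
  indices serves.\<close>

lemma (in num_field_prime) ram_lower_eventually_trivial:
  assumes "K \<subseteq> L" "finite (carrier (galois_group K L))"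
  shows "\<exists>i0. \<forall>i\<ge>i0. ram_lower K L P i = {\<one>\<^bsub>galois_group K L\<^esub>}"
proof -
  have "\<exists>i. \<tau> \<notin> ram_lower K L P i" if "\<tau> \<in> carrier (galois_group K L)" "\<tau> \<noteq> \<one>\<^bsub>galois_group K L\<^esub>" for \<tau>
  proof (rule ccontr)
    assume *: "\<not> ?thesis"
    have "\<tau> x = x" if x: "x \<in> ints L" for x
    proof -
      have "\<tau> x - x \<in> U k" for k
      proof -
        have "\<tau> x - x \<in> P \<up> (k + 1)"
          using * x galois_group_ints[OF L \<open>\<tau> \<in> carrier _\<close> x] by (intro ram_lower_diff) auto
        then have "\<tau> x - x \<in> U (k + 1)" by (rule subsetD[OF ipow_subset_U])
        then show ?thesis using U_antimono[of k "k + 1"] by auto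
      qed
      then have "\<tau> x - x = 0" by (rule U_Inter)
      then show ?thesis by simp
    qed
    then show False using galois_eq_one_if_fixes_ints that by blast
  qed
  then obtain i where i: "\<And>\<tau>. \<tau> \<in> carrier (galois_group K L) \<Longrightarrow> \<tau> \<noteq> \<one>\<^bsub>galois_group K L\<^esub> \<Longrightarrow> \<tau> \<notin> ram_lower K L P (i \<tau>)"
    by metis
  define i0 where "i0 = Max (i ` carrier (galois_group K L))"
  have "ram_lower K L P j = {\<one>\<^bsub>galois_group K L\<^esub>}" if "j \<ge> i0" for j
  proof (intro subset_antisym subsetI)
    fix \<tau> assume \<tau>: "\<tau> \<in> ram_lower K L P j"
    then have \<tau>G: "\<tau> \<in> carrier (galois_group K L)" by (simp add: ram_lower_def)
    then have "i \<tau> \<le> j" using that assms(2) unfolding i0_def by (meson Max_ge finite_imageI imageI le_trans)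
    then have "\<tau> \<in> ram_lower K L P (i \<tau>)" using \<tau> ram_lower_antimono by blast
    then show "\<tau> \<in> {\<one>\<^bsub>galois_group K L\<^esub>}" using i[OF \<tau>G] by blast
  qed (use one_mem_ram_lower[OF assms(1)] in auto)
  then show ?thesis by blast
qed

section \<open>The Herbrand function\<close>

text \<open>\<open>g\<close> stands for the orders of the ramification groups. The integrand lies
  between 1 / g 0 and 1, so \<open>H\<close> is continuous, strictly increasing and unbounded, with
  H u \<le> u; hence the description of \<open>u\<close> has exactly one solution, and it is at
  least \<open>e\<close>.\<close>

lemma
  fixes g :: "nat \<Rightarrow> nat" and e :: nat
  assumes anti: "\<And>i j. i \<le> j \<Longrightarrow> g j \<le> g i" and pos: "\<And>i. g i > 0"
  defines "H \<equiv> \<lambda>u. integral {0..u} (\<lambda>t. real (g (nat \<lceil>t\<rceil>)) / real (g 0))"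
  defines "u \<equiv> THE u. u \<ge> 0 \<and> H u = real e"
  shows herbrand_inverse_ge: "u \<ge> real e" and herbrand_inverse_0: "e = 0 \<Longrightarrow> u = 0"
proof -
  define f where "f t = real (g (nat \<lceil>t\<rceil>)) / real (g 0)" for t :: real
  define c where "c = 1 / real (g 0)"
  have "c > 0" using pos by (simp add: c_def)
  have f_anti: "f t \<le> f s" if "s \<le> t" for s t
    unfolding f_def using that pos[of 0] by (intro divide_right_mono of_nat_mono anti nat_mono ceiling_mono) auto
  have f_int: "f integrable_on {a..b}" for a b
  proof -
    \<comment> \<open>Monotonicity gives integrability; the sign turns the decreasing
      \<open>f\<close> into an increasing function.\<close>
    have "(\<lambda>t. - f t) integrable_on {a..b}"
      by (rule integrable_on_mono_on) (auto intro!: mono_onI f_anti)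
    then show ?thesis by (simp add: integrable_neg_iff)
  qed
  have f_le: "f t \<le> 1" and f_ge: "c \<le> f t" for t
  proof -
    have "g (nat \<lceil>t\<rceil>) \<le> g 0" "g (nat \<lceil>t\<rceil>) \<ge> 1" using anti[of 0] pos[of "nat \<lceil>t\<rceil>"] by (simp_all add: Suc_leI)
    then show "f t \<le> 1" "c \<le> f t" using pos[of 0] by (simp_all add: f_def c_def divide_right_mono)
  qed
  have H_eq: "H = (\<lambda>u. integral {0..u} f)" unfolding H_def f_def ..
  have diff: "H b - H a = integral {a..b} f" if "0 \<le> a" "a \<le> b" for a b
    using Henstock_Kurzweil_Integration.integral_combine[OF that f_int[of 0 b]] by (simp add: H_eq)
  have upper: "H b - H a \<le> b - a" and lower: "c * (b - a) \<le> H b - H a" if "0 \<le> a" "a \<le> b" for a b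
  proof -
    have "integral {a..b} f \<le> integral {a..b} (\<lambda>t. 1)" by (intro integral_le f_int f_le) auto
    then show "H b - H a \<le> b - a" using diff[OF that] that by simp
    have "integral {a..b} (\<lambda>t. c) \<le> integral {a..b} f" by (intro integral_le f_int f_ge) auto
    then show "c * (b - a) \<le> H b - H a" using diff[OF that] that by (simp add: mult.commute)
  qed
  have H0: "H 0 = 0" by (simp add: H_def)
  have cont: "continuous_on {0..b} H" for b
    unfolding H_eq using indefinite_integral_continuous_1[OF f_int] by simp
  \<comment> \<open>The lower bound c b \<le> H b shows that \<open>H\<close> has reached
    \<open>e\<close> at e / c, so the intermediate value theorem applies on {0..b}.\<close>
  define b where "b = real e / c"
  have "b \<ge> 0" using \<open>c > 0\<close> by (simp add: b_def)
  have "real e \<le> H b" using lower[of 0 b] \<open>b \<ge> 0\<close> \<open>c > 0\<close> H0 by (simp add: b_def)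
  then obtain v where v: "0 \<le> v" "H v = real e"
    using IVT'[of H 0 "real e" b] H0 \<open>b \<ge> 0\<close> cont by auto
  have inj: "x = y" if "0 \<le> x" "0 \<le> y" "H x = H y" for x y
  proof (rule ccontr)
    assume "x \<noteq> y"
    then have "c * (max x y - min x y) > 0" using \<open>c > 0\<close> by (simp add: max_def min_def)
    moreover have "c * (max x y - min x y) \<le> H (max x y) - H (min x y)" using that by (intro lower) auto
    ultimately show False using that by (simp add: max_def min_def split: if_splits)
  qed
  have "u = v" unfolding u_def
  proof (rule the_equality)
    show "0 \<le> v \<and> H v = real e" using v by simp
    fix w assume w: "0 \<le> w \<and> H w = real e"
    then have "H w = H v" using v(2) by metis
    then show "w = v" using w v(1) inj by blast
  qed
  show "u \<ge> real e" using upper[of 0 v] v H0 \<open>u = v\<close> by simp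
  show "u = 0" if "e = 0" using inj[of v 0] v H0 \<open>u = v\<close> that by simp
qed

context num_field_prime
begin

context
  fixes K assumes KL: "K \<subseteq> L" and fin: "finite (carrier (galois_group K L))"
begin

text \<open>phi(u) = e forces u \<ge> e, and the lower groups decrease. At e = 0 the solution is u =
  0, so the upper group there is the inertia group.\<close>

lemma
  shows ram_upper_subset: "ram_upper K L P e \<subseteq> ram_lower K L P e"
    and ram_upper_supset: "\<one>\<^bsub>galois_group K L\<^esub> \<in> ram_upper K L P e"
    and ram_upper_0: "ram_upper K L P 0 = ram_lower K L P 0"
proof -
  define g where "g i = card (ram_lower K L P i)" for i
  have sub: "ram_lower K L P i \<subseteq> carrier (galois_group K L)" for i by (auto simp: ram_lower_def)
  have finr: "finite (ram_lower K L P i)" for i using finite_subset[OF sub fin] .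
  have anti: "g j \<le> g i" if "i \<le> j" for i j
    unfolding g_def using card_mono[OF finr ram_lower_antimono[OF that]] .
  have pos: "g i > 0" for i
    unfolding g_def using finr one_mem_ram_lower[OF KL] by (auto simp: card_gt_0_iff)
  define u where "u e = (THE u. u \<ge> 0 \<and> herbrand K L P u = real e)" for e :: nat
  have u: "u e \<ge> real e" "e = 0 \<Longrightarrow> u e = 0" for e
    using herbrand_inverse_ge[OF anti pos, where e = e] herbrand_inverse_0[OF anti pos, where e = e]
    by (simp_all add: u_def herbrand_def g_def)
  have up: "ram_upper K L P e = ram_lower K L P (nat \<lceil>u e\<rceil>)" for e
    by (simp add: ram_upper_def u_def)
  have "e \<le> nat \<lceil>u e\<rceil>" using u(1)[of e] by linarith
  then show "ram_upper K L P e \<subseteq> ram_lower K L P e" unfolding up by (rule ram_lower_antimono)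
  show "\<one>\<^bsub>galois_group K L\<^esub> \<in> ram_upper K L P e" unfolding up by (rule one_mem_ram_lower[OF KL])
  show "ram_upper K L P 0 = ram_lower K L P 0" unfolding up using u(2)[of 0] by simp
qed

lemma ram_upper_eventually_trivial:
  "\<exists>e0. \<forall>e\<ge>e0. ram_upper K L P e = {\<one>\<^bsub>galois_group K L\<^esub>}"
proof -
  obtain i0 where "\<forall>i\<ge>i0. ram_lower K L P i = {\<one>\<^bsub>galois_group K L\<^esub>}"
    using ram_lower_eventually_trivial[OF KL fin] by blast
  then have "ram_upper K L P e = {\<one>\<^bsub>galois_group K L\<^esub>}" if "e \<ge> i0" for e
    using ram_upper_subset[of e] ram_upper_supset[of e] that by blast
  then show ?thesis by blast
qed

end

end

section \<open>The ideal \<open>\<ff>\<close> and the units of the monoids \<open>D\<close>\<close>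

locale galois_ext = K: num_field K + L: num_field L for K L :: "'a::field_char_0 set" +
  assumes KL: "K \<subseteq> L" and finite_group: "finite (carrier (galois_group K L))"
begin

sublocale G: group "galois_group K L"
  by (rule group_galois_group[OF L.L KL])

abbreviation "G_one \<equiv> \<one>\<^bsub>galois_group K L\<^esub>"

text \<open>The exponent at \<open>p\<close> that \<open>ram_ideal\<close> prescribes, in the same
  words, so that the choice made there can be resolved against it.\<close>

definition conductor :: "'a set \<Rightarrow> nat"
  where "conductor p = (LEAST e. \<forall>P \<in> primes_over K L p. ram_upper K L P e = {G_one})"

lemma ints_mono: "ints K \<subseteq> ints L"
  using KL by (auto simp: ints_def)

lemma primes_over_prime: "P \<in> primes_over K L p \<Longrightarrow> num_field_prime L P"
  by unfold_locales (simp add: primes_over_def)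

text \<open>All primes over \<open>p\<close> contain a fixed nonzero element of
  \<open>p\<close>.\<close>

lemma finite_primes_over:
  assumes "p \<in> primes_of K"
  shows "finite (primes_over K L p)"
proof -
  note p = K.primes_ideal[OF assms]
  obtain x where x: "x \<in> p" "x \<noteq> 0" using K.nonzeroE[OF p] .
  have "x \<in> ints L" using x(1) K.ideal_closed(1)[OF p(1)] ints_mono by blast
  then have "finite {I. L.Ideal I \<and> x \<in> I}" using x(2) by (rule L.finite_ideals_containing)
  moreover have "primes_over K L p \<subseteq> {I. L.Ideal I \<and> x \<in> I}"
    using x(1) L.primes_ideal(1) unfolding primes_over_def by blast
  ultimately show ?thesis by (rule finite_subset[rotated])
qed

text \<open>Each P over p has a bound beyond which its groups are trivial. The maximum of these
  finitely many bounds shows that the minimum in \<open>conductor\<close> is taken over a nonempty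
  set.\<close>

lemma ram_upper_conductor:
  assumes "p \<in> primes_of K" "P \<in> primes_over K L p"
  shows "ram_upper K L P (conductor p) = {G_one}"
proof -
  have "\<exists>e0. \<forall>e\<ge>e0. ram_upper K L Q e = {G_one}" if "Q \<in> primes_over K L p" for Q
    using num_field_prime.ram_upper_eventually_trivial[OF primes_over_prime[OF that] KL finite_group] .
  then obtain e0 where e0: "\<And>Q e. Q \<in> primes_over K L p \<Longrightarrow> e0 Q \<le> e \<Longrightarrow> ram_upper K L Q e = {G_one}"
    by metis
  define e where "e = Max (e0 ` primes_over K L p)"
  have "e0 Q \<le> e" if "Q \<in> primes_over K L p" for Q
    unfolding e_def using finite_primes_over[OF assms(1)] that by simp
  then have "\<forall>P \<in> primes_over K L p. ram_upper K L P e = {G_one}" using e0 by simp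
  then have "\<forall>P \<in> primes_over K L p. ram_upper K L P (conductor p) = {G_one}"
    unfolding conductor_def by (rule LeastI)
  with assms(2) show ?thesis by simp
qed

text \<open>If \<open>\<tau> \<noteq> 1\<close> moves the integer \<open>x\<close> and lies in the inertia group of \<open>P\<close>, then \<open>P\<close> is one of the
  finitely many ideals that contain \<open>\<tau> x - x\<close>.\<close>
lemma finite_conductor_support: "finite {p \<in> primes_of K. conductor p \<noteq> 0}"
proof -
  define G where "G = carrier (galois_group K L) - {G_one}"
  have "\<exists>x\<in>ints L. \<tau> x \<noteq> x" if "\<tau> \<in> G" for \<tau>
    using L.galois_eq_one_if_fixes_ints[of \<tau> K] that unfolding G_def by blast
  then obtain x where x: "\<And>\<tau>. \<tau> \<in> G \<Longrightarrow> x \<tau> \<in> ints L" "\<And>\<tau>. \<tau> \<in> G \<Longrightarrow> \<tau> (x \<tau>) \<noteq> x \<tau>" by metis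
  have \<tau>x: "\<tau> (x \<tau>) \<in> ints L" if "\<tau> \<in> G" for \<tau>
    using galois_group_ints[OF L.L _ x(1)[OF that], of \<tau> K] that unfolding G_def by blast
  define B where "B = (\<Union>\<tau>\<in>G. {I. L.Ideal I \<and> \<tau> (x \<tau>) - x \<tau> \<in> I})"
  have "finite {I. L.Ideal I \<and> \<tau> (x \<tau>) - x \<tau> \<in> I}" if "\<tau> \<in> G" for \<tau>
    using L.finite_ideals_containing[OF L.ints_closed(6)[OF \<tau>x[OF that] x(1)[OF that]]] x(2)[OF that] by simp
  then have "finite B" unfolding B_def using finite_group by (simp add: G_def)
  have "{p \<in> primes_of K. conductor p \<noteq> 0} \<subseteq> (\<lambda>P. P \<inter> K) ` B"
  proof
    fix p assume p: "p \<in> {p \<in> primes_of K. conductor p \<noteq> 0}"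
    have "\<not> (\<forall>P \<in> primes_over K L p. ram_upper K L P 0 = {G_one})"
    proof
      assume "\<forall>P \<in> primes_over K L p. ram_upper K L P 0 = {G_one}"
      then have "conductor p = 0" unfolding conductor_def by (rule Least_eq_0)
      with p show False by simp
    qed
    then obtain P where P: "P \<in> primes_over K L p" "ram_upper K L P 0 \<noteq> {G_one}" by blast
    interpret P: num_field_prime L P by (rule primes_over_prime[OF P(1)])
    have "ram_lower K L P 0 \<noteq> {G_one}" using P(2) P.ram_upper_0[OF KL finite_group] by simp
    then obtain \<tau> where \<tau>: "\<tau> \<in> ram_lower K L P 0" "\<tau> \<noteq> G_one"
      using P.one_mem_ram_lower[OF KL, of 0] by blast
    then have G: "\<tau> \<in> G" unfolding G_def ram_lower_def by simp
    have "\<tau> (x \<tau>) - x \<tau> \<in> L.iprod (ints L) P"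
      using P.ram_lower_diff[OF \<tau>(1) x(1)[OF G] \<tau>x[OF G]] by simp
    then have "\<tau> (x \<tau>) - x \<tau> \<in> P" unfolding L.iprod_ints(1)[OF P.P] .
    then have "P \<in> B" unfolding B_def using G P.P by blast
    \<comment> \<open>\<open>p\<close> is recovered from \<open>P\<close>, so finitely many
      \<open>P\<close> leave finitely many \<open>p\<close>.\<close>
    moreover have "p = P \<inter> K" using P(1) unfolding primes_over_def by blast
    ultimately show "p \<in> (\<lambda>P. P \<inter> K) ` B" by (rule rev_image_eqI)
  qed
  then show ?thesis using \<open>finite B\<close> finite_subset by blast
qed

text \<open>\<open>ram_ideal\<close> is a choice, so its properties follow once one ideal with the
  prescribed valuations is known; the finite support of \<open>conductor\<close> permits its
  construction.\<close>

lemma ram_ideal: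
  shows ram_ideal_ideal: "K.Ideal (ram_ideal K L)" and ram_ideal_nonzero: "ram_ideal K L \<noteq> {0}"
    and ideal_val_ram_ideal: "p \<in> primes_of K \<Longrightarrow> ideal_val K p (ram_ideal K L) = conductor p"
proof -
  have "\<exists>I. K.Ideal I \<and> I \<noteq> {0} \<and> (\<forall>p\<in>primes_of K. \<exists>J. K.Ideal J \<and> \<not> J \<subseteq> p \<and>
      I = K.iprod (p [^]\<^bsub>ideal_monoid K\<^esub> conductor p) J)"
    by (rule K.ideal_with_valuations_exists[OF finite_conductor_support]) simp_all
  then obtain I where I: "K.Ideal I" "I \<noteq> {0}" "\<And>p. p \<in> primes_of K \<Longrightarrow> \<exists>J. K.Ideal J \<and> \<not> J \<subseteq> p \<and>
      I = K.iprod (p [^]\<^bsub>ideal_monoid K\<^esub> conductor p) J" by metis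
  have "ideal_val K p I = conductor p" if "p \<in> primes_of K" for p
    using I(3)[OF that] K.ideal_val_eqI[OF that] by metis
  then have "I \<in> carrier (ideal_monoid K) \<and> (\<forall>p \<in> primes_of K. ideal_val K p I =
      (LEAST e. \<forall>P \<in> primes_over K L p. ram_upper K L P e = {G_one}))"
    using I(1,2) by (simp add: conductor_def)
  then have "ram_ideal K L \<in> carrier (ideal_monoid K) \<and> (\<forall>p \<in> primes_of K. ideal_val K p (ram_ideal K L) =
      (LEAST e. \<forall>P \<in> primes_over K L p. ram_upper K L P e = {G_one}))"
    unfolding ram_ideal_def by (rule someI)
  then show "K.Ideal (ram_ideal K L)" "ram_ideal K L \<noteq> {0}"
    "p \<in> primes_of K \<Longrightarrow> ideal_val K p (ram_ideal K L) = conductor p"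
    by (simp_all add: conductor_def)
qed

lemma ram_field_ram_ideal: "ram_field K L (ram_ideal K L) = L"
proof -
  define R where "R = (\<Union>p \<in> primes_of K. \<Union>P \<in> primes_over K L p. ram_upper K L P (ideal_val K p (ram_ideal K L)))"
  have "R \<subseteq> {G_one}"
    unfolding R_def using ideal_val_ram_ideal ram_upper_conductor by simp
  then have "generate (galois_group K L) R \<subseteq> generate (galois_group K L) {G_one}"
    by (rule G.mono_generate)
  then have "generate (galois_group K L) R \<subseteq> {G_one}" unfolding G.generate_one .
  then have "\<sigma> x = x" if "\<sigma> \<in> generate (galois_group K L) R" "x \<in> L" for \<sigma> x
    using that by (auto simp: galois_group_simps)
  then show ?thesis
    unfolding ram_field_def R_def[symmetric] fixed_field_def by (intro subset_antisym subsetI) simp_all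
qed

text \<open>(1) is neutral for the product of ideals, so the description in
  \<open>ideal_quot\<close> has \<open>ram_ideal K L\<close> as its only solution here.\<close>

lemma quot_field_ints: "quot_field K L (ints K) = L"
proof -
  have "ideal_quot K (ram_ideal K L) (ints K) = ram_ideal K L"
    unfolding ideal_quot_def
  proof (rule the_equality)
    show "ram_ideal K L \<in> carrier (ideal_monoid K) \<and> ints K \<otimes>\<^bsub>ideal_monoid K\<^esub> ram_ideal K L = ram_ideal K L"
      by (simp add: K.iprod_ints(1)[OF ram_ideal_ideal] ram_ideal_ideal ram_ideal_nonzero)
    fix I assume "I \<in> carrier (ideal_monoid K) \<and> ints K \<otimes>\<^bsub>ideal_monoid K\<^esub> I = ram_ideal K L"
    then have "K.Ideal I" "K.iprod (ints K) I = ram_ideal K L" by simp_all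
    then show "I = ram_ideal K L" using K.iprod_ints(1) by metis
  qed
  then show ?thesis unfolding quot_field_def by (simp only: ram_field_ram_ideal)
qed

lemma ideal_gcd_mem: "x \<in> ideal_gcd K I J \<longleftrightarrow> (\<exists>a\<in>I. \<exists>b\<in>J. x = a + b)"
  unfolding ideal_gcd_def set_add_def' by simp

lemma ideal_gcd_ints:
  assumes "K.Ideal I"
  shows "ideal_gcd K I (ints K) = ints K" "ideal_gcd K (ints K) I = ints K"
proof -
  note I = K.ideal_closed(1,2)[OF assms]
  have 1: "x = 0 + x" "x = x + 0" for x :: 'a by simp_all
  show "ideal_gcd K I (ints K) = ints K"
  proof (intro subset_antisym subsetI)
    fix x assume "x \<in> ideal_gcd K I (ints K)"
    then show "x \<in> ints K" using I(1) K.ints_closed(4) unfolding ideal_gcd_mem by blast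
  next
    fix x assume "x \<in> ints K"
    then show "x \<in> ideal_gcd K I (ints K)" using I(2) 1(1) unfolding ideal_gcd_mem by metis
  qed
  show "ideal_gcd K (ints K) I = ints K"
  proof (intro subset_antisym subsetI)
    fix x assume "x \<in> ideal_gcd K (ints K) I"
    then show "x \<in> ints K" using I(1) K.ints_closed(4) unfolding ideal_gcd_mem by blast
  next
    fix x assume "x \<in> ints K"
    then show "x \<in> ideal_gcd K (ints K) I" using I(2) 1(2) unfolding ideal_gcd_mem by metis
  qed
qed

section \<open>The part of the monoid over the trivial ideal\<close>

lemma D_monoid_simps:
  "x \<otimes>\<^bsub>D_monoid K L\<^esub> y = D_mult K L x y" "\<one>\<^bsub>D_monoid K L\<^esub> = (ints K, G_one)"
  by (simp_all add: D_monoid_def quot_field_ints)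

lemma mem_D_monoid:
  "(d, \<sigma>) \<in> carrier (D_monoid K L) \<longleftrightarrow> K.Ideal d \<and> d \<noteq> {0} \<and>
    (\<exists>c. K.Ideal c \<and> c \<noteq> {0} \<and> ram_ideal K L = K.iprod d c) \<and> \<sigma> \<in> carrier (galois_group K (quot_field K L d))"
  by (auto simp: D_monoid_def factor_def)

lemma mem_D_monoid_ints:
  "(ints K, \<sigma>) \<in> carrier (D_monoid K L) \<longleftrightarrow> \<sigma> \<in> carrier (galois_group K L)"
  unfolding mem_D_monoid quot_field_ints
  using K.ideal_ints K.ints_nonzero ram_ideal_ideal ram_ideal_nonzero K.iprod_ints(1) by metis

lemma D_mult_ints:
  assumes "\<sigma> \<in> carrier (galois_group K L)" "\<tau> \<in> carrier (galois_group K L)"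
  shows "D_mult K L (ints K, \<sigma>) (ints K, \<tau>) = (ints K, \<sigma> \<otimes>\<^bsub>galois_group K L\<^esub> \<tau>)"
proof -
  have "restrict \<sigma> L = \<sigma>" "restrict \<tau> L = \<tau>"
    using assms by (simp_all add: mem_galois_group extensional_restrict)
  then show ?thesis
    by (simp add: D_mult_def Let_def K.iprod_ints(1)[OF K.ideal_ints] ideal_gcd_ints(1)[OF ram_ideal_ideal] quot_field_ints)
qed

lemma D_transition_ints: "D_transition K L (ints K, \<sigma>) = (ints K, restrict \<sigma> L)"
  by (simp add: D_transition_def Let_def ideal_gcd_ints(2)[OF ram_ideal_ideal] quot_field_ints)

lemma D_monoid_unit:
  assumes x: "x \<in> carrier (D_monoid K L)" and y: "y \<in> carrier (D_monoid K L)"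
    and one: "x \<otimes>\<^bsub>D_monoid K L\<^esub> y = \<one>\<^bsub>D_monoid K L\<^esub>"
  obtains \<sigma> where "\<sigma> \<in> carrier (galois_group K L)" "x = (ints K, \<sigma>)"
proof -
  obtain d \<sigma> where x_eq: "x = (d, \<sigma>)" by (cases x)
  obtain d' \<sigma>' where y_eq: "y = (d', \<sigma>')" by (cases y)
  obtain c where d: "K.Ideal d" "K.Ideal c" "ram_ideal K L = K.iprod d c"
    using x unfolding x_eq mem_D_monoid by blast
  have d': "K.Ideal d'" using y unfolding y_eq mem_D_monoid by blast
  have "ideal_gcd K (ram_ideal K L) (K.iprod d d') = ints K"
    using one by (simp add: x_eq y_eq D_monoid_simps D_mult_def Let_def)
  then have "1 \<in> ideal_gcd K (ram_ideal K L) (K.iprod d d')" using K.ints_closed(2) by simp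
  then obtain a b where ab: "a \<in> ram_ideal K L" "b \<in> K.iprod d d'" "1 = a + b"
    unfolding ideal_gcd_mem by blast
  \<comment> \<open>\<open>d\<close> divides \<open>ram_ideal K L\<close>, and a product of ideals
    is contained in each factor, so both summands of 1 lie in \<open>d\<close>.\<close>
  have "a \<in> d" using ab(1) K.iprod_subset[OF d(1,2)] unfolding d(3) by blast
  moreover have "b \<in> d" using ab(2) K.iprod_subset[OF d(1) d'] by blast
  ultimately have "1 \<in> d" unfolding ab(3) by (rule K.ideal_closed(3)[OF d(1)])
  then have "d = ints K" by (rule K.ideal_eq_ints[OF d(1)])
  then have "x = (ints K, \<sigma>)" by (simp add: x_eq)
  moreover from this x have "\<sigma> \<in> carrier (galois_group K L)" by (simp add: mem_D_monoid_ints)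
  ultimately show ?thesis by (intro that)
qed

end

section \<open>The directed system of finite Galois extensions\<close>

lemma number_field_finite_galois:
  assumes "number_field K" "finite_galois K L"
  shows "number_field L"
proof -
  interpret R: field "\<R> :: 'a ring" by (rule field_from_type_algebra)
  show ?thesis
    using assms R.telescopic_base_dim(1)[OF subfield_Rats, of K L]
    unfolding number_field_def finite_galois_def by blast
qed

lemma galois_ext_finite_galois:
  fixes K :: "'a::field_char_0 set"
  assumes K: "number_field K" and alg: "\<And>x :: 'a. algebraic_over K x" and L: "finite_galois K L"
  shows "galois_ext K L"
proof
  show "number_field K" by fact
  show "number_field L" by (rule number_field_finite_galois[OF K L])
  show "K \<subseteq> L" using L by (simp add: finite_galois_def)
  have "subfield K \<R>" using K by (simp add: number_field_def)
  then show "finite (carrier (galois_group K L))" using alg L by (rule finite_galois_group)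
qed

text \<open>Finite spanning lists of both fields over K form one finite set; a finite Galois
  extension containing this set contains both spans.\<close>

lemma finite_galois_directed:
  fixes K :: "'a::{alg_closed_field, field_char_0} set"
  assumes K: "subfield K \<R>" and alg: "\<And>x :: 'a. algebraic_over K x"
    and "finite_galois K L1" "finite_galois K L2"
  obtains L where "finite_galois K L" "L1 \<subseteq> L" "L2 \<subseteq> L"
proof -
  interpret R: field "\<R> :: 'a ring" by (rule field_from_type_algebra)
  have span: "\<exists>Us. R.Span K Us = L" if "finite_galois K L" for L
    using that R.exists_base[OF K] R.finite_dimensionE[OF K] unfolding finite_galois_def by blast
  obtain Us where Us: "R.Span K Us = L1" using span[OF assms(3)] by blast
  obtain Vs where Vs: "R.Span K Vs = L2" using span[OF assms(4)] by blast
  obtain L where L: "finite_galois K L" "set Us \<union> set Vs \<subseteq> L"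
    using finite_galois_exists[OF K alg, of "set Us \<union> set Vs"] by auto
  have sub: "R.Span K Ws \<subseteq> L" if "set Ws \<subseteq> L" for Ws
    using that
  proof (induction Ws)
    case Nil
    then show ?case using L(1) subfield_zero[of L] by (simp add: finite_galois_def)
  next
    case (Cons w Ws)
    show ?case
    proof
      fix z assume "z \<in> R.Span K (w # Ws)"
      then obtain k v where *: "k \<in> K" "v \<in> R.Span K Ws" "z = k * w + v"
        by (auto simp: R.line_extension_mem_iff)
      have "v \<in> L" using *(2) Cons by auto
      moreover have "w \<in> L" using Cons(2) by simp
      moreover have L': "subfield L \<R>" "K \<subseteq> L" using L(1) by (simp_all add: finite_galois_def)
      moreover have "k \<in> L" using *(1) L'(2) by blast
      ultimately show "z \<in> L" unfolding *(3) using subfield_add[OF L'(1)] subfield_mult[OF L'(1)] by blast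
    qed
  qed
  have "L1 \<subseteq> L" unfolding Us[symmetric] using L(2) by (intro sub) blast
  moreover have "L2 \<subseteq> L" unfolding Vs[symmetric] using L(2) by (intro sub) blast
  ultimately show ?thesis using L(1) by (intro that)
qed

section \<open>The unit group of the inverse limit\<close>

lemma DG_simps:
  "carrier (DG K) = {x \<in> (\<Pi>\<^sub>E L \<in> {L. finite_galois K L}. carrier (D_monoid K L)).
     \<forall>L L'. finite_galois K L \<longrightarrow> finite_galois K L' \<longrightarrow> L \<subseteq> L' \<longrightarrow> D_transition K L (x L') = x L}"
  "x \<otimes>\<^bsub>DG K\<^esub> y = (\<lambda>L\<in>{L. finite_galois K L}. x L \<otimes>\<^bsub>D_monoid K L\<^esub> y L)"
  "\<one>\<^bsub>DG K\<^esub> = (\<lambda>L\<in>{L. finite_galois K L}. \<one>\<^bsub>D_monoid K L\<^esub>)"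
  by (simp_all add: DG_def)

locale abs_galois =
  fixes K :: "'a::{alg_closed_field, field_char_0} set"
  assumes number_field: "number_field K" and algebraic: "\<And>x :: 'a. algebraic_over K x"
begin

abbreviation "GK \<equiv> absolute_galois_group K"

lemma K: "subfield K \<R>"
  using number_field by (simp add: number_field_def)

lemma ext: "finite_galois K L \<Longrightarrow> galois_ext K L"
  using number_field algebraic by (rule galois_ext_finite_galois)

lemma finite_galois_containing:
  assumes "finite S"
  obtains L where "finite_galois K L" "S \<subseteq> L"
  using finite_galois_exists[OF K algebraic assms] .

lemma finite_galoisD:
  assumes "finite_galois K L"
  shows "subfield L \<R>" "K \<subseteq> L"
  using assms by (simp_all add: finite_galois_def)

lemma subfield_UNIV: "subfield (UNIV :: 'a set) \<R>"
  by (simp add: subfield_iff)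

sublocale GK: group GK
  unfolding absolute_galois_group_def by (rule group_galois_group[OF subfield_UNIV]) simp

lemma GK_hom_on: "\<sigma> \<in> carrier GK \<Longrightarrow> hom_on UNIV \<sigma>"
  unfolding absolute_galois_group_def by (rule galois_group_hom_on)

lemma GK_fixes: "\<sigma> \<in> carrier GK \<Longrightarrow> x \<in> K \<Longrightarrow> \<sigma> x = x"
  unfolding absolute_galois_group_def by (rule galois_group_fixes)

lemma GK_mult: "\<sigma> \<in> carrier GK \<Longrightarrow> \<tau> \<in> carrier GK \<Longrightarrow> (\<sigma> \<otimes>\<^bsub>GK\<^esub> \<tau>) x = \<sigma> (\<tau> x)"
  unfolding absolute_galois_group_def by (simp add: galois_group_simps(2) compose_def)

lemma GK_image:
  assumes "\<sigma> \<in> carrier GK" "finite_galois K L"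
  shows "\<sigma> ` L = L"
  using finite_galois_normal[OF K algebraic assms(2) subfield_UNIV subset_UNIV GK_hom_on[OF assms(1)]]
    GK_fixes[OF assms(1)] by simp

lemma GK_restrict:
  assumes "\<sigma> \<in> carrier GK" "finite_galois K L"
  shows "restrict \<sigma> L \<in> carrier (galois_group K L)"
  using finite_galoisD(1)[OF assms(2)] GK_hom_on[OF assms(1)] subset_UNIV GK_image[OF assms]
    finite_galoisD(2)[OF assms(2)] GK_fixes[OF assms(1)] by (rule restrict_galois_group)

text \<open>G_K as the compatible families over the trivial ideal, where the Galois group attached
  to L is that of L itself. Off the index set the family is \<open>undefined\<close>, as the
  extensional product demands.\<close>

definition unit_of :: "('a \<Rightarrow> 'a) \<Rightarrow> 'a set \<Rightarrow> 'a set \<times> ('a \<Rightarrow> 'a)"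
  where "unit_of \<sigma> = (\<lambda>L\<in>{L. finite_galois K L}. (ints K, restrict \<sigma> L))"

lemma unit_of_closed:
  assumes "\<sigma> \<in> carrier GK"
  shows "unit_of \<sigma> \<in> carrier (DG K)"
proof -
  have "(ints K, restrict \<sigma> L) \<in> carrier (D_monoid K L)" if "finite_galois K L" for L
    using galois_ext.mem_D_monoid_ints[OF ext[OF that]] GK_restrict[OF assms that] by simp
  moreover have "D_transition K L (ints K, restrict \<sigma> L') = (ints K, restrict \<sigma> L)"
    if "finite_galois K L" "L \<subseteq> L'" for L L'
    using galois_ext.D_transition_ints[OF ext[OF that(1)]] that(2) by (simp add: Int_absorb1)
  ultimately show ?thesis by (simp add: DG_simps unit_of_def)
qed

lemma unit_of_mult:
  assumes "\<sigma> \<in> carrier GK" "\<tau> \<in> carrier GK"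
  shows "unit_of (\<sigma> \<otimes>\<^bsub>GK\<^esub> \<tau>) = unit_of \<sigma> \<otimes>\<^bsub>DG K\<^esub> unit_of \<tau>"
proof
  fix L
  show "unit_of (\<sigma> \<otimes>\<^bsub>GK\<^esub> \<tau>) L = (unit_of \<sigma> \<otimes>\<^bsub>DG K\<^esub> unit_of \<tau>) L"
  proof (cases "finite_galois K L")
    case True
    interpret galois_ext K L by (rule ext[OF True])
    note mem = GK_restrict[OF assms(1) True] GK_restrict[OF assms(2) True]
    \<comment> \<open>\<open>\<tau>\<close> maps \<open>L\<close> into itself by normality, which
      makes restriction compatible with composition.\<close>
    have "restrict (\<sigma> \<otimes>\<^bsub>GK\<^esub> \<tau>) L x = compose L (restrict \<sigma> L) (restrict \<tau> L) x" for x
      using GK_image[OF assms(2) True] GK_mult[OF assms] by (auto simp: compose_def)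
    then have "restrict (\<sigma> \<otimes>\<^bsub>GK\<^esub> \<tau>) L = restrict \<sigma> L \<otimes>\<^bsub>galois_group K L\<^esub> restrict \<tau> L"
      unfolding galois_group_simps(2)[OF mem] by (rule HOL.ext)
    then show ?thesis
      using True D_mult_ints[OF mem] by (simp add: unit_of_def DG_simps D_monoid_simps)
  qed (simp add: unit_of_def DG_simps)
qed

lemma unit_of_one: "unit_of \<one>\<^bsub>GK\<^esub> = \<one>\<^bsub>DG K\<^esub>"
proof
  fix L
  show "unit_of \<one>\<^bsub>GK\<^esub> L = \<one>\<^bsub>DG K\<^esub> L"
  proof (cases "finite_galois K L")
    case True
    have "restrict \<one>\<^bsub>GK\<^esub> L = \<one>\<^bsub>galois_group K L\<^esub>"
      unfolding absolute_galois_group_def galois_group_simps by simp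
    then show ?thesis
      using True galois_ext.D_monoid_simps(2)[OF ext[OF True]] by (simp add: unit_of_def DG_simps)
  qed (simp add: unit_of_def DG_simps)
qed

lemma unit_of_Units:
  assumes \<sigma>: "\<sigma> \<in> carrier GK"
  shows "unit_of \<sigma> \<in> Units (DG K)"
proof -
  have \<sigma>': "inv\<^bsub>GK\<^esub> \<sigma> \<in> carrier GK" using \<sigma> by (rule GK.inv_closed)
  have "unit_of (inv\<^bsub>GK\<^esub> \<sigma>) \<otimes>\<^bsub>DG K\<^esub> unit_of \<sigma> = \<one>\<^bsub>DG K\<^esub>"
    "unit_of \<sigma> \<otimes>\<^bsub>DG K\<^esub> unit_of (inv\<^bsub>GK\<^esub> \<sigma>) = \<one>\<^bsub>DG K\<^esub>"
    unfolding unit_of_mult[OF \<sigma> \<sigma>', symmetric] unit_of_mult[OF \<sigma>' \<sigma>, symmetric]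
    using GK.l_inv[OF \<sigma>] GK.r_inv[OF \<sigma>] by (simp_all add: unit_of_one)
  then show ?thesis
    unfolding Units_def using unit_of_closed[OF \<sigma>] unit_of_closed[OF \<sigma>'] by blast
qed

text \<open>Every element of the closure lies in a finite Galois extension, so an automorphism is
  determined by its restrictions.\<close>

lemma unit_of_inj: "inj_on unit_of (carrier GK)"
proof (rule inj_onI, rule HOL.ext)
  fix \<sigma> \<tau> x assume "unit_of \<sigma> = unit_of \<tau>"
  obtain L where L: "finite_galois K L" "{x} \<subseteq> L" using finite_galois_containing[of "{x}"] by blast
  have "unit_of \<sigma> L = unit_of \<tau> L" using \<open>unit_of \<sigma> = unit_of \<tau>\<close> by simp
  then have "restrict \<sigma> L = restrict \<tau> L" using L(1) by (simp add: unit_of_def)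
  then have "restrict \<sigma> L x = restrict \<tau> L x" by simp
  then show "\<sigma> x = \<tau> x" using L(2) by simp
qed

text \<open>Each component of a unit is a unit, hence an automorphism \<open>s L\<close> over the
  trivial ideal. The transition maps make the \<open>s L\<close> coherent, and they glue to one
  automorphism of the closure.\<close>

lemma unit_of_surj:
  assumes "x \<in> Units (DG K)"
  obtains \<sigma> where "\<sigma> \<in> carrier GK" "unit_of \<sigma> = x"
proof -
  obtain y where x: "x \<in> carrier (DG K)" and y: "y \<in> carrier (DG K)" and xy: "x \<otimes>\<^bsub>DG K\<^esub> y = \<one>\<^bsub>DG K\<^esub>"
    using assms unfolding Units_def by blast
  have "\<exists>\<sigma>. \<sigma> \<in> carrier (galois_group K L) \<and> x L = (ints K, \<sigma>)" if L: "finite_galois K L" for L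
  proof -
    have "x L \<in> carrier (D_monoid K L)" "y L \<in> carrier (D_monoid K L)"
      using x y L by (auto simp: DG_simps)
    moreover have "(x \<otimes>\<^bsub>DG K\<^esub> y) L = \<one>\<^bsub>DG K\<^esub> L" using xy by simp
    then have "x L \<otimes>\<^bsub>D_monoid K L\<^esub> y L = \<one>\<^bsub>D_monoid K L\<^esub>" using L by (simp add: DG_simps)
    ultimately obtain \<sigma> where "\<sigma> \<in> carrier (galois_group K L)" "x L = (ints K, \<sigma>)"
      by (rule galois_ext.D_monoid_unit[OF ext[OF L]])
    then show ?thesis by blast
  qed
  then obtain s where s: "\<And>L. finite_galois K L \<Longrightarrow> s L \<in> carrier (galois_group K L)"
      "\<And>L. finite_galois K L \<Longrightarrow> x L = (ints K, s L)" by metis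
  have compat: "s L' z = s L z" if "finite_galois K L" "finite_galois K L'" "L \<subseteq> L'" "z \<in> L" for L L' z
  proof -
    have "D_transition K L (x L') = x L" using x that(1-3) unfolding DG_simps by blast
    then have "restrict (s L') L = s L"
      using galois_ext.D_transition_ints[OF ext[OF that(1)]] s(2)[OF that(1)] s(2)[OF that(2)] by simp
    then have "restrict (s L') L z = s L z" by simp
    then show ?thesis using that(4) by simp
  qed
  have "\<exists>L. finite_galois K L \<and> z \<in> L" for z
    using finite_galois_containing[of "{z}"] by (metis finite.emptyI finite.insertI insert_subset)
  then obtain F where F: "\<And>z. finite_galois K (F z)" "\<And>z. z \<in> F z" by metis
  \<comment> \<open>\<open>F z\<close> is an arbitrary finite Galois field around \<open>z\<close>;
    two such fields are compared in a common larger one.\<close>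
  define \<sigma> where "\<sigma> z = s (F z) z" for z
  have \<sigma>: "\<sigma> z = s L z" if L: "finite_galois K L" "z \<in> L" for L z
  proof -
    obtain M where M: "finite_galois K M" "L \<subseteq> M" "F z \<subseteq> M"
      using finite_galois_directed[OF K algebraic L(1) F(1)] by metis
    show ?thesis
      unfolding \<sigma>_def using compat[OF L(1) M(1,2) L(2)] compat[OF F(1) M(1,3) F(2)] by simp
  qed
  \<comment> \<open>Injectivity and the homomorphism laws involve two elements, which have to be
    placed in one field.\<close>
  have pair: "\<exists>L. finite_galois K L \<and> u \<in> L \<and> v \<in> L" for u v
    using finite_galois_containing[of "{u, v}"] by (metis finite.emptyI finite.insertI insert_subset)
  have "\<sigma> \<in> carrier (galois_group K UNIV)"
    unfolding mem_galois_group
  proof (intro conjI ballI)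
    show "\<sigma> \<in> extensional UNIV" by (simp add: extensional_def)
    show "bij_betw \<sigma> UNIV UNIV"
    proof (rule bijI)
      show "inj \<sigma>"
      proof (rule injI)
        fix u v assume "\<sigma> u = \<sigma> v"
        obtain L where L: "finite_galois K L" "u \<in> L" "v \<in> L" using pair by blast
        then have "s L u = s L v" using \<open>\<sigma> u = \<sigma> v\<close> \<sigma> by simp
        then show "u = v" using hom_on_inj[OF finite_galoisD(1)[OF L(1)] galois_group_hom_on[OF s(1)[OF L(1)]]] L(2,3)
          by (meson inj_onD)
      qed
      show "surj \<sigma>"
        unfolding surj_def
      proof
        fix v
        have "v \<in> F v" "bij_betw (s (F v)) (F v) (F v)"
          using F s(1)[OF F(1)] by (simp_all add: mem_galois_group)
        then obtain u where "u \<in> F v" "s (F v) u = v" unfolding bij_betw_def by (metis imageE)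
        then show "\<exists>u. v = \<sigma> u" using \<sigma>[OF F(1)] by metis
      qed
    qed
    fix u v
    obtain L where L: "finite_galois K L" "u \<in> L" "v \<in> L" using pair by blast
    note LF = finite_galoisD[OF L(1)] and h = galois_group_hom_on[OF s(1)[OF L(1)]]
    show "\<sigma> (u + v) = \<sigma> u + \<sigma> v"
      using hom_on_add[OF LF(1) h L(2,3)] \<sigma>[OF L(1)] L(2,3) subfield_add[OF LF(1) L(2,3)] by simp
    show "\<sigma> (u * v) = \<sigma> u * \<sigma> v"
      using hom_on_mult[OF LF(1) h L(2,3)] \<sigma>[OF L(1)] L(2,3) subfield_mult[OF LF(1) L(2,3)] by simp
    show "\<sigma> 1 = 1" using hom_on_one[OF LF(1) h] \<sigma>[OF L(1) subfield_one[OF LF(1)]] by simp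
  next
    fix z assume z: "z \<in> K"
    show "\<sigma> z = z" unfolding \<sigma>_def using s(1)[OF F(1)] z by (rule galois_group_fixes)
  qed
  then have "\<sigma> \<in> carrier GK" by (simp add: absolute_galois_group_def)
  moreover have "unit_of \<sigma> = x"
  proof
    fix L
    show "unit_of \<sigma> L = x L"
    proof (cases "finite_galois K L")
      case True
      have "s L \<in> extensional L" using s(1)[OF True] by (simp add: mem_galois_group)
      then have "restrict \<sigma> L = s L" using \<sigma>[OF True] by (intro extensionalityI[of _ L]) simp_all
      then show ?thesis using True s(2)[OF True] by (simp add: unit_of_def)
    next
      case False
      \<comment> \<open>Off the index set both families take the value
        \<open>undefined\<close>.\<close>
      have "x \<in> extensional {L. finite_galois K L}" using x unfolding DG_simps PiE_def by blast
      with False show ?thesis by (simp add: unit_of_def extensional_def)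
    qed
  qed
  ultimately show ?thesis by (rule that)
qed

lemma unit_of_iso: "unit_of \<in> iso GK (units_of (DG K))"
proof (rule isoI)
  show "unit_of \<in> hom GK (units_of (DG K))"
    by (rule homI) (simp_all add: units_of_carrier units_of_mult unit_of_Units unit_of_mult)
  have "unit_of ` carrier GK = Units (DG K)"
  proof (intro subset_antisym subsetI)
    fix x assume "x \<in> Units (DG K)"
    then obtain \<sigma> where "\<sigma> \<in> carrier GK" "unit_of \<sigma> = x" by (rule unit_of_surj)
    then show "x \<in> unit_of ` carrier GK" by blast
  next
    fix x assume "x \<in> unit_of ` carrier GK"
    then show "x \<in> Units (DG K)" using unit_of_Units by blast
  qed
  then show "bij_betw unit_of (carrier GK) (carrier (units_of (DG K)))"
    using unit_of_inj by (simp add: bij_betw_def units_of_carrier)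
qed

end

theorem proposition5p4:
  fixes K :: "'a::{alg_closed_field, field_char_0} set"
  assumes "number_field K"
    and "\<And>x :: 'a. algebraic_over K x"
  shows "units_of (DG K) \<cong> absolute_galois_group K"
proof -
  interpret abs_galois K using assms by unfold_locales
  \<comment> \<open>\<open>unit_of\<close> runs from G_K to the units; the isomorphism is then
    reversed, its source being a group.\<close>
  have "absolute_galois_group K \<cong> units_of (DG K)" using unit_of_iso by (rule is_isoI)
  then show ?thesis by (rule GK.iso_sym)
qed

end
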